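(* Let $n,N\geq 1$, let $\Omega\subset\mathbb{R}^n$ be a bounded Lipschitz domain, $\lambda>0$, and $f\in L^2(\Omega,\mathbb{R}^N)$. For $\mu>1$ let $\Phi_\mu(t):=\int_0^t\int_0^s(1+r)^{-\mu}\,dr\,ds$ for $t\geq 0$, put $\Psi_\mu:=(\mu-1)\Phi_\mu$ (so that $\lim_{t\to\infty}\Psi_\mu'(t)=1$), and let $u_\mu\in BV(\Omega,\mathbb{R}^N)$ be the unique minimizer of $$\mathcal{K}_\mu[w]:=\int_\Omega\Psi_\mu(|\nabla^a w|)\,dx+|\nabla^s w|(\Omega)+\frac{\lambda}{2}\int_\Omega|w-f|^2\,dx,\quad w\in BV(\Omega,\mathbb{R}^N).$$ Then the problem $$\int_\Omega|\nabla w|+\frac{\lambda}{2}\int_\Omega|w-f|^2\,dx\to\min\ \text{ in } BV(\Omega,\mathbb{R}^N)$$ has a unique minimizer $u$, and as $\mu\to\infty$ we have $\|u_\mu-u\|_{L^p(\Omega,\mathbb{R}^N)}\to 0$ for every $p<\frac{n}{n-1}$ (every $p<\infty$ if $n=1$) and $u_\mu\rightharpoonup u$ weakly in $L^2(\Omega,\mathbb{R}^N)$.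
   Context: $|\cdot|$ is the Euclidean norm of vectors and matrices. For $w\in BV(\Omega,\mathbb{R}^N)$, $\nabla w=\nabla^a w\,\mathcal{L}^n+\nabla^s w$ is the Lebesgue decomposition of the matrix-valued measure $\nabla w$ into absolutely continuous part (density $\nabla^a w$) and singular part $\nabla^s w$ w.r.t. Lebesgue measure; $|\nabla^s w|(\Omega)$ is the total variation of $\nabla^s w$ and $\int_\Omega|\nabla w|$ the total variation of $\nabla w$ on $\Omega$. *)

theory Defs
  imports "HOL-Analysis.Analysis"
begin

text \<open>Points of the domain are in real^'n (so n = CARD('n)), values in real^'m (N = CARD('m)).
  Matrices (gradients) are real^'n^'m: row i is the gradient of the i-th component.
  The norm on real^'n^'m is the Euclidean (Frobenius) norm, and the inner product is the
  Frobenius inner product.\<close>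

text \<open>Bounded Lipschitz domain: nonempty open connected bounded set whose boundary is locally
  the graph of a Lipschitz function (in suitably rotated coordinates: e is the direction of
  the last axis, the function gamma is evaluated on the hyperplane orthogonal to e).\<close>
definition lipschitz_domain :: "(real^'n) set \<Rightarrow> bool" where
  "lipschitz_domain \<Omega> \<longleftrightarrow> open \<Omega> \<and> connected \<Omega> \<and> \<Omega> \<noteq> {} \<and>
     (\<forall>x0\<in>frontier \<Omega>. \<exists>r>0. \<exists>e::real^'n. norm e = 1 \<and>
        (\<exists>(\<gamma>::real^'n \<Rightarrow> real) L. L-lipschitz_on UNIV \<gamma> \<and>
           \<Omega> \<inter> ball x0 r = {x \<in> ball x0 r. x \<bullet> e < \<gamma> (x - (x \<bullet> e) *\<^sub>R e)}))"

definition test_fun :: "(real^'n) set \<Rightarrow> (real^'n \<Rightarrow> real^'n^'m) \<Rightarrow> bool" where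
  "test_fun \<Omega> \<phi> \<longleftrightarrow> compact (closure {x. \<phi> x \<noteq> 0}) \<and> closure {x. \<phi> x \<noteq> 0} \<subseteq> \<Omega> \<and>
     (\<forall>x. \<phi> differentiable (at x)) \<and>
     (\<forall>j. continuous_on UNIV (\<lambda>x. frechet_derivative \<phi> (at x) (axis j 1)))"

definition mdiv :: "(real^'n \<Rightarrow> real^'n^'m) \<Rightarrow> real^'n \<Rightarrow> real^'m" where
  "mdiv \<phi> x = (\<chi> i. \<Sum>j\<in>UNIV. frechet_derivative \<phi> (at x) (axis j 1) $ i $ j)"

text \<open>Polar representation of the distributional gradient: \<nabla>w = \<sigma> \<nu> on \<Omega>, where
  \<nu> = |\<nabla>w| is a finite Borel measure concentrated on \<Omega> and |\<sigma>| = 1 \<nu>-a.e.\<close>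
definition grad_repr :: "(real^'n) set \<Rightarrow> (real^'n \<Rightarrow> real^'m) \<Rightarrow> (real^'n) measure
    \<Rightarrow> (real^'n \<Rightarrow> real^'n^'m) \<Rightarrow> bool" where
  "grad_repr \<Omega> w \<nu> \<sigma> \<longleftrightarrow> sets \<nu> = sets borel \<and> finite_measure \<nu> \<and> emeasure \<nu> (UNIV - \<Omega>) = 0 \<and>
     \<sigma> \<in> borel_measurable borel \<and> (AE x in \<nu>. norm (\<sigma> x) = 1) \<and>
     (\<forall>\<phi>. test_fun \<Omega> \<phi> \<longrightarrow>
        (\<integral>x. w x \<bullet> mdiv \<phi> x \<partial>lebesgue_on \<Omega>) = - (\<integral>x. \<phi> x \<bullet> \<sigma> x \<partial>\<nu>))"

definition is_BV :: "(real^'n) set \<Rightarrow> (real^'n \<Rightarrow> real^'m) \<Rightarrow> bool" where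
  "is_BV \<Omega> w \<longleftrightarrow> integrable (lebesgue_on \<Omega>) w \<and> (\<exists>\<nu> \<sigma>. grad_repr \<Omega> w \<nu> \<sigma>)"

text \<open>Lebesgue decomposition of |\<nabla>w| = \<nu>: \<nu> restricted to the complement of a Lebesgue-null
  Borel set Z has density h w.r.t. Lebesgue measure; then \<nabla>^a w = h \<sigma> and
  \<nabla>^s w = \<sigma> (\<nu> restricted to Z), so |\<nabla>^s w|(\<Omega>) = \<nu>(Z).\<close>
definition leb_decomp :: "(real^'n) measure \<Rightarrow> (real^'n) set \<Rightarrow> (real^'n \<Rightarrow> real) \<Rightarrow> bool" where
  "leb_decomp \<nu> Z h \<longleftrightarrow> Z \<in> sets borel \<and> emeasure lborel Z = 0 \<and>
     h \<in> borel_measurable borel \<and> (\<forall>x. 0 \<le> h x) \<and>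
     density \<nu> (indicator (UNIV - Z)) = density lborel (\<lambda>x. ennreal (h x))"

definition Phi :: "real \<Rightarrow> real \<Rightarrow> real" where
  "Phi \<mu> t = integral {0..t} (\<lambda>s. integral {0..s} (\<lambda>r. (1 + r) powr (- \<mu>)))"

definition Psi :: "real \<Rightarrow> real \<Rightarrow> real" where
  "Psi \<mu> t = (\<mu> - 1) * Phi \<mu> t"

definition K_energy :: "real \<Rightarrow> (real^'n) set \<Rightarrow> real \<Rightarrow> (real^'n \<Rightarrow> real^'m)
    \<Rightarrow> (real^'n \<Rightarrow> real^'m) \<Rightarrow> ennreal \<Rightarrow> bool" where
  "K_energy \<mu> \<Omega> lam f w k \<longleftrightarrow> (\<exists>\<nu> \<sigma> Z h. grad_repr \<Omega> w \<nu> \<sigma> \<and> leb_decomp \<nu> Z h \<and>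
     k = (\<integral>\<^sup>+x. ennreal (Psi \<mu> (norm (h x *\<^sub>R \<sigma> x))) \<partial>lebesgue_on \<Omega>)
         + emeasure \<nu> Z
         + ennreal (lam/2) * (\<integral>\<^sup>+x. ennreal ((norm (w x - f x))\<^sup>2) \<partial>lebesgue_on \<Omega>))"

definition TV_energy :: "(real^'n) set \<Rightarrow> real \<Rightarrow> (real^'n \<Rightarrow> real^'m)
    \<Rightarrow> (real^'n \<Rightarrow> real^'m) \<Rightarrow> ennreal \<Rightarrow> bool" where
  "TV_energy \<Omega> lam f w k \<longleftrightarrow> (\<exists>\<nu> \<sigma>. grad_repr \<Omega> w \<nu> \<sigma> \<and>
     k = emeasure \<nu> UNIV + ennreal (lam/2) * (\<integral>\<^sup>+x. ennreal ((norm (w x - f x))\<^sup>2) \<partial>lebesgue_on \<Omega>))"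

definition BV_minimizer :: "(real^'n) set \<Rightarrow> ((real^'n \<Rightarrow> real^'m) \<Rightarrow> ennreal \<Rightarrow> bool)
    \<Rightarrow> (real^'n \<Rightarrow> real^'m) \<Rightarrow> bool" where
  "BV_minimizer \<Omega> E w \<longleftrightarrow> is_BV \<Omega> w \<and>
     (\<forall>v k k'. is_BV \<Omega> v \<longrightarrow> E w k \<longrightarrow> E v k' \<longrightarrow> k \<le> k')"

end

theory Submission
  imports Defs "HOL-Probability.Probability"
begin

text \<open>
  Since \<open>\<Psi>\<^sub>\<mu>(t) \<le> t \<le> \<Psi>\<^sub>\<mu>(t) + 1/(\<mu>-2)\<close>, the energies satisfy
  \<open>K\<^sub>\<mu> \<le> J \<le> K\<^sub>\<mu> + |\<Omega>|/(\<mu>-2)\<close>, where \<open>J\<close> is the total variation energy, so \<open>u\<^sub>\<mu>\<close> minimizes \<open>J\<close> up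
  to \<open>|\<Omega>|/(\<mu>-2)\<close>. The fidelity term makes \<open>J\<close> strongly convex in \<open>L\<^sup>2\<close>; hence almost minimizers
  are Cauchy in \<open>L\<^sup>2\<close>, their limit is the unique minimizer, and \<open>u\<^sub>\<mu>\<close> converges to it strongly
  in \<open>L\<^sup>2\<close>. No compact embedding of \<open>BV\<close> is needed. As \<open>n/(n-1) \<le> 2\<close> for \<open>n \<ge> 2\<close>, this gives all
  the claimed exponents; for \<open>n = 1\<close> one interpolates with a uniform \<open>L\<^sup>\<infinity>\<close> bound, obtained by duality
  from the primitives of mean-zero test functions.

  The total variation is lower semicontinuous in \<open>L\<^sup>2\<close> because bounded sequences of measures on a
  compact subset of Euclidean space converge weakly along a subsequence. This is reduced to Helly's
  theorem on the real line by pulling the measures back along a space-filling curve with a Borel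
  right inverse.
\<close>


section \<open>Sums of measures and the Lebesgue decomposition\<close>

definition add_measure :: "'a measure \<Rightarrow> 'a measure \<Rightarrow> 'a measure" where
  "add_measure M N = measure_of (space M) (sets M) (\<lambda>A. emeasure M A + emeasure N A)"

lemma sets_add_measure [simp, measurable_cong]: "sets (add_measure M N) = sets M"
  by (simp add: add_measure_def)

lemma space_add_measure [simp]: "space (add_measure M N) = space M"
  by (simp add: add_measure_def)

lemma emeasure_add_measure:
  assumes "sets N = sets M" "A \<in> sets M"
  shows "emeasure (add_measure M N) A = emeasure M A + emeasure N A"
proof (rule emeasure_measure_of[OF add_measure_def])
  show "countably_additive (sets (add_measure M N)) (\<lambda>A. emeasure M A + emeasure N A)"
  proof (rule countably_additiveI)
    fix A :: "nat \<Rightarrow> 'a set"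
    assume A: "range A \<subseteq> sets (add_measure M N)" "disjoint_family A"
    then have "(\<Sum>i. emeasure M (A i) + emeasure N (A i)) = (\<Sum>i. emeasure M (A i)) + (\<Sum>i. emeasure N (A i))"
      by (intro suminf_add[symmetric]) auto
    also have "\<dots> = emeasure M (\<Union> (range A)) + emeasure N (\<Union> (range A))"
      using A assms by (simp add: suminf_emeasure)
    finally show "(\<Sum>i. emeasure M (A i) + emeasure N (A i)) = emeasure M (\<Union> (range A)) + emeasure N (\<Union> (range A))" .
  qed
qed (use assms sets.space_closed in \<open>auto simp: positive_def\<close>)

lemma nn_integral_add_measure:
  assumes sets: "sets N = sets M" and "f \<in> borel_measurable M"
  shows "(\<integral>\<^sup>+x. f x \<partial>add_measure M N) = (\<integral>\<^sup>+x. f x \<partial>M) + (\<integral>\<^sup>+x. f x \<partial>N)"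
  using assms(2)
proof (induction rule: borel_measurable_induct)
  case (cong f g)
  then show ?case
    using sets_eq_imp_space_eq[OF sets] by (simp cong: nn_integral_cong_simp)
next
  case (set A)
  then show ?case using sets by (simp add: emeasure_add_measure)
next
  case (mult u c)
  then have "u \<in> borel_measurable (add_measure M N)" "u \<in> borel_measurable N"
    using sets by (auto cong: measurable_cong_sets)
  with mult show ?case by (simp add: nn_integral_cmult distrib_left)
next
  case (add u v)
  then have "u \<in> borel_measurable (add_measure M N)" "u \<in> borel_measurable N"
    "v \<in> borel_measurable (add_measure M N)" "v \<in> borel_measurable N"
    using sets by (auto cong: measurable_cong_sets)
  with add show ?case by (simp add: nn_integral_add ac_simps)
next
  case (seq U)
  then have "\<And>i. U i \<in> borel_measurable (add_measure M N)" "\<And>i. U i \<in> borel_measurable N"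
    using sets by (auto cong: measurable_cong_sets)
  moreover have "incseq (\<lambda>i. \<integral>\<^sup>+ x. U i x \<partial>K)" for K
    using seq by (auto simp: incseq_def le_fun_def intro!: nn_integral_mono)
  ultimately show ?case
    using seq unfolding SUP_apply
    by (simp add: nn_integral_monotone_convergence_SUP ennreal_SUP_add)
qed

lemma integrable_add_measure_iff:
  fixes f :: "'a \<Rightarrow> 'b::{banach, second_countable_topology}"
  assumes "sets N = sets M"
  shows "integrable (add_measure M N) f \<longleftrightarrow> integrable M f \<and> integrable N f"
proof -
  have "f \<in> borel_measurable (add_measure M N) \<longleftrightarrow> f \<in> borel_measurable M"
     "f \<in> borel_measurable N \<longleftrightarrow> f \<in> borel_measurable M"
    using assms by (auto cong: measurable_cong_sets)
  then show ?thesis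
    by (auto simp: integrable_iff_bounded nn_integral_add_measure[OF assms])
qed

lemma integral_add_measure:
  fixes f :: "'a \<Rightarrow> real"
  assumes sets: "sets N = sets M" and f: "integrable M f" "integrable N f"
  shows "(\<integral>x. f x \<partial>add_measure M N) = (\<integral>x. f x \<partial>M) + (\<integral>x. f x \<partial>N)"
proof -
  have [measurable]: "f \<in> borel_measurable M" "f \<in> borel_measurable N" using f by auto
  have "integrable (add_measure M N) f" using integrable_add_measure_iff[OF sets] f by blast
  moreover have "(\<integral>\<^sup>+x. ennreal (f x) \<partial>K) < \<infinity>" "(\<integral>\<^sup>+x. ennreal (- f x) \<partial>K) < \<infinity>" if "integrable K f" for K
    using that by (auto simp: real_integrable_def top.not_eq_extremum)
  ultimately show ?thesis
    using f by (simp add: real_lebesgue_integral_def nn_integral_add_measure[OF sets] enn2real_plus)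
qed

lemma finite_measure_add_measure:
  assumes "sets N = sets M" "finite_measure M" "finite_measure N"
  shows "finite_measure (add_measure M N)"
  using assms finite_measure.emeasure_finite
  by (intro finite_measureI) (auto simp: emeasure_add_measure)

lemma exists_null_set_absolutely_continuous_off:
  assumes "finite_measure N" and sets: "sets N = sets M"
  obtains Z where "Z \<in> null_sets M" "absolutely_continuous M (density N (indicator (space M - Z)))"
proof -
  interpret N: finite_measure N by fact
  have "null_sets M \<noteq> {}" by blast
  from ennreal_SUP_countable_SUP[OF this, of "emeasure N"] obtain g :: "nat \<Rightarrow> ennreal"
    where g: "range g \<subseteq> emeasure N ` null_sets M" "(SUP A\<in>null_sets M. emeasure N A) = (SUP i. g i)"
    by auto
  have "\<forall>i. \<exists>B. B \<in> null_sets M \<and> g i = emeasure N B" using g(1) by blast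
  then obtain A where A: "\<And>i. A i \<in> null_sets M" "\<And>i. g i = emeasure N (A i)" by metis
  define Z where "Z = (\<Union>i. A i)"
  have Z: "Z \<in> null_sets M" unfolding Z_def using A(1) by blast
  have maximal: "emeasure N B \<le> emeasure N Z" if "B \<in> null_sets M" for B
  proof -
    have "emeasure N B \<le> (SUP i. emeasure N (A i))"
      unfolding A(2)[symmetric] g(2)[symmetric] using that by (rule SUP_upper)
    also have "\<dots> \<le> emeasure N Z"
      using A(1) sets by (intro SUP_least emeasure_mono) (auto simp: Z_def)
    finally show ?thesis .
  qed
  have "B \<in> null_sets (density N (indicator (space M - Z)))" if B: "B \<in> null_sets M" for B
  proof -
    have [measurable]: "B \<in> sets N" "Z \<in> sets N" "space M - Z \<in> sets N" using B Z sets by auto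
    have "emeasure N Z + emeasure N (B - Z) = emeasure N (Z \<union> B)"
      by (subst plus_emeasure) auto
    also have "\<dots> \<le> emeasure N Z + 0" using maximal[of "Z \<union> B"] B Z by auto
    finally have "emeasure N (B - Z) = 0"
      using N.emeasure_finite[of Z] by (subst (asm) ennreal_add_left_cancel_le) auto
    moreover have "emeasure (density N (indicator (space M - Z))) B = emeasure N ((space M - Z) \<inter> B)"
      using sets_eq_imp_space_eq[OF sets] by (intro emeasure_restricted) auto
    moreover have "(space M - Z) \<inter> B = B - Z"
      using sets.sets_into_space[of B N] sets_eq_imp_space_eq[OF sets] by auto
    ultimately show ?thesis by (simp add: null_sets_def)
  qed
  with Z that show ?thesis unfolding absolutely_continuous_def by blast
qed

lemma exists_real_density:
  assumes "sigma_finite_measure M" and N: "finite_measure N" and sets: "sets N = sets M"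
    and ac: "absolutely_continuous M N"
  obtains d where "d \<in> borel_measurable M" "\<And>x. 0 \<le> d x" "integrable M d"
    "N = density M (\<lambda>x. ennreal (d x))"
proof -
  interpret sigma_finite_measure M by fact
  obtain d where d: "d \<in> borel_measurable M" "AE x in M. RN_deriv M N x = ennreal (d x)" "\<And>x. 0 \<le> d x"
    using real_RN_deriv[OF N ac sets] by blast
  have "density M (RN_deriv M N) = density M (\<lambda>x. ennreal (d x))"
    using d by (intro density_cong) auto
  then have N_eq: "N = density M (\<lambda>x. ennreal (d x))" using density_RN_deriv[OF ac sets] by simp
  have "(\<integral>\<^sup>+x. ennreal (d x) \<partial>M) = emeasure N (space M)"
    unfolding N_eq using d(1) by (subst emeasure_density) (auto intro!: nn_integral_cong)
  also have "\<dots> < \<infinity>" using finite_measure.emeasure_finite[OF N] by (simp add: less_top)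
  finally have "integrable M d" using d(1,3) by (intro integrableI_nonneg) auto
  with d(1,3) N_eq that show ?thesis by blast
qed

lemma exists_leb_decomp:
  fixes \<nu> :: "(real^'n) measure"
  assumes "finite_measure \<nu>" and sets [measurable_cong]: "sets \<nu> = sets borel"
  obtains Z h where "leb_decomp \<nu> Z h"
proof -
  obtain Z where Z: "Z \<in> null_sets lborel"
    and ac: "absolutely_continuous lborel (density \<nu> (indicator (UNIV - Z)))"
    using exists_null_set_absolutely_continuous_off[of \<nu> lborel] assms by auto
  let ?\<rho> = "density \<nu> (indicator (UNIV - Z))"
  have [measurable]: "Z \<in> sets borel" using Z by auto
  have "finite_measure ?\<rho>"
    by (rule finite_measure.finite_measure_restricted) (use sets in \<open>auto intro: assms\<close>)
  moreover have "sets ?\<rho> = sets lborel" by (simp add: sets)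
  ultimately obtain h where "h \<in> borel_measurable lborel" "\<And>x. 0 \<le> h x" "?\<rho> = density lborel (\<lambda>x. ennreal (h x))"
    using exists_real_density[OF lborel.sigma_finite_measure_axioms _ _ ac] by blast
  with Z have "leb_decomp \<nu> Z h" unfolding leb_decomp_def by auto
  then show ?thesis by (rule that)
qed

section \<open>Square integrable functions\<close>

definition square_integrable :: "'a measure \<Rightarrow> ('a \<Rightarrow> 'b::euclidean_space) \<Rightarrow> bool" where
  "square_integrable M f \<longleftrightarrow> f \<in> borel_measurable M \<and> integrable M (\<lambda>x. (norm (f x))\<^sup>2)"

definition L2_norm :: "'a measure \<Rightarrow> ('a \<Rightarrow> 'b::euclidean_space) \<Rightarrow> real" where
  "L2_norm M f = sqrt (\<integral>x. (norm (f x))\<^sup>2 \<partial>M)"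

lemma square_integrableD:
  assumes "square_integrable M f"
  shows "f \<in> borel_measurable M" "integrable M (\<lambda>x. (norm (f x))\<^sup>2)"
  using assms by (auto simp: square_integrable_def)

lemma square_integrable_scaleR:
  "square_integrable M f \<Longrightarrow> square_integrable M (\<lambda>x. c *\<^sub>R f x)"
  by (auto simp: square_integrable_def power_mult_distrib)

lemma square_integrable_add:
  fixes f g :: "'a \<Rightarrow> 'b::euclidean_space"
  assumes f: "square_integrable M f" and g: "square_integrable M g"
  shows "square_integrable M (\<lambda>x. f x + g x)"
  unfolding square_integrable_def
proof
  note [measurable] = square_integrableD(1)[OF f] square_integrableD(1)[OF g]
  show "(\<lambda>x. f x + g x) \<in> borel_measurable M" by measurable
  show "integrable M (\<lambda>x. (norm (f x + g x))\<^sup>2)"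
  proof (rule Bochner_Integration.integrable_bound)
    show "integrable M (\<lambda>x. 2 * (norm (f x))\<^sup>2 + 2 * (norm (g x))\<^sup>2)"
      using square_integrableD(2)[OF f] square_integrableD(2)[OF g] by simp
    have "(norm (a + b))\<^sup>2 \<le> 2 * (norm a)\<^sup>2 + 2 * (norm b)\<^sup>2" for a b :: 'b
      using zero_le_power2[of "norm (a - b)"]
      unfolding power2_norm_eq_inner by (simp add: inner_add inner_diff inner_commute)
    then show "AE x in M. norm ((norm (f x + g x))\<^sup>2) \<le> norm (2 * (norm (f x))\<^sup>2 + 2 * (norm (g x))\<^sup>2)"
      by simp
  qed measurable
qed

lemma square_integrable_diff:
  assumes "square_integrable M f" "square_integrable M g"
  shows "square_integrable M (\<lambda>x. f x - g x)"
  using square_integrable_add[OF assms(1) square_integrable_scaleR[OF assms(2), of "-1"]] by simp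

lemma integrable_inner_square_integrable:
  fixes f g :: "'a \<Rightarrow> 'b::euclidean_space"
  assumes f: "square_integrable M f" and g: "square_integrable M g"
  shows "integrable M (\<lambda>x. f x \<bullet> g x)"
proof (rule Bochner_Integration.integrable_bound)
  note [measurable] = square_integrableD(1)[OF f] square_integrableD(1)[OF g]
  show "(\<lambda>x. f x \<bullet> g x) \<in> borel_measurable M" by measurable
  show "integrable M (\<lambda>x. (norm (f x))\<^sup>2 + (norm (g x))\<^sup>2)"
    using square_integrableD(2)[OF f] square_integrableD(2)[OF g] by simp
  have "\<bar>a \<bullet> b\<bar> \<le> (norm a)\<^sup>2 + (norm b)\<^sup>2" for a b :: 'b
    using Cauchy_Schwarz_ineq2[of a b] sum_squares_bound[of "norm a" "norm b"]
      mult_nonneg_nonneg[of "norm a" "norm b"] by simp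
  then show "AE x in M. norm (f x \<bullet> g x) \<le> norm ((norm (f x))\<^sup>2 + (norm (g x))\<^sup>2)" by simp
qed

lemma (in finite_measure) square_integrable_const: "square_integrable M (\<lambda>_. c)"
  by (simp add: square_integrable_def)

lemma (in finite_measure) integrable_of_square_integrable:
  assumes "square_integrable M f"
  shows "integrable M f"
proof (rule integrable_norm_cancel)
  note [measurable] = square_integrableD(1)[OF assms]
  show "integrable M (\<lambda>x. norm (f x))"
    by (rule square_integrable_imp_integrable) (use square_integrableD(2)[OF assms] in measurable)
  show "f \<in> borel_measurable M" by measurable
qed

lemma L2_norm_nonneg: "0 \<le> L2_norm M f"
  by (simp add: L2_norm_def)

lemma L2_norm_power2: "(L2_norm M f)\<^sup>2 = (\<integral>x. (norm (f x))\<^sup>2 \<partial>M)"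
  by (simp add: L2_norm_def)

lemma L2_norm_minus_commute: "L2_norm M (\<lambda>x. f x - g x) = L2_norm M (\<lambda>x. g x - f x)"
  by (simp add: L2_norm_def norm_minus_commute)

lemma nn_integral_norm_power2:
  assumes "square_integrable M f"
  shows "(\<integral>\<^sup>+x. ennreal ((norm (f x))\<^sup>2) \<partial>M) = ennreal ((L2_norm M f)\<^sup>2)"
  unfolding L2_norm_power2
  using square_integrableD(2)[OF assms] by (rule nn_integral_eq_integral) simp

lemma L2_norm_add_power2:
  assumes f: "square_integrable M f" and g: "square_integrable M g"
  shows "(L2_norm M (\<lambda>x. f x + g x))\<^sup>2 = (L2_norm M f)\<^sup>2 + 2 * (\<integral>x. f x \<bullet> g x \<partial>M) + (L2_norm M g)\<^sup>2"
proof -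
  have "(norm (f x + g x))\<^sup>2 = (norm (f x))\<^sup>2 + 2 * (f x \<bullet> g x) + (norm (g x))\<^sup>2" for x
    by (simp add: power2_norm_eq_inner inner_add inner_commute)
  then show ?thesis
    unfolding L2_norm_power2
    using square_integrableD(2)[OF f] square_integrableD(2)[OF g] integrable_inner_square_integrable[OF f g]
    by simp
qed

lemma L2_norm_parallelogram:
  assumes f: "square_integrable M f" and g: "square_integrable M g"
  shows "(L2_norm M (\<lambda>x. f x + g x))\<^sup>2 + (L2_norm M (\<lambda>x. f x - g x))\<^sup>2
    = 2 * (L2_norm M f)\<^sup>2 + 2 * (L2_norm M g)\<^sup>2"
  using L2_norm_add_power2[OF f g] L2_norm_add_power2[OF f square_integrable_scaleR[OF g, of "-1"]]
  by (simp add: L2_norm_power2)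

lemma L2_norm_scaleR: "L2_norm M (\<lambda>x. c *\<^sub>R f x) = \<bar>c\<bar> * L2_norm M f"
  by (simp add: L2_norm_def power_mult_distrib real_sqrt_mult)

lemma abs_integral_inner_le_L2_norm:
  assumes f: "square_integrable M f" and g: "square_integrable M g"
  shows "\<bar>\<integral>x. f x \<bullet> g x \<partial>M\<bar> \<le> L2_norm M f * L2_norm M g"
proof -
  define a where "a = L2_norm M f"
  define b where "b = L2_norm M g"
  define I where "I = (\<integral>x. f x \<bullet> g x \<partial>M)"
  have quadratic: "0 \<le> a\<^sup>2 + 2 * t * I + t\<^sup>2 * b\<^sup>2" for t
  proof -
    have "0 \<le> (L2_norm M (\<lambda>x. f x + t *\<^sub>R g x))\<^sup>2" by simp
    also have "\<dots> = a\<^sup>2 + 2 * t * I + t\<^sup>2 * b\<^sup>2"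
      using L2_norm_add_power2[OF f square_integrable_scaleR[OF g, of t]]
      by (simp add: a_def b_def I_def L2_norm_scaleR power_mult_distrib)
    finally show ?thesis .
  qed
  have "I\<^sup>2 \<le> (a * b)\<^sup>2"
  proof (cases "b = 0")
    case True
    then have "I = 0"
      using quadratic[of "- (a\<^sup>2 + 1) / (2 * I)"] by (cases "I = 0") (auto simp: field_simps)
    then show ?thesis by simp
  next
    case False
    then have "0 \<le> a\<^sup>2 - I\<^sup>2 / b\<^sup>2"
      using quadratic[of "- I / b\<^sup>2"] by (simp add: field_simps power2_eq_square)
    then show ?thesis
      using False by (simp add: divide_le_eq power_mult_distrib)
  qed
  then show ?thesis
    using abs_le_square_iff[of I "a * b"] L2_norm_nonneg[of M f] L2_norm_nonneg[of M g]
    by (simp add: a_def b_def I_def)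
qed

lemma L2_norm_triangle_ineq:
  assumes f: "square_integrable M f" and g: "square_integrable M g"
  shows "L2_norm M (\<lambda>x. f x + g x) \<le> L2_norm M f + L2_norm M g"
proof (rule power2_le_imp_le)
  show "(L2_norm M (\<lambda>x. f x + g x))\<^sup>2 \<le> (L2_norm M f + L2_norm M g)\<^sup>2"
    using abs_integral_inner_le_L2_norm[OF f g] unfolding L2_norm_add_power2[OF f g] power2_sum by simp
qed (simp add: L2_norm_nonneg)

lemma abs_L2_norm_diff_le:
  assumes f: "square_integrable M f" and g: "square_integrable M g"
  shows "\<bar>L2_norm M f - L2_norm M g\<bar> \<le> L2_norm M (\<lambda>x. f x - g x)"
  using L2_norm_triangle_ineq[OF square_integrable_diff[OF f g] g]
    L2_norm_triangle_ineq[OF square_integrable_diff[OF g f] f]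
  by (simp add: L2_norm_minus_commute[of M g f])

lemma integral_inner_tendsto_of_L2:
  assumes f: "\<forall>\<^sub>F i in F. square_integrable M (f i)" and h: "square_integrable M h"
    and lim: "((\<lambda>i. L2_norm M (\<lambda>x. f i x - h x)) \<longlongrightarrow> 0) F" and g: "square_integrable M g"
  shows "((\<lambda>i. \<integral>x. f i x \<bullet> g x \<partial>M) \<longlongrightarrow> (\<integral>x. h x \<bullet> g x \<partial>M)) F"
proof (rule LIM_zero_cancel, rule Lim_null_comparison)
  show "((\<lambda>i. L2_norm M (\<lambda>x. f i x - h x) * L2_norm M g) \<longlongrightarrow> 0) F"
    using tendsto_mult_right[OF lim, of "L2_norm M g"] by simp
  show "\<forall>\<^sub>F i in F. norm ((\<integral>x. f i x \<bullet> g x \<partial>M) - (\<integral>x. h x \<bullet> g x \<partial>M))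
      \<le> L2_norm M (\<lambda>x. f i x - h x) * L2_norm M g"
    using f
  proof eventually_elim
    case (elim i)
    have "(\<integral>x. f i x \<bullet> g x \<partial>M) - (\<integral>x. h x \<bullet> g x \<partial>M) = (\<integral>x. (f i x - h x) \<bullet> g x \<partial>M)"
      using integrable_inner_square_integrable[OF elim g] integrable_inner_square_integrable[OF h g]
      by (simp add: inner_diff_left)
    then show ?case
      using abs_integral_inner_le_L2_norm[OF square_integrable_diff[OF elim h] g] by simp
  qed
qed

lemma AE_eq_of_L2_norm_diff_eq_0:
  assumes "square_integrable M f" "square_integrable M g" "L2_norm M (\<lambda>x. f x - g x) = 0"
  shows "AE x in M. f x = g x"
proof -
  have "integrable M (\<lambda>x. (norm (f x - g x))\<^sup>2)"
    using square_integrableD(2)[OF square_integrable_diff[OF assms(1,2)]] .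
  moreover have "(\<integral>x. (norm (f x - g x))\<^sup>2 \<partial>M) = 0"
    using assms(3) by (simp add: L2_norm_def)
  ultimately have "AE x in M. (norm (f x - g x))\<^sup>2 = 0"
    by (subst (asm) integral_nonneg_eq_0_iff_AE) auto
  then show ?thesis by eventually_elim simp
qed

lemma (in finite_measure) integral_norm_le_L2_norm:
  fixes f :: "'a \<Rightarrow> 'b::euclidean_space"
  assumes "square_integrable M f"
  shows "(\<integral>x. norm (f x) \<partial>M) \<le> sqrt (measure M (space M)) * L2_norm M f"
proof -
  have "square_integrable M (\<lambda>x. norm (f x))"
    unfolding square_integrable_def using square_integrableD[OF assms] by (simp add: borel_measurable_norm)
  then have "\<bar>\<integral>x. 1 \<bullet> norm (f x) \<partial>M\<bar> \<le> L2_norm M (\<lambda>_. 1 :: real) * L2_norm M (\<lambda>x. norm (f x))"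
    by (intro abs_integral_inner_le_L2_norm square_integrable_const)
  then show ?thesis by (simp add: L2_norm_def)
qed

lemma L2_norm_le_of_AE_tendsto:
  fixes f :: "nat \<Rightarrow> 'a \<Rightarrow> 'b::euclidean_space"
  assumes f: "\<And>i. square_integrable M (f i)" and g: "g \<in> borel_measurable M"
    and lim: "AE x in M. (\<lambda>i. f i x) \<longlonglongrightarrow> g x"
    and bound: "\<forall>\<^sub>F i in sequentially. L2_norm M (f i) \<le> C"
  shows "square_integrable M g" "L2_norm M g \<le> C"
proof -
  note [measurable] = g square_integrableD(1)[OF f]
  obtain i where "L2_norm M (f i) \<le> C"
    using eventually_happens[OF bound] by auto
  then have C: "0 \<le> C" using L2_norm_nonneg[of M "f i"] by linarith
  have "(\<integral>\<^sup>+x. ennreal ((norm (g x))\<^sup>2) \<partial>M) = (\<integral>\<^sup>+x. liminf (\<lambda>i. ennreal ((norm (f i x))\<^sup>2)) \<partial>M)"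
  proof (rule nn_integral_cong_AE)
    show "AE x in M. ennreal ((norm (g x))\<^sup>2) = liminf (\<lambda>i. ennreal ((norm (f i x))\<^sup>2))"
      using lim
    proof eventually_elim
      case (elim x)
      then have "(\<lambda>i. ennreal ((norm (f i x))\<^sup>2)) \<longlonglongrightarrow> ennreal ((norm (g x))\<^sup>2)"
        by (intro tendsto_intros tendsto_ennrealI)
      then show ?case by (intro lim_imp_Liminf[symmetric]) auto
    qed
  qed
  also have "\<dots> \<le> liminf (\<lambda>i. \<integral>\<^sup>+x. ennreal ((norm (f i x))\<^sup>2) \<partial>M)"
    by (rule nn_integral_liminf) simp
  also have "\<dots> \<le> limsup (\<lambda>i. \<integral>\<^sup>+x. ennreal ((norm (f i x))\<^sup>2) \<partial>M)"
    by (rule Liminf_le_Limsup) simp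
  also have "\<dots> \<le> ennreal (C\<^sup>2)"
    using bound by (intro Limsup_bounded)
      (auto elim!: eventually_mono simp: nn_integral_norm_power2[OF f] L2_norm_nonneg intro!: ennreal_leI power_mono)
  finally have fatou: "(\<integral>\<^sup>+x. ennreal ((norm (g x))\<^sup>2) \<partial>M) \<le> ennreal (C\<^sup>2)" .
  show sq: "square_integrable M g"
    unfolding square_integrable_def
    using le_less_trans[OF fatou ennreal_less_top] by (auto intro: integrableI_nonneg)
  show "L2_norm M g \<le> C"
    using fatou C unfolding nn_integral_norm_power2[OF sq] by (auto intro: power2_le_imp_le)
qed

lemma (in finite_measure) L2_Cauchy_AE_convergent_subseq:
  fixes f :: "nat \<Rightarrow> 'a \<Rightarrow> 'b::euclidean_space"
  assumes f: "\<And>i. square_integrable M (f i)"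
    and cauchy: "\<And>e. 0 < e \<Longrightarrow> \<exists>N. \<forall>i\<ge>N. \<forall>j\<ge>N. L2_norm M (\<lambda>x. f i x - f j x) < e"
  obtains r g where "strict_mono r" "g \<in> borel_measurable M" "AE x in M. (\<lambda>i. f (r i) x) \<longlonglongrightarrow> g x"
proof -
  define S where "S = sqrt (measure M (space M)) + 1"
  have S: "0 < S" by (simp add: S_def add_nonneg_pos)
  note [measurable] = square_integrableD(1)[OF f]
  obtain r where r: "strict_mono r" "AE x in M. Cauchy (\<lambda>i. f (r i) x)"
  proof (rule cauchy_L1_AE_cauchy_subseq[OF integrable_of_square_integrable[OF f]])
    fix e :: real assume "0 < e"
    then have "0 < e / S" using S by simp
    from cauchy[OF this] obtain N
      where N: "\<And>i j. N \<le> i \<Longrightarrow> N \<le> j \<Longrightarrow> L2_norm M (\<lambda>x. f i x - f j x) < e / S"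
      by blast
    have "(\<integral>x. norm (f i x - f j x) \<partial>M) < e" if "N \<le> i" "N \<le> j" for i j
    proof -
      have "(\<integral>x. norm (f i x - f j x) \<partial>M) \<le> sqrt (measure M (space M)) * L2_norm M (\<lambda>x. f i x - f j x)"
        by (intro integral_norm_le_L2_norm square_integrable_diff f)
      also have "\<dots> \<le> S * L2_norm M (\<lambda>x. f i x - f j x)"
        by (intro mult_right_mono L2_norm_nonneg) (simp add: S_def)
      also have "\<dots> < S * (e / S)" by (rule mult_strict_left_mono[OF N[OF that] S])
      also have "\<dots> = e" using S by simp
      finally show ?thesis .
    qed
    then show "\<exists>N. \<forall>i\<ge>N. \<forall>j\<ge>N. (\<integral>x. norm (f i x - f j x) \<partial>M) < e" by blast
  qed blast
  have "(\<lambda>x. lim (\<lambda>i. f (r i) x)) \<in> borel_measurable M"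
    by (rule borel_measurable_lim_metric) simp
  moreover have "AE x in M. (\<lambda>i. f (r i) x) \<longlonglongrightarrow> lim (\<lambda>i. f (r i) x)"
    using r(2) by eventually_elim (simp add: Cauchy_convergent_iff convergent_LIMSEQ_iff)
  ultimately show ?thesis using r(1) that by blast
qed

lemma L2_norm_diff_le_of_AE_convergent_subseq:
  fixes f :: "nat \<Rightarrow> 'a \<Rightarrow> 'b::euclidean_space"
  assumes f: "\<And>i. square_integrable M (f i)" and r: "strict_mono r" and g: "g \<in> borel_measurable M"
    and lim: "AE x in M. (\<lambda>i. f (r i) x) \<longlonglongrightarrow> g x"
    and N: "\<And>i j. N \<le> i \<Longrightarrow> N \<le> j \<Longrightarrow> L2_norm M (\<lambda>x. f i x - f j x) < e" and k: "N \<le> k"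
  shows "square_integrable M (\<lambda>x. f k x - g x)" "L2_norm M (\<lambda>x. f k x - g x) \<le> e"
proof -
  have diff_lim: "AE x in M. (\<lambda>i. f k x - f (r i) x) \<longlonglongrightarrow> f k x - g x"
    using lim by eventually_elim (intro tendsto_intros)
  have bound: "\<forall>\<^sub>F i in sequentially. L2_norm M (\<lambda>x. f k x - f (r i) x) \<le> e"
    unfolding eventually_sequentially
  proof (intro exI[of _ N] allI impI)
    fix i assume "N \<le> i"
    then have "N \<le> r i" using seq_suble[OF r, of i] by simp
    then show "L2_norm M (\<lambda>x. f k x - f (r i) x) \<le> e" using N[OF k] by (intro less_imp_le)
  qed
  have diff_meas: "(\<lambda>x. f k x - g x) \<in> borel_measurable M"
    using square_integrableD(1)[OF f] g by simp
  note limit = L2_norm_le_of_AE_tendsto[OF square_integrable_diff[OF f f] diff_meas diff_lim bound]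
  show "square_integrable M (\<lambda>x. f k x - g x)" "L2_norm M (\<lambda>x. f k x - g x) \<le> e" by (rule limit)+
qed

lemma (in finite_measure) L2_complete:
  fixes f :: "nat \<Rightarrow> 'a \<Rightarrow> 'b::euclidean_space"
  assumes f: "\<And>i. square_integrable M (f i)"
    and cauchy: "\<And>e. 0 < e \<Longrightarrow> \<exists>N. \<forall>i\<ge>N. \<forall>j\<ge>N. L2_norm M (\<lambda>x. f i x - f j x) < e"
  obtains g where "square_integrable M g" "(\<lambda>i. L2_norm M (\<lambda>x. f i x - g x)) \<longlonglongrightarrow> 0"
proof -
  obtain r g where r: "strict_mono r" and g: "g \<in> borel_measurable M"
    and lim: "AE x in M. (\<lambda>i. f (r i) x) \<longlonglongrightarrow> g x"
    by (rule L2_Cauchy_AE_convergent_subseq[OF f cauchy])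
  note tail = L2_norm_diff_le_of_AE_convergent_subseq[OF f r g lim]
  obtain N where N: "\<And>i j. N \<le> i \<Longrightarrow> N \<le> j \<Longrightarrow> L2_norm M (\<lambda>x. f i x - f j x) < 1"
    using cauchy[OF zero_less_one] by blast
  have "square_integrable M (\<lambda>x. f N x - g x)" using N by (rule tail(1)[where N = N and e = 1]) simp_all
  from square_integrable_diff[OF f[of N] this] have "square_integrable M g" by simp
  moreover have "(\<lambda>k. L2_norm M (\<lambda>x. f k x - g x)) \<longlonglongrightarrow> 0"
  proof (rule LIMSEQ_I)
    fix e :: real assume "0 < e"
    then have "0 < e / 2" by simp
    from cauchy[OF this] obtain N
      where N: "\<And>i j. N \<le> i \<Longrightarrow> N \<le> j \<Longrightarrow> L2_norm M (\<lambda>x. f i x - f j x) < e / 2"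
      by blast
    have "norm (L2_norm M (\<lambda>x. f k x - g x) - 0) < e" if "N \<le> k" for k
      using tail(2)[OF N that] \<open>0 < e\<close> L2_norm_nonneg[of M "\<lambda>x. f k x - g x"] by simp
    then show "\<exists>N. \<forall>k\<ge>N. norm (L2_norm M (\<lambda>x. f k x - g x) - 0) < e" by blast
  qed
  ultimately show ?thesis by (rule that)
qed

lemma powr_le_add_power2:
  fixes t d p :: real
  assumes "0 \<le> t" "0 < d" "0 < p" "p \<le> 2"
  shows "t powr p \<le> d powr p + d powr (p - 2) * t\<^sup>2"
proof (cases "t \<le> d")
  case True
  then have "t powr p \<le> d powr p" using assms by (intro powr_mono2) auto
  then show ?thesis by (simp add: add_increasing2)
next
  case False
  then have "t powr p = t powr (p - 2) * t\<^sup>2"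
    using assms by (simp add: powr_diff)
  also have "\<dots> \<le> d powr (p - 2) * t\<^sup>2"
    using False assms by (intro mult_right_mono powr_mono2') auto
  finally show ?thesis by (simp add: add_increasing)
qed

lemma powr_le_mult_power2:
  fixes t B p :: real
  assumes "0 \<le> t" "t \<le> B" "2 \<le> p"
  shows "t powr p \<le> B powr (p - 2) * t\<^sup>2"
proof -
  have "t powr p = t powr (p - 2) * t\<^sup>2"
    using assms by (cases "t = 0") (auto simp: powr_diff)
  also have "\<dots> \<le> B powr (p - 2) * t\<^sup>2"
    using assms by (intro mult_right_mono powr_mono2) auto
  finally show ?thesis .
qed

lemma nn_integral_power2_tendsto_0:
  assumes "\<forall>\<^sub>F i in F. square_integrable M (f i)" and "((\<lambda>i. L2_norm M (f i)) \<longlongrightarrow> 0) F"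
  shows "((\<lambda>i. \<integral>\<^sup>+x. ennreal ((norm (f i x))\<^sup>2) \<partial>M) \<longlongrightarrow> 0) F"
proof (rule Lim_transform_eventually)
  show "((\<lambda>i. ennreal ((L2_norm M (f i))\<^sup>2)) \<longlongrightarrow> 0) F"
    using tendsto_ennrealI[OF tendsto_power[OF assms(2), of 2]] by simp
qed (use assms(1) in \<open>auto elim!: eventually_mono simp: nn_integral_norm_power2\<close>)

lemma (in finite_measure) Lp_tendsto_0_of_L2:
  fixes f :: "'i \<Rightarrow> 'a \<Rightarrow> 'b::euclidean_space"
  assumes f: "\<forall>\<^sub>F i in F. square_integrable M (f i)" and lim: "((\<lambda>i. L2_norm M (f i)) \<longlongrightarrow> 0) F"
    and p: "0 < p" "p \<le> 2"
  shows "((\<lambda>i. \<integral>\<^sup>+x. ennreal (norm (f i x) powr p) \<partial>M) \<longlongrightarrow> 0) F"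
proof (rule order_tendstoI)
  fix e :: ennreal assume "0 < e"
  have "((\<lambda>d. ennreal (d powr p * measure M (space M))) \<longlongrightarrow> ennreal (0 powr p * measure M (space M))) (at_right 0)"
    using p(1) by (intro tendsto_ennrealI tendsto_intros) (auto simp: eventually_at_filter)
  then have "\<forall>\<^sub>F d in at_right 0. ennreal (d powr p * measure M (space M)) < e"
    using \<open>0 < e\<close> by (intro order_tendstoD) auto
  from eventually_happens[OF eventually_conj[OF eventually_at_right_less this]]
  obtain d where d: "0 < d" "ennreal (d powr p * measure M (space M)) < e"
    by auto
  have Lp_le: "(\<integral>\<^sup>+x. ennreal (norm (f i x) powr p) \<partial>M) \<le> ennreal (d powr p * measure M (space M))
      + ennreal (d powr (p - 2)) * (\<integral>\<^sup>+x. ennreal ((norm (f i x))\<^sup>2) \<partial>M)"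
    if "square_integrable M (f i)" for i
  proof -
    note [measurable] = square_integrableD(1)[OF that]
    have "(\<integral>\<^sup>+x. ennreal (norm (f i x) powr p) \<partial>M)
      \<le> (\<integral>\<^sup>+x. ennreal (d powr p) + ennreal (d powr (p - 2)) * ennreal ((norm (f i x))\<^sup>2) \<partial>M)"
      using powr_le_add_power2[OF norm_ge_zero d(1) p] by (intro nn_integral_mono)
        (simp add: ennreal_mult[symmetric] ennreal_plus[symmetric] ennreal_leI del: ennreal_plus)
    then show ?thesis
      by (simp add: nn_integral_add nn_integral_cmult emeasure_eq_measure ennreal_mult)
  qed
  have "((\<lambda>i. ennreal (d powr p * measure M (space M))
      + ennreal (d powr (p - 2)) * (\<integral>\<^sup>+x. ennreal ((norm (f i x))\<^sup>2) \<partial>M))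
      \<longlongrightarrow> ennreal (d powr p * measure M (space M)) + ennreal (d powr (p - 2)) * 0) F"
    by (intro tendsto_add tendsto_const ennreal_tendsto_cmult nn_integral_power2_tendsto_0 f lim) simp
  then have "\<forall>\<^sub>F i in F. ennreal (d powr p * measure M (space M))
      + ennreal (d powr (p - 2)) * (\<integral>\<^sup>+x. ennreal ((norm (f i x))\<^sup>2) \<partial>M) < e"
    using d(2) by (intro order_tendstoD) auto
  with f show "\<forall>\<^sub>F i in F. (\<integral>\<^sup>+x. ennreal (norm (f i x) powr p) \<partial>M) < e"
    by eventually_elim (use Lp_le in \<open>blast intro: le_less_trans\<close>)
qed simp

lemma Lp_tendsto_0_of_L2_of_bounded:
  fixes f :: "'i \<Rightarrow> 'a \<Rightarrow> 'b::euclidean_space"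
  assumes f: "\<forall>\<^sub>F i in F. square_integrable M (f i)" and lim: "((\<lambda>i. L2_norm M (f i)) \<longlongrightarrow> 0) F"
    and B: "\<forall>\<^sub>F i in F. AE x in M. norm (f i x) \<le> B" and p: "2 \<le> p"
  shows "((\<lambda>i. \<integral>\<^sup>+x. ennreal (norm (f i x) powr p) \<partial>M) \<longlongrightarrow> 0) F"
proof (rule tendsto_sandwich[OF _ _ tendsto_const])
  show "((\<lambda>i. ennreal (B powr (p - 2)) * (\<integral>\<^sup>+x. ennreal ((norm (f i x))\<^sup>2) \<partial>M)) \<longlongrightarrow> 0) F"
    using ennreal_tendsto_cmult[OF _ nn_integral_power2_tendsto_0[OF f lim], of "ennreal (B powr (p - 2))"]
    by simp
  show "\<forall>\<^sub>F i in F. (\<integral>\<^sup>+x. ennreal (norm (f i x) powr p) \<partial>M)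
      \<le> ennreal (B powr (p - 2)) * (\<integral>\<^sup>+x. ennreal ((norm (f i x))\<^sup>2) \<partial>M)"
    using f B
  proof eventually_elim
    case (elim i)
    note [measurable] = square_integrableD(1)[OF elim(1)]
    have "(\<integral>\<^sup>+x. ennreal (norm (f i x) powr p) \<partial>M)
        \<le> (\<integral>\<^sup>+x. ennreal (B powr (p - 2)) * ennreal ((norm (f i x))\<^sup>2) \<partial>M)"
      using elim(2) powr_le_mult_power2[OF norm_ge_zero _ p] by (intro nn_integral_mono_AE)
        (auto elim!: eventually_mono simp: ennreal_mult[symmetric] intro!: ennreal_leI)
    then show ?case by (simp add: nn_integral_cmult)
  qed
qed simp

section \<open>Continuously differentiable functions of compact support\<close>

definition C1 :: "('a::euclidean_space \<Rightarrow> 'b::real_normed_vector) \<Rightarrow> bool" where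
  "C1 f \<longleftrightarrow> (\<exists>f'. (\<forall>x. (f has_derivative f' x) (at x)) \<and> (\<forall>h. continuous_on UNIV (\<lambda>x. f' x h)))"

abbreviation supp :: "('a::topological_space \<Rightarrow> 'b::zero) \<Rightarrow> 'a set" where
  "supp f \<equiv> closure {x. f x \<noteq> 0}"

definition C1_compact :: "'a set \<Rightarrow> ('a::euclidean_space \<Rightarrow> 'b::real_normed_vector) \<Rightarrow> bool" where
  "C1_compact \<Omega> f \<longleftrightarrow> C1 f \<and> compact (supp f) \<and> supp f \<subseteq> \<Omega>"

lemma C1I:
  "(\<And>x. (f has_derivative f' x) (at x)) \<Longrightarrow> (\<And>h. continuous_on UNIV (\<lambda>x. f' x h)) \<Longrightarrow> C1 f"
  by (auto simp: C1_def)

lemma C1_imp_continuous_on: "C1 f \<Longrightarrow> continuous_on UNIV f"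
  by (auto simp: C1_def continuous_on_eq_continuous_at dest: has_derivative_continuous)

lemma C1_const: "C1 (\<lambda>_. c)"
  by (rule C1I[where f' = "\<lambda>_ _. 0"]) auto

lemma C1_add:
  assumes "C1 f" "C1 g" shows "C1 (\<lambda>x. f x + g x)"
proof -
  obtain f' g' where "\<And>x. (f has_derivative f' x) (at x)" "\<And>x. (g has_derivative g' x) (at x)"
    "\<And>h. continuous_on UNIV (\<lambda>x. f' x h)" "\<And>h. continuous_on UNIV (\<lambda>x. g' x h)"
    using assms unfolding C1_def by blast
  then show ?thesis
    by (intro C1I[where f' = "\<lambda>x h. f' x h + g' x h"] has_derivative_add continuous_on_add)
qed

lemma C1_sum: "(\<And>i. i \<in> I \<Longrightarrow> C1 (f i)) \<Longrightarrow> C1 (\<lambda>x. \<Sum>i\<in>I. f i x)"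
  by (induction I rule: infinite_finite_induct) (auto intro: C1_add C1_const)

lemma C1_bounded_linear:
  assumes T: "bounded_linear T" and "C1 f" shows "C1 (\<lambda>x. T (f x))"
proof -
  obtain f' where "\<And>x. (f has_derivative f' x) (at x)" "\<And>h. continuous_on UNIV (\<lambda>x. f' x h)"
    using assms(2) unfolding C1_def by blast
  then show ?thesis
    by (intro C1I[where f' = "\<lambda>x h. T (f' x h)"] bounded_linear.has_derivative[OF T]
        bounded_linear.continuous_on[OF T])
qed

lemma C1_compose_real:
  fixes g :: "real \<Rightarrow> real"
  assumes f: "C1 f" and g: "\<And>t. (g has_real_derivative g' t) (at t)" "continuous_on UNIV g'"
  shows "C1 (\<lambda>x. g (f x))"
proof -
  obtain f' where f': "\<And>x. (f has_derivative f' x) (at x)" "\<And>h. continuous_on UNIV (\<lambda>x. f' x h)"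
    using f unfolding C1_def by blast
  show ?thesis
  proof (rule C1I)
    show "((\<lambda>x. g (f x)) has_derivative (\<lambda>h. g' (f x) * f' x h)) (at x)" for x
      using has_derivative_compose[OF f'(1) g(1)[unfolded has_field_derivative_def]] .
    show "continuous_on UNIV (\<lambda>x. g' (f x) * f' x h)" for h
      using f'(2) g(2) C1_imp_continuous_on[OF f]
      by (intro continuous_on_mult continuous_on_compose2[of UNIV g' UNIV f]) auto
  qed
qed

lemma has_real_derivative_pos_part_power2:
  "((\<lambda>t::real. (max 0 t)\<^sup>2) has_real_derivative 2 * max 0 t) (at t)"
  unfolding DERIV_def
proof (rule LIM_zero_cancel, rule Lim_null_comparison)
  have "norm (((max 0 (t + h))\<^sup>2 - (max 0 t)\<^sup>2) / h - 2 * max 0 t) \<le> \<bar>h\<bar>" if "h \<noteq> 0" for h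
  proof -
    have "\<bar>(max 0 (t + h))\<^sup>2 - (max 0 t)\<^sup>2 - 2 * max 0 t * h\<bar> \<le> h\<^sup>2"
    proof -
      consider (stays_nonneg) "0 \<le> t" "0 \<le> t + h" | (crosses) "0 \<le> t" "t + h < 0" | (neg) "t < 0"
        by linarith
      then show ?thesis
      proof cases
        case stays_nonneg
        then show ?thesis by (simp add: power2_eq_square algebra_simps)
      next
        case crosses
        then have "(max 0 (t + h))\<^sup>2 - (max 0 t)\<^sup>2 - 2 * max 0 t * h = t * (- (t + 2 * h))"
          by (simp add: power2_eq_square algebra_simps)
        moreover have "0 \<le> t * (- (t + 2 * h))" using crosses by (intro mult_nonneg_nonneg) auto
        moreover have "h\<^sup>2 - t * (- (t + 2 * h)) = (t + h)\<^sup>2"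
          by (simp add: power2_eq_square algebra_simps)
        ultimately show ?thesis using zero_le_power2[of "t + h"] by linarith
      next
        case neg
        then have "(max 0 (t + h))\<^sup>2 \<le> \<bar>h\<bar>\<^sup>2" by (intro power_mono) auto
        then show ?thesis using neg by simp
      qed
    qed
    then have "\<bar>((max 0 (t + h))\<^sup>2 - (max 0 t)\<^sup>2 - 2 * max 0 t * h) / h\<bar> \<le> h\<^sup>2 / \<bar>h\<bar>"
      unfolding abs_divide by (rule divide_right_mono) simp
    moreover have "h\<^sup>2 / \<bar>h\<bar> = \<bar>h\<bar>" by (simp add: power2_eq_square abs_if)
    ultimately show ?thesis using that by (simp add: diff_divide_distrib)
  qed
  then show "\<forall>\<^sub>F h in at 0. norm (((max 0 (t + h))\<^sup>2 - (max 0 t)\<^sup>2) / h - 2 * max 0 t) \<le> \<bar>h\<bar>"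
    by (simp add: eventually_at_filter)
  show "((\<lambda>h::real. \<bar>h\<bar>) \<longlongrightarrow> 0) (at 0)" by (rule tendsto_rabs_zero) (rule tendsto_ident_at)
qed

lemma C1_pos_part_power2:
  "C1 f \<Longrightarrow> C1 (\<lambda>x. (max 0 (f x :: real))\<^sup>2)"
  by (rule C1_compose_real[OF _ has_real_derivative_pos_part_power2]) (simp, intro continuous_intros)

lemma zero_outside_supp: "x \<notin> supp f \<Longrightarrow> f x = 0"
  using closure_subset[of "{x. f x \<noteq> 0}"] by blast

lemma C1_compactI:
  assumes "C1 f" "compact K" "K \<subseteq> \<Omega>" "\<And>x. x \<notin> K \<Longrightarrow> f x = 0"
  shows "C1_compact \<Omega> f"
proof -
  have "supp f \<subseteq> K" using assms by (intro closure_minimal) (auto intro: compact_imp_closed)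
  then show ?thesis
    using assms closed_closure compact_Int_closed[of K "supp f"] unfolding C1_compact_def
    by (simp add: Int_absorb1)
qed

lemma C1_compactD:
  assumes "C1_compact \<Omega> f"
  shows "C1 f" "compact (supp f)" "supp f \<subseteq> \<Omega>" "continuous_on UNIV f" "f \<in> borel_measurable borel"
    "x \<notin> \<Omega> \<Longrightarrow> f x = 0"
  using assms C1_imp_continuous_on[of f] zero_outside_supp[of x f]
  by (auto simp: C1_compact_def intro: borel_measurable_continuous_onI)

lemma C1_compact_add:
  assumes f: "C1_compact \<Omega> f" and g: "C1_compact \<Omega> g"
  shows "C1_compact \<Omega> (\<lambda>x. f x + g x)"
proof (rule C1_compactI[of _ "supp f \<union> supp g"])
  show "C1 (\<lambda>x. f x + g x)" using f g by (intro C1_add C1_compactD(1))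
  show "compact (supp f \<union> supp g)" using f g by (intro compact_Un C1_compactD(2))
  show "supp f \<union> supp g \<subseteq> \<Omega>" using f g by (intro Un_least C1_compactD(3))
  show "f x + g x = 0" if "x \<notin> supp f \<union> supp g" for x
    using that zero_outside_supp[of x f] zero_outside_supp[of x g] by simp
qed

lemma C1_compact_bounded_linear:
  assumes T: "bounded_linear T" and f: "C1_compact \<Omega> f"
  shows "C1_compact \<Omega> (\<lambda>x. T (f x))"
proof (rule C1_compactI[of _ "supp f"])
  show "C1 (\<lambda>x. T (f x))" by (rule C1_bounded_linear[OF T C1_compactD(1)[OF f]])
  show "T (f x) = 0" if "x \<notin> supp f" for x
    using zero_outside_supp[OF that] linear_simps(3)[OF T] by simp
qed (use C1_compactD[OF f] in blast)+

lemma C1_compact_mono: "C1_compact \<Omega> f \<Longrightarrow> \<Omega> \<subseteq> \<Omega>' \<Longrightarrow> C1_compact \<Omega>' f"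
  by (auto simp: C1_compact_def)

lemma bounded_of_compact_support:
  fixes f :: "'a::topological_space \<Rightarrow> 'b::real_normed_vector"
  assumes f: "continuous_on UNIV f" and K: "compact K" "\<And>x. x \<notin> K \<Longrightarrow> f x = 0"
  obtains B where "0 \<le> B" "\<And>x. norm (f x) \<le> B"
proof -
  have "bounded (f ` K)"
    using f K by (intro compact_imp_bounded compact_continuous_image) (auto intro: continuous_on_subset)
  then obtain B where "0 < B" "\<And>x. x \<in> K \<Longrightarrow> norm (f x) \<le> B" by (auto simp: bounded_pos)
  then have "norm (f x) \<le> B" for x using K(2)[of x] by (cases "x \<in> K") auto
  with \<open>0 < B\<close> that show ?thesis by (meson less_imp_le)
qed

lemma C1_compact_bounded:
  assumes "C1_compact \<Omega> f"
  obtains B where "0 \<le> B" "\<And>x. norm (f x) \<le> B"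
  using bounded_of_compact_support[of f "supp f"] C1_compactD[OF assms] zero_outside_supp[of _ f] by metis

definition ball_bump :: "'a::euclidean_space \<Rightarrow> real \<Rightarrow> 'a \<Rightarrow> real" where
  "ball_bump c r x = (max 0 (r\<^sup>2 - (norm (x - c))\<^sup>2))\<^sup>2"

lemma ball_bump_nonneg: "0 \<le> ball_bump c r x"
  by (simp add: ball_bump_def)

lemma C1_ball_bump: "C1 (ball_bump c r)"
proof -
  have "C1 (\<lambda>x. r\<^sup>2 - (norm (x - c))\<^sup>2)"
  proof (rule C1I)
    show "((\<lambda>x. r\<^sup>2 - (norm (x - c))\<^sup>2) has_derivative (\<lambda>h. - 2 * ((x - c) \<bullet> h))) (at x)" for x
      unfolding power2_norm_eq_inner
      by (auto intro!: derivative_eq_intros simp: inner_commute algebra_simps)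
  qed (intro continuous_intros)
  then show ?thesis unfolding ball_bump_def[abs_def] by (rule C1_pos_part_power2)
qed

lemma ball_bump_pos:
  assumes "x \<in> ball c r"
  shows "0 < ball_bump c r x"
proof -
  have "(norm (x - c))\<^sup>2 < r\<^sup>2"
    using assms by (intro power_strict_mono) (auto simp: dist_norm norm_minus_commute)
  then show ?thesis by (simp add: ball_bump_def)
qed

lemma ball_bump_eq_0:
  assumes "0 \<le> r" "x \<notin> cball c r"
  shows "ball_bump c r x = 0"
proof -
  have "r\<^sup>2 \<le> (norm (x - c))\<^sup>2"
    using assms by (intro power_mono) (auto simp: dist_norm norm_minus_commute)
  then show ?thesis by (simp add: ball_bump_def)
qed

lemma exists_C1_compact_pos_on:
  fixes K U :: "'a::euclidean_space set"
  assumes K: "compact K" and U: "open U" and KU: "K \<subseteq> U"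
  obtains g :: "'a \<Rightarrow> real" where "C1_compact U g" "\<And>x. 0 \<le> g x" "\<And>x. x \<in> K \<Longrightarrow> 0 < g x"
proof -
  obtain r where r: "\<And>x. x \<in> K \<Longrightarrow> 0 < r x" "\<And>x. x \<in> K \<Longrightarrow> cball x (r x) \<subseteq> U"
    using U KU unfolding open_contains_cball by (metis subsetD)
  obtain C where C: "C \<subseteq> K" "finite C" "K \<subseteq> (\<Union>c\<in>C. ball c (r c))"
    by (rule compactE_image[OF K, of K "\<lambda>c. ball c (r c)"]) (use r(1) in auto)
  let ?g = "\<lambda>x. \<Sum>c\<in>C. ball_bump c (r c) x"
  show ?thesis
  proof (rule that)
    show "C1_compact U ?g"
    proof (rule C1_compactI)
      show "C1 ?g" by (intro C1_sum C1_ball_bump)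
      show "compact (\<Union>c\<in>C. cball c (r c))" using C(2) by auto
      show "(\<Union>c\<in>C. cball c (r c)) \<subseteq> U" using r(2) C(1) by blast
      show "?g x = 0" if "x \<notin> (\<Union>c\<in>C. cball c (r c))" for x
        using that C(1) r(1) by (intro sum.neutral ballI ball_bump_eq_0) (auto simp: less_imp_le subset_iff)
    qed
    show "0 \<le> ?g x" for x by (intro sum_nonneg ball_bump_nonneg)
    show "0 < ?g x" if "x \<in> K" for x
    proof -
      obtain c where c: "c \<in> C" "x \<in> ball c (r c)" using C(3) \<open>x \<in> K\<close> by blast
      show ?thesis using C(2) c(1) ball_bump_pos[OF c(2)] by (rule sum_pos2) (rule ball_bump_nonneg)
    qed
  qed
qed

lemma exists_C1_cutoff:
  fixes K U :: "'a::euclidean_space set"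
  assumes "compact K" "open U" "K \<subseteq> U"
  obtains \<eta> :: "'a \<Rightarrow> real" where "C1_compact U \<eta>" "\<And>x. 0 \<le> \<eta> x" "\<And>x. \<eta> x \<le> 1" "\<And>x. x \<in> K \<Longrightarrow> \<eta> x = 1"
proof -
  obtain g :: "'a \<Rightarrow> real" where g: "C1_compact U g" "\<And>x. 0 \<le> g x" "\<And>x. x \<in> K \<Longrightarrow> 0 < g x"
    using exists_C1_compact_pos_on[OF assms] by blast
  obtain m :: real where m: "0 < m" "\<And>x. x \<in> K \<Longrightarrow> m \<le> g x"
  proof (cases "K = {}")
    case False
    have "continuous_on K g"
      using C1_compactD(4)[OF g(1)] by (rule continuous_on_subset) simp
    from continuous_attains_inf[OF assms(1) False this] obtain z
      where "z \<in> K" "\<And>x. x \<in> K \<Longrightarrow> g z \<le> g x" by blast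
    then show ?thesis using g(3)[of z] that[of "g z"] by blast
  qed (use that[of 1] in auto)
  define \<eta> where "\<eta> x = 1 - (max 0 (1 - g x / m))\<^sup>2" for x
  have unit: "0 \<le> max 0 (1 - g x / m)" "max 0 (1 - g x / m) \<le> 1" for x
    using g(2)[of x] m(1) by auto
  show ?thesis
  proof (rule that[of \<eta>])
    have "C1 (\<lambda>x. 1 + (- 1 / m) *\<^sub>R g x)"
      by (intro C1_add C1_const C1_bounded_linear[OF bounded_linear_scaleR_right] C1_compactD(1)[OF g(1)])
    then have "C1 (\<lambda>x. (max 0 (1 - g x / m))\<^sup>2)"
      by (intro C1_pos_part_power2) simp
    then have "C1 (\<lambda>x. 1 + (- 1) *\<^sub>R (max 0 (1 - g x / m))\<^sup>2)"
      by (intro C1_add C1_const C1_bounded_linear[OF bounded_linear_scaleR_right])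
    then have "C1 \<eta>" by (simp add: \<eta>_def[abs_def])
    then show "C1_compact U \<eta>"
    proof (rule C1_compactI[OF _ C1_compactD(2,3)[OF g(1)]])
      show "\<eta> x = 0" if "x \<notin> supp g" for x
        using zero_outside_supp[OF that] by (simp add: \<eta>_def)
    qed
    show "0 \<le> \<eta> x" for x using power_le_one[OF unit, of x 2] by (simp add: \<eta>_def)
    show "\<eta> x \<le> 1" for x by (simp add: \<eta>_def)
    show "\<eta> x = 1" if "x \<in> K" for x
      using m(2)[OF that] m(1) by (simp add: \<eta>_def max_def)
  qed
qed

lemma compact_inner_approx:
  fixes M :: "'a::euclidean_space measure"
  assumes "finite_measure M" and sets: "sets M = sets borel" and A: "A \<in> sets borel" and e: "0 < e"
  obtains K where "compact K" "K \<subseteq> A" "measure M (A - K) < e"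
proof -
  interpret finite_measure M by fact
  have "{K. K \<subseteq> A \<and> compact K} \<noteq> {}" by auto
  moreover have "emeasure M A = (SUP K\<in>{K. K \<subseteq> A \<and> compact K}. emeasure M K)"
    by (rule inner_regular[OF sets _ A]) simp
  moreover have "emeasure M A \<noteq> \<infinity>" by simp
  ultimately have "\<exists>K\<in>{K. K \<subseteq> A \<and> compact K}. emeasure M A < emeasure M K + ennreal e"
    by (rule SUP_approx_ennreal[OF e])
  then obtain K where K: "K \<subseteq> A" "compact K" "emeasure M A < emeasure M K + ennreal e"
    by blast
  have "measure M A < measure M K + e"
    using K(3) e by (simp add: emeasure_eq_measure ennreal_less_iff flip: ennreal_plus)
  moreover have "measure M (A - K) = measure M A - measure M K"
    using K A by (intro finite_measure_Diff) (auto simp: sets borel_compact)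
  ultimately show ?thesis using that K by auto
qed

lemma compact_open_approx:
  fixes M :: "'a::euclidean_space measure"
  assumes "finite_measure M" and sets: "sets M = sets borel" and A: "A \<in> sets borel" and e: "0 < e"
  obtains K U where "compact K" "open U" "K \<subseteq> A" "A \<subseteq> U" "measure M (U - K) < e"
proof -
  interpret finite_measure M by fact
  obtain K where K: "compact K" "K \<subseteq> A" "measure M (A - K) < e / 2"
    using compact_inner_approx[OF \<open>finite_measure M\<close> sets A, of "e / 2"] e by auto
  obtain K' where K': "compact K'" "K' \<subseteq> - A" "measure M (- A - K') < e / 2"
    using compact_inner_approx[OF \<open>finite_measure M\<close> sets, of "- A" "e / 2"] A e by auto
  have [simp]: "A \<in> sets M" "K \<in> sets M" "K' \<in> sets M" "- A \<in> sets M"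
    using A K(1) K'(1) by (auto simp: sets borel_compact)
  have "measure M (- K' - K) \<le> measure M ((A - K) \<union> (- A - K'))"
    by (intro finite_measure_mono sets.Un sets.Diff) auto
  also have "\<dots> \<le> measure M (A - K) + measure M (- A - K')"
    by (rule measure_Un_le) auto
  finally have "measure M (- K' - K) < e" using K(3) K'(3) by linarith
  with K(1,2) K'(1,2) that[of K "- K'"] show ?thesis by (auto intro: compact_imp_closed)
qed

lemma indicator_approx_C1_compact:
  fixes M :: "'a::euclidean_space measure"
  assumes M: "finite_measure M" and sets: "sets M = sets borel"
    and \<Omega>: "open \<Omega>" "emeasure M (UNIV - \<Omega>) = 0" and A: "A \<in> sets borel" and e: "0 < e"
  obtains \<eta> :: "'a \<Rightarrow> real" where "C1_compact \<Omega> \<eta>" "integrable M \<eta>"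
    "(\<integral>x. \<bar>indicator A x - \<eta> x\<bar> \<partial>M) < e"
proof -
  interpret finite_measure M by fact
  have [measurable]: "A \<in> sets M" "\<Omega> \<in> sets M" using A \<Omega>(1) by (simp_all add: sets)
  have "A \<inter> \<Omega> \<in> sets borel" using A \<Omega>(1) by simp
  from compact_open_approx[OF M sets this e] obtain K U
    where K: "compact K" "K \<subseteq> A \<inter> \<Omega>" and U: "open U" "A \<inter> \<Omega> \<subseteq> U" and small: "measure M (U - K) < e"
    by metis
  have [measurable]: "K \<in> sets M" "U \<in> sets M" using K(1) U(1) by (simp_all add: sets borel_compact)
  obtain \<eta> :: "'a \<Rightarrow> real" where \<eta>: "C1_compact (U \<inter> \<Omega>) \<eta>" "\<And>x. 0 \<le> \<eta> x" "\<And>x. \<eta> x \<le> 1"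
    "\<And>x. x \<in> K \<Longrightarrow> \<eta> x = 1"
    using exists_C1_cutoff[OF K(1), of "U \<inter> \<Omega>"] K(2) U \<Omega>(1) by (metis open_Int le_inf_iff order_trans)
  have [measurable]: "\<eta> \<in> borel_measurable M"
    using C1_compactD(5)[OF \<eta>(1)] by (simp add: measurable_cong_sets[OF sets refl])
  have \<eta>_int: "integrable M \<eta>"
    by (rule integrable_const_bound[of _ 1]) (use \<eta>(2,3) in auto)
  have "AE x in M. x \<in> \<Omega>"
    using \<Omega> sets_eq_imp_space_eq[OF sets] by (intro AE_I'[of "UNIV - \<Omega>"]) (auto simp: null_sets_def sets)
  then have "AE x in M. \<bar>indicator A x - \<eta> x\<bar> \<le> indicator (U - K) x"
  proof eventually_elim
    case (elim x)
    have "\<eta> x = 0" if "x \<notin> U" using C1_compactD(6)[OF \<eta>(1), of x] that by simp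
    then show ?case
      using elim U(2) K(2) \<eta>(2)[of x] \<eta>(3)[of x] \<eta>(4)[of x] by (auto simp: indicator_def)
  qed
  then have "(\<integral>x. \<bar>indicator A x - \<eta> x\<bar> \<partial>M) \<le> (\<integral>x. indicator (U - K) x \<partial>M)"
    using \<eta>_int by (intro integral_mono_AE) (auto simp: less_top[symmetric])
  also have "\<dots> < e" using small by simp
  finally show ?thesis
    using that C1_compact_mono[OF \<eta>(1)] \<eta>_int by blast
qed

lemma scaled_indicator_approx_C1_compact:
  fixes M :: "'a::euclidean_space measure" and c :: "'b::euclidean_space"
  assumes M: "finite_measure M" and sets: "sets M = sets borel"
    and \<Omega>: "open \<Omega>" "emeasure M (UNIV - \<Omega>) = 0" and A: "A \<in> sets borel" and e: "0 < e"
  obtains g where "C1_compact \<Omega> g" "integrable M g" "(\<integral>x. norm (indicator A x *\<^sub>R c - g x) \<partial>M) < e"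
proof -
  have "0 < e / (norm c + 1)" using e by (simp add: add_nonneg_pos)
  from indicator_approx_C1_compact[OF M sets \<Omega> A this]
  obtain \<eta> :: "'a \<Rightarrow> real" where \<eta>: "C1_compact \<Omega> \<eta>" "integrable M \<eta>"
    "(\<integral>x. \<bar>indicator A x - \<eta> x\<bar> \<partial>M) < e / (norm c + 1)" .
  have "(\<integral>x. norm (indicator A x *\<^sub>R c - \<eta> x *\<^sub>R c) \<partial>M) = (\<integral>x. \<bar>indicator A x - \<eta> x\<bar> \<partial>M) * norm c"
    by (simp flip: scaleR_diff_left)
  also have "\<dots> \<le> (\<integral>x. \<bar>indicator A x - \<eta> x\<bar> \<partial>M) * (norm c + 1)"
    by (intro mult_left_mono) auto
  also have "\<dots> < e" using \<eta>(3) by (simp add: less_divide_eq add_nonneg_pos)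
  finally have "(\<integral>x. norm (indicator A x *\<^sub>R c - \<eta> x *\<^sub>R c) \<partial>M) < e" .
  then show ?thesis
    using that[OF C1_compact_bounded_linear[OF bounded_linear_scaleR_left \<eta>(1)]] \<eta>(2) by simp
qed

lemma integral_norm_diff_tendsto_0_of_dominated:
  fixes f :: "'a \<Rightarrow> 'b::euclidean_space"
  assumes f: "integrable M f" and s: "\<And>i. integrable M (s i)"
    and lim: "\<And>x. x \<in> space M \<Longrightarrow> (\<lambda>i. s i x) \<longlonglongrightarrow> f x"
    and dom: "\<And>i x. x \<in> space M \<Longrightarrow> norm (s i x) \<le> 2 * norm (f x)"
  shows "(\<lambda>i. \<integral>x. norm (f x - s i x) \<partial>M) \<longlonglongrightarrow> 0"
proof -
  have "(\<lambda>i. \<integral>x. norm (f x - s i x) \<partial>M) \<longlonglongrightarrow> (\<integral>x. norm (f x - f x) \<partial>M)"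
  proof (rule integral_dominated_convergence[where w = "\<lambda>x. 3 * norm (f x)"])
    show "AE x in M. (\<lambda>i. norm (f x - s i x)) \<longlonglongrightarrow> norm (f x - f x)"
      using lim by (intro AE_I2 tendsto_intros)
    show "AE x in M. norm (norm (f x - s i x)) \<le> 3 * norm (f x)" for i
    proof (rule AE_I2)
      fix x assume "x \<in> space M"
      then show "norm (norm (f x - s i x)) \<le> 3 * norm (f x)"
        using dom[of x i] norm_triangle_ineq4[of "f x" "s i x"] by simp
    qed
  qed (use f s in auto)
  then show ?thesis by simp
qed

lemma integrable_approx_C1_compact:
  fixes f :: "'a::euclidean_space \<Rightarrow> 'b::euclidean_space"
  assumes M: "finite_measure M" and sets: "sets M = sets borel"
    and \<Omega>: "open \<Omega>" "emeasure M (UNIV - \<Omega>) = 0" and f: "integrable M f" and e: "0 < e"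
  obtains g where "C1_compact \<Omega> g" "integrable M g" "(\<integral>x. norm (f x - g x) \<partial>M) < e"
proof -
  have "\<exists>g. C1_compact \<Omega> g \<and> integrable M g \<and> (\<integral>x. norm (f x - g x) \<partial>M) < e" if "0 < e" for e
    using f that
  proof (induction arbitrary: e rule: integrable_induct)
    case (base A c)
    from base(1) have "A \<in> sets borel" by (simp only: sets)
    from scaled_indicator_approx_C1_compact[OF M sets \<Omega> this base(3), of c] show ?case by blast
  next
    case (add f1 f2)
    have "0 < e / 2" using add.prems by simp
    from add.IH(1)[OF this] add.IH(2)[OF this] obtain g1 g2
      where g: "C1_compact \<Omega> g1" "integrable M g1" "(\<integral>x. norm (f1 x - g1 x) \<partial>M) < e / 2"
        "C1_compact \<Omega> g2" "integrable M g2" "(\<integral>x. norm (f2 x - g2 x) \<partial>M) < e / 2"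
      by blast
    have "(\<integral>x. norm ((f1 x + f2 x) - (g1 x + g2 x)) \<partial>M)
        \<le> (\<integral>x. norm (f1 x - g1 x) + norm (f2 x - g2 x) \<partial>M)"
      using add.hyps g by (intro integral_mono norm_diff_triangle_ineq) auto
    also have "\<dots> < e" using add.hyps g by simp
    finally show ?case
      using g by (intro exI[of _ "\<lambda>x. g1 x + g2 x"]) (auto intro: C1_compact_add)
  next
    case (lim f s)
    have half: "0 < e / 2" using lim.prems by simp
    have "(\<lambda>i. \<integral>x. norm (f x - s i x) \<partial>M) \<longlonglongrightarrow> 0"
      using lim.hyps by (intro integral_norm_diff_tendsto_0_of_dominated) auto
    from eventually_happens[OF order_tendstoD(2)[OF this half]]
    obtain i where i: "(\<integral>x. norm (f x - s i x) \<partial>M) < e / 2" by auto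
    obtain g where g: "C1_compact \<Omega> g" "integrable M g" "(\<integral>x. norm (s i x - g x) \<partial>M) < e / 2"
      using lim.IH[OF half] by blast
    have "(\<integral>x. norm (f x - g x) \<partial>M) \<le> (\<integral>x. norm (f x - s i x) + norm (s i x - g x) \<partial>M)"
    proof (rule integral_mono)
      show "norm (f x - g x) \<le> norm (f x - s i x) + norm (s i x - g x)" for x
        using dist_triangle[of "f x" "g x" "s i x"] by (simp add: dist_norm)
    qed (use lim.hyps g in auto)
    also have "\<dots> < e" using lim.hyps g i by simp
    finally show ?case using g by blast
  qed
  with e that show ?thesis by blast
qed

section \<open>Polar representation of vector measures\<close>

lemma integrable_inner_bounded:
  fixes f g :: "'a \<Rightarrow> 'b::euclidean_space"
  assumes f: "integrable M f" and g: "g \<in> borel_measurable M" "\<And>x. norm (g x) \<le> B"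
  shows "integrable M (\<lambda>x. g x \<bullet> f x)"
proof (rule Bochner_Integration.integrable_bound)
  show "integrable M (\<lambda>x. B * norm (f x))" using f by simp
  have "\<bar>g x \<bullet> f x\<bar> \<le> \<bar>B * norm (f x)\<bar>" for x
    using Cauchy_Schwarz_ineq2[of "g x" "f x"] mult_right_mono[OF g(2)[of x] norm_ge_zero[of "f x"]]
    by linarith
  then show "AE x in M. norm (g x \<bullet> f x) \<le> norm (B * norm (f x))" by simp
qed (use f g in measurable)

lemma integral_inner_bounded_le:
  fixes f g :: "'a \<Rightarrow> 'b::euclidean_space"
  assumes f: "integrable M f" and g: "g \<in> borel_measurable M" "\<And>x. norm (g x) \<le> B"
  shows "\<bar>\<integral>x. g x \<bullet> f x \<partial>M\<bar> \<le> B * (\<integral>x. norm (f x) \<partial>M)"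
proof -
  have "\<bar>\<integral>x. g x \<bullet> f x \<partial>M\<bar> \<le> (\<integral>x. norm (g x \<bullet> f x) \<partial>M)"
    using integral_norm_bound[of M "\<lambda>x. g x \<bullet> f x"] by simp
  also have "\<dots> \<le> (\<integral>x. B * norm (f x) \<partial>M)"
  proof (rule integral_mono)
    show "integrable M (\<lambda>x. norm (g x \<bullet> f x))"
      using integrable_inner_bounded[OF f g] by (rule integrable_norm)
    show "norm (g x \<bullet> f x) \<le> B * norm (f x)" for x
      using Cauchy_Schwarz_ineq2[of "g x" "f x"] mult_right_mono[OF g(2)[of x] norm_ge_zero[of "f x"]]
      by simp
  qed (use f in simp)
  finally show ?thesis by simp
qed

lemma finite_measure_density_of_integrable:
  fixes y :: "'a \<Rightarrow> real"
  assumes "integrable N y"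
  shows "finite_measure (density N (\<lambda>x. ennreal (y x)))"
  using assms by (intro finite_measureI)
    (auto simp: emeasure_density real_integrable_def cong: nn_integral_cong_simp)

lemma absolutely_continuous_distr_density:
  assumes [measurable]: "X \<in> measurable N K" "y \<in> borel_measurable N"
  shows "absolutely_continuous (distr N K X) (distr (density N y) K X)"
  unfolding absolutely_continuous_def
proof
  fix A assume "A \<in> null_sets (distr N K X)"
  then have [measurable]: "A \<in> sets K" and "X -` A \<inter> space N \<in> null_sets N"
    by (auto simp: null_sets_def emeasure_distr)
  then have "X -` A \<inter> space N \<in> null_sets (density N y)"
    by (subst null_sets_density_iff) (auto dest: AE_not_in)
  then show "A \<in> null_sets (distr (density N y) K X)" by (auto simp: null_sets_def emeasure_distr)
qed

lemma pushforward_density_nonneg: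
  fixes y :: "'a \<Rightarrow> real" and X :: "'a \<Rightarrow> 'b::topological_space"
  assumes N: "finite_measure N" and X [measurable]: "X \<in> borel_measurable N"
    and y: "integrable N y" "\<And>x. 0 \<le> y x"
  obtains d where "d \<in> borel_measurable borel" "integrable (distr N borel X) d"
    "\<And>\<psi>. \<psi> \<in> borel_measurable borel \<Longrightarrow> (\<integral>x. \<psi> (X x) * y x \<partial>N) = (\<integral>x. \<psi> x * d x \<partial>distr N borel X)"
proof -
  let ?Y = "density N (\<lambda>x. ennreal (y x))"
  define \<beta> where "\<beta> = distr N borel X"
  define \<rho> where "\<rho> = distr ?Y borel X"
  have [measurable]: "y \<in> borel_measurable N" using y by auto
  have [simp, measurable_cong]: "sets \<beta> = sets borel" "sets \<rho> = sets borel"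
    by (simp_all add: \<beta>_def \<rho>_def)
  interpret \<beta>: finite_measure \<beta> unfolding \<beta>_def by (rule finite_measure.finite_measure_distr[OF N X])
  have "finite_measure \<rho>"
    unfolding \<rho>_def
    by (rule finite_measure.finite_measure_distr[OF finite_measure_density_of_integrable[OF y(1)]]) simp
  moreover have "absolutely_continuous \<beta> \<rho>"
    unfolding \<beta>_def \<rho>_def by (rule absolutely_continuous_distr_density) measurable
  ultimately obtain d where d: "d \<in> borel_measurable \<beta>" "\<And>x. 0 \<le> d x" "integrable \<beta> d"
    and \<rho>: "\<rho> = density \<beta> (\<lambda>x. ennreal (d x))"
    using exists_real_density[OF \<beta>.sigma_finite_measure_axioms] by (metis \<open>sets \<beta> = sets borel\<close> \<open>sets \<rho> = sets borel\<close>)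
  have [measurable]: "d \<in> borel_measurable borel" using d(1) by simp
  have "(\<integral>x. \<psi> (X x) * y x \<partial>N) = (\<integral>x. \<psi> x * d x \<partial>\<beta>)"
    if [measurable]: "\<psi> \<in> borel_measurable borel" for \<psi>
  proof -
    have "(\<integral>x. \<psi> (X x) * y x \<partial>N) = (\<integral>x. \<psi> (X x) \<partial>?Y)"
      using y(2) by (subst integral_density) (auto simp: mult.commute)
    also have "\<dots> = (\<integral>x. \<psi> x \<partial>\<rho>)" unfolding \<rho>_def by (rule integral_distr[symmetric]) auto
    also have "\<dots> = (\<integral>x. \<psi> x * d x \<partial>\<beta>)"
      unfolding \<rho> using d(2) by (subst integral_density) (auto simp: mult.commute)
    finally show ?thesis .
  qed
  with d(3) that show ?thesis unfolding \<beta>_def by auto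
qed

lemma pushforward_density_real:
  fixes y :: "'a \<Rightarrow> real" and X :: "'a \<Rightarrow> 'b::topological_space"
  assumes N: "finite_measure N" and X [measurable]: "X \<in> borel_measurable N" and y: "integrable N y"
  obtains d where "d \<in> borel_measurable borel" "integrable (distr N borel X) d"
    "\<And>\<psi> B. \<psi> \<in> borel_measurable borel \<Longrightarrow> (\<And>x. norm (\<psi> x) \<le> B) \<Longrightarrow>
      (\<integral>x. \<psi> (X x) * y x \<partial>N) = (\<integral>x. \<psi> x * d x \<partial>distr N borel X)"
proof -
  let ?\<beta> = "distr N borel X"
  let ?p = "\<lambda>x. max 0 (y x)" and ?n = "\<lambda>x. max 0 (- y x)"
  have int: "integrable N ?p" "integrable N ?n" using y by auto
  obtain p where p: "p \<in> borel_measurable borel" "integrable ?\<beta> p"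
    "\<And>\<psi>. \<psi> \<in> borel_measurable borel \<Longrightarrow> (\<integral>x. \<psi> (X x) * ?p x \<partial>N) = (\<integral>x. \<psi> x * p x \<partial>?\<beta>)"
    by (rule pushforward_density_nonneg[OF N X int(1) max.cobounded1]) blast
  obtain n where n: "n \<in> borel_measurable borel" "integrable ?\<beta> n"
    "\<And>\<psi>. \<psi> \<in> borel_measurable borel \<Longrightarrow> (\<integral>x. \<psi> (X x) * ?n x \<partial>N) = (\<integral>x. \<psi> x * n x \<partial>?\<beta>)"
    by (rule pushforward_density_nonneg[OF N X int(2) max.cobounded1]) blast
  show ?thesis
  proof (rule that[of "\<lambda>x. p x - n x"])
    show "(\<lambda>x. p x - n x) \<in> borel_measurable borel" "integrable ?\<beta> (\<lambda>x. p x - n x)"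
      using p(1,2) n(1,2) by simp_all
    fix \<psi> :: "'b \<Rightarrow> real" and B assume \<psi> [measurable]: "\<psi> \<in> borel_measurable borel" and B: "\<And>x. norm (\<psi> x) \<le> B"
    have N_int: "integrable N (\<lambda>x. \<psi> (X x) * f x)" if "integrable N f" for f :: "_ \<Rightarrow> real"
      using integrable_inner_bounded[OF that, of "\<lambda>x. \<psi> (X x)" B] B by simp
    have \<beta>_int: "integrable ?\<beta> (\<lambda>x. \<psi> x * f x)" if "integrable ?\<beta> f" for f :: "_ \<Rightarrow> real"
      using integrable_inner_bounded[OF that, of \<psi> B] B by simp
    have "(\<integral>x. \<psi> (X x) * y x \<partial>N) = (\<integral>x. \<psi> (X x) * ?p x - \<psi> (X x) * ?n x \<partial>N)"
      by (intro Bochner_Integration.integral_cong) (auto simp: max_def)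
    also have "\<dots> = (\<integral>x. \<psi> x * p x \<partial>?\<beta>) - (\<integral>x. \<psi> x * n x \<partial>?\<beta>)"
      unfolding p(3)[OF \<psi>, symmetric] n(3)[OF \<psi>, symmetric]
      by (intro Bochner_Integration.integral_diff N_int int)
    also have "\<dots> = (\<integral>x. \<psi> x * (p x - n x) \<partial>?\<beta>)"
      unfolding right_diff_distrib
      by (intro Bochner_Integration.integral_diff[symmetric] \<beta>_int p(2) n(2))
    finally show "(\<integral>x. \<psi> (X x) * y x \<partial>N) = (\<integral>x. \<psi> x * (p x - n x) \<partial>?\<beta>)" .
  qed
qed

lemma integral_inner_eq_sum_Basis:
  fixes f g :: "'a \<Rightarrow> 'c::euclidean_space"
  assumes "\<And>b. b \<in> Basis \<Longrightarrow> integrable M (\<lambda>x. (f x \<bullet> b) * (g x \<bullet> b))"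
  shows "(\<integral>x. f x \<bullet> g x \<partial>M) = (\<Sum>b\<in>Basis. \<integral>x. (f x \<bullet> b) * (g x \<bullet> b) \<partial>M)"
proof -
  have "(\<integral>x. f x \<bullet> g x \<partial>M) = (\<integral>x. (\<Sum>b\<in>Basis. (f x \<bullet> b) * (g x \<bullet> b)) \<partial>M)"
    by (simp add: euclidean_inner[symmetric])
  also have "\<dots> = (\<Sum>b\<in>Basis. \<integral>x. (f x \<bullet> b) * (g x \<bullet> b) \<partial>M)"
    by (intro Bochner_Integration.integral_sum assms)
  finally show ?thesis .
qed

lemma integrable_inner_Basis_mult:
  fixes f g :: "'a \<Rightarrow> 'c::euclidean_space"
  assumes [measurable]: "f \<in> borel_measurable M" and f: "\<And>x. norm (f x) \<le> B" and g: "integrable M g" and b: "b \<in> Basis"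
  shows "integrable M (\<lambda>x. (f x \<bullet> b) * (g x \<bullet> b))"
proof -
  have "norm (f x \<bullet> b) \<le> B" for x using Basis_le_norm[OF b, of "f x"] f[of x] by simp
  then show ?thesis
    using integrable_inner_bounded[of M "\<lambda>x. g x \<bullet> b" "\<lambda>x. f x \<bullet> b" B] g by simp
qed

lemma pushforward_density:
  fixes y :: "'a \<Rightarrow> 'c::euclidean_space" and X :: "'a \<Rightarrow> 'b::topological_space"
  assumes N: "finite_measure N" and X [measurable]: "X \<in> borel_measurable N" and y: "integrable N y"
  obtains d where "d \<in> borel_measurable borel" "integrable (distr N borel X) d"
    "\<And>\<phi> B. \<phi> \<in> borel_measurable borel \<Longrightarrow> (\<And>x. norm (\<phi> x) \<le> B) \<Longrightarrow>
      (\<integral>x. \<phi> (X x) \<bullet> y x \<partial>N) = (\<integral>x. \<phi> x \<bullet> d x \<partial>distr N borel X)"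
proof -
  let ?\<beta> = "distr N borel X"
  define density_of where "density_of b d \<longleftrightarrow> d \<in> borel_measurable borel \<and> integrable ?\<beta> d \<and>
      (\<forall>\<psi> B. \<psi> \<in> borel_measurable borel \<longrightarrow> (\<forall>x. norm (\<psi> x) \<le> B) \<longrightarrow>
        (\<integral>x. \<psi> (X x) * (y x \<bullet> b) \<partial>N) = (\<integral>x. \<psi> x * d x \<partial>?\<beta>))" for b and d :: "'b \<Rightarrow> real"
  have "integrable N (\<lambda>x. y x \<bullet> b)" for b using y by simp
  then have "\<exists>d. density_of b d" for b
    unfolding density_of_def by (rule pushforward_density_real[OF N X]) blast
  then obtain c where "\<And>b. density_of b (c b)" by metis
  then have c: "\<And>b. c b \<in> borel_measurable borel" "\<And>b. integrable ?\<beta> (c b)"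
    "\<And>b \<psi> B. \<psi> \<in> borel_measurable borel \<Longrightarrow> (\<And>x. norm (\<psi> x) \<le> B) \<Longrightarrow>
      (\<integral>x. \<psi> (X x) * (y x \<bullet> b) \<partial>N) = (\<integral>x. \<psi> x * c b x \<partial>?\<beta>)"
    unfolding density_of_def by blast+
  note [measurable] = c(1)
  define d where "d x = (\<Sum>b\<in>Basis. c b x *\<^sub>R b)" for x
  have d_component: "d x \<bullet> b = c b x" if "b \<in> Basis" for x b using that by (simp add: d_def)
  have d_meas: "d \<in> borel_measurable borel" unfolding d_def by measurable
  have d_int: "integrable ?\<beta> d" unfolding d_def using c(2) by simp
  have "(\<integral>x. \<phi> (X x) \<bullet> y x \<partial>N) = (\<integral>x. \<phi> x \<bullet> d x \<partial>?\<beta>)"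
    if \<phi> [measurable]: "\<phi> \<in> borel_measurable borel" and B: "\<And>x. norm (\<phi> x) \<le> B" for \<phi> B
  proof -
    have "norm (\<phi> x \<bullet> b) \<le> B" if "b \<in> Basis" for x b
      using Basis_le_norm[OF that, of "\<phi> x"] B[of x] by simp
    then have "(\<integral>x. (\<phi> (X x) \<bullet> b) * (y x \<bullet> b) \<partial>N) = (\<integral>x. (\<phi> x \<bullet> b) * (d x \<bullet> b) \<partial>?\<beta>)" if "b \<in> Basis" for b
      using that by (simp add: d_component c(3)[of "\<lambda>x. \<phi> x \<bullet> b" B])
    then show ?thesis
      using integrable_inner_Basis_mult[OF _ B y] integrable_inner_Basis_mult[OF _ B d_int]
      by (simp add: integral_inner_eq_sum_Basis)
  qed
  with d_meas d_int that show ?thesis by blast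
qed

lemma polar_decomposition:
  fixes d :: "'a::topological_space \<Rightarrow> 'b::euclidean_space"
  assumes sets [measurable_cong]: "sets \<beta> = sets borel" and [measurable]: "d \<in> borel_measurable borel"
    and d: "integrable \<beta> d"
  defines "\<nu> \<equiv> density \<beta> (\<lambda>x. ennreal (norm (d x)))" and "\<sigma> \<equiv> \<lambda>x. sgn (d x)"
  shows "finite_measure \<nu>" "AE x in \<nu>. norm (\<sigma> x) = 1" "\<sigma> \<in> borel_measurable borel"
    "\<And>\<phi>. \<phi> \<in> borel_measurable borel \<Longrightarrow> (\<integral>x. \<phi> x \<bullet> \<sigma> x \<partial>\<nu>) = (\<integral>x. \<phi> x \<bullet> d x \<partial>\<beta>)"
proof -
  have space: "space \<beta> = UNIV" using sets_eq_imp_space_eq[OF sets] by simp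
  have "emeasure \<nu> UNIV = ennreal (\<integral>x. norm (d x) \<partial>\<beta>)"
    using d by (simp add: \<nu>_def emeasure_density space[symmetric] nn_integral_eq_integral)
  then show "finite_measure \<nu>" by (intro finite_measureI) (simp add: \<nu>_def space)
  show [measurable]: "\<sigma> \<in> borel_measurable borel" unfolding \<sigma>_def sgn_div_norm by measurable
  show "AE x in \<nu>. norm (\<sigma> x) = 1"
    unfolding \<nu>_def by (subst AE_density) (auto simp: \<sigma>_def norm_sgn)
  show "(\<integral>x. \<phi> x \<bullet> \<sigma> x \<partial>\<nu>) = (\<integral>x. \<phi> x \<bullet> d x \<partial>\<beta>)" if [measurable]: "\<phi> \<in> borel_measurable borel" for \<phi>
  proof -
    have "norm (d x) *\<^sub>R sgn (d x) = d x" for x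
      by (cases "d x = 0") (simp_all add: sgn_div_norm)
    then have "norm (d x) * (\<phi> x \<bullet> \<sigma> x) = \<phi> x \<bullet> d x" for x
      unfolding \<sigma>_def by (metis inner_scaleR_right)
    then show ?thesis unfolding \<nu>_def by (subst integral_density) auto
  qed
qed

lemma measure_le_of_polar_pairing:
  fixes y :: "'a \<Rightarrow> 'c::euclidean_space" and X :: "'a \<Rightarrow> 'b::topological_space"
  assumes [measurable]: "X \<in> borel_measurable N" and y: "integrable N y"
    and sets [measurable_cong]: "sets \<nu> = sets borel"
    and [measurable]: "\<sigma> \<in> borel_measurable borel"
    and \<sigma>: "\<And>x. norm (\<sigma> x) \<le> 1" "AE x in \<nu>. norm (\<sigma> x) = 1"
    and pairing: "\<And>\<phi>. \<phi> \<in> borel_measurable borel \<Longrightarrow> (\<And>x. norm (\<phi> x) \<le> 1) \<Longrightarrow>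
      (\<integral>x. \<phi> (X x) \<bullet> y x \<partial>N) = (\<integral>x. \<phi> x \<bullet> \<sigma> x \<partial>\<nu>)"
    and [measurable]: "A \<in> sets borel"
  shows "measure \<nu> A \<le> (\<integral>x. indicator A (X x) * norm (y x) \<partial>N)"
proof -
  define \<phi> where "\<phi> x = indicat_real A x *\<^sub>R \<sigma> x" for x
  have [measurable]: "\<phi> \<in> borel_measurable borel" unfolding \<phi>_def by measurable
  have \<phi>_le: "norm (\<phi> x) \<le> indicator A x" "norm (\<phi> x) \<le> 1" for x
    using \<sigma>(1)[of x] by (auto simp: \<phi>_def indicator_def)
  have "\<sigma> x \<bullet> \<sigma> x = 1" if "norm (\<sigma> x) = 1" for x using that by (simp add: dot_square_norm)
  then have "(\<integral>x. indicator A x \<partial>\<nu>) = (\<integral>x. \<phi> x \<bullet> \<sigma> x \<partial>\<nu>)"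
    using \<sigma>(2) by (intro integral_cong_AE) (auto simp: \<phi>_def elim!: eventually_mono)
  then have "measure \<nu> A = (\<integral>x. \<phi> (X x) \<bullet> y x \<partial>N)"
    using sets_eq_imp_space_eq[OF sets] pairing[of \<phi>] \<phi>_le(2) by simp
  also have "\<dots> \<le> (\<integral>x. indicator A (X x) * norm (y x) \<partial>N)"
  proof (rule integral_mono)
    show "integrable N (\<lambda>x. \<phi> (X x) \<bullet> y x)"
      by (rule integrable_inner_bounded[OF y _ \<phi>_le(2)]) measurable
    show "integrable N (\<lambda>x. indicator A (X x) * norm (y x))"
      using integrable_inner_bounded[of N "\<lambda>x. norm (y x)" "\<lambda>x. indicator A (X x)" 1] y by simp
    show "\<phi> (X x) \<bullet> y x \<le> indicator A (X x) * norm (y x)" for x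
      using norm_cauchy_schwarz[of "\<phi> (X x)" "y x"] mult_right_mono[OF \<phi>_le(1)[of "X x"], of "norm (y x)"]
      by simp
  qed
  finally show ?thesis .
qed

lemma exists_polar_representation:
  fixes y :: "'a \<Rightarrow> 'c::euclidean_space" and X :: "'a \<Rightarrow> 'b::topological_space"
  assumes N: "finite_measure N" and X: "X \<in> borel_measurable N" and y: "integrable N y"
  obtains \<nu> \<sigma> where "sets \<nu> = sets borel" "finite_measure \<nu>"
    "\<sigma> \<in> borel_measurable borel" "AE x in \<nu>. norm (\<sigma> x) = 1"
    "\<And>A. A \<in> sets borel \<Longrightarrow> measure \<nu> A \<le> (\<integral>x. indicator A (X x) * norm (y x) \<partial>N)"
    "\<And>\<phi> B. \<phi> \<in> borel_measurable borel \<Longrightarrow> (\<And>x. norm (\<phi> x) \<le> B) \<Longrightarrow>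
      (\<integral>x. \<phi> (X x) \<bullet> y x \<partial>N) = (\<integral>x. \<phi> x \<bullet> \<sigma> x \<partial>\<nu>)"
proof -
  let ?\<beta> = "distr N borel X"
  obtain d where d: "d \<in> borel_measurable borel" "integrable ?\<beta> d"
    and push: "\<And>\<phi> B. \<phi> \<in> borel_measurable borel \<Longrightarrow> (\<And>x. norm (\<phi> x) \<le> B) \<Longrightarrow>
      (\<integral>x. \<phi> (X x) \<bullet> y x \<partial>N) = (\<integral>x. \<phi> x \<bullet> d x \<partial>?\<beta>)"
    by (rule pushforward_density[OF N X y]) blast
  define \<nu> where "\<nu> = density ?\<beta> (\<lambda>x. ennreal (norm (d x)))"
  define \<sigma> where "\<sigma> x = sgn (d x)" for x
  note polar = polar_decomposition[OF sets_distr d, folded \<nu>_def \<sigma>_def]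
  have sets: "sets \<nu> = sets borel" by (simp add: \<nu>_def)
  have \<sigma>_le: "norm (\<sigma> x) \<le> 1" for x by (simp add: \<sigma>_def norm_sgn)
  have pairing: "(\<integral>x. \<phi> (X x) \<bullet> y x \<partial>N) = (\<integral>x. \<phi> x \<bullet> \<sigma> x \<partial>\<nu>)"
    if "\<phi> \<in> borel_measurable borel" "\<And>x. norm (\<phi> x) \<le> B" for \<phi> B
    using push[OF that] polar(4)[OF that(1)] by simp
  show ?thesis
    by (rule that[OF sets polar(1,3,2) measure_le_of_polar_pairing[OF X y sets polar(3) \<sigma>_le polar(2) pairing] pairing])
qed

section \<open>Weak compactness of probability measures\<close>

definition schoenberg_wave :: "real \<Rightarrow> real" where
  "schoenberg_wave x = max 0 (min 1 (1/2 - cos (pi * x)))"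

lemma schoenberg_wave_bounds: "0 \<le> schoenberg_wave x" "schoenberg_wave x \<le> 1"
  by (auto simp: schoenberg_wave_def)

lemma schoenberg_wave_periodic: "schoenberg_wave (x + 2 * of_nat k) = schoenberg_wave x"
proof -
  have "cos (pi * (x + 2 * of_nat k)) = cos (pi * x)"
    using cos.plus_of_nat[of "pi * x" k] by (simp add: algebra_simps)
  then show ?thesis by (simp add: schoenberg_wave_def)
qed

lemma schoenberg_wave_eq_0:
  assumes "0 \<le> x" "x \<le> 1/3" shows "schoenberg_wave x = 0"
proof -
  have "cos (pi / 3) \<le> cos (pi * x)"
    using assms by (intro cos_monotone_0_pi_le) (auto simp: field_simps)
  then show ?thesis by (simp add: schoenberg_wave_def cos_60)
qed

lemma schoenberg_wave_eq_1:
  assumes "2/3 \<le> x" "x \<le> 1" shows "schoenberg_wave x = 1"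
proof -
  have "cos (pi * x) \<le> cos (2 * pi / 3)"
    using assms by (intro cos_monotone_0_pi_le) (auto simp: field_simps)
  then show ?thesis by (simp add: schoenberg_wave_def cos_120)
qed

definition cantor_number :: "(nat \<Rightarrow> bool) \<Rightarrow> real" where
  "cantor_number a = (\<Sum>i. 2 * of_bool (a i) * (1/3) ^ Suc i)"

lemma sums_two_thirds: "(\<lambda>i. 2 * (1/3::real) ^ Suc i) sums 1"
  using sums_mult[OF geometric_sums[of "1/3::real"], of "2/3"] by simp

lemma summable_cantor_number: "summable (\<lambda>i. 2 * of_bool (a i) * (1/3::real) ^ Suc i)"
  by (rule summable_comparison_test[OF _ sums_summable[OF sums_two_thirds]]) auto

lemma cantor_number_bounds: "0 \<le> cantor_number a" "cantor_number a \<le> 1"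
proof -
  show "0 \<le> cantor_number a"
    unfolding cantor_number_def by (intro suminf_nonneg summable_cantor_number) simp
  have "cantor_number a \<le> (\<Sum>i. 2 * (1/3::real) ^ Suc i)"
    unfolding cantor_number_def
    by (intro suminf_le summable_cantor_number sums_summable[OF sums_two_thirds]) simp
  then show "cantor_number a \<le> 1" using sums_unique[OF sums_two_thirds] by simp
qed

lemma cantor_number_Suc:
  "cantor_number a = (2 * of_bool (a 0) + cantor_number (\<lambda>i. a (Suc i))) / 3"
proof -
  have "cantor_number a = (\<Sum>i. 2 * of_bool (a (Suc i)) * (1/3) ^ Suc (Suc i)) + 2 * of_bool (a 0) / 3"
    unfolding cantor_number_def using suminf_split_head[OF summable_cantor_number[of a]] by simp
  also have "(\<Sum>i. 2 * of_bool (a (Suc i)) * (1/3::real) ^ Suc (Suc i)) = (1/3) * cantor_number (\<lambda>i. a (Suc i))"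
    unfolding cantor_number_def
    by (subst suminf_mult[OF summable_cantor_number, symmetric]) (simp add: ac_simps)
  finally show ?thesis by simp
qed

lemma power_3_mult_cantor_number:
  obtains k :: nat where "3 ^ m * cantor_number a = cantor_number (\<lambda>i. a (m + i)) + 2 * of_nat k"
proof -
  have "\<exists>k::nat. 3 ^ m * cantor_number a = cantor_number (\<lambda>i. a (m + i)) + 2 * of_nat k"
  proof (induction m)
    case (Suc m)
    then obtain k :: nat
      where "3 ^ m * cantor_number a = cantor_number (\<lambda>i. a (m + i)) + 2 * of_nat k" by blast
    then have "3 ^ Suc m * cantor_number a = 3 * cantor_number (\<lambda>i. a (m + i)) + 6 * of_nat k" by simp
    also have "\<dots> = cantor_number (\<lambda>i. a (Suc m + i)) + 2 * of_nat (of_bool (a m) + 3 * k)"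
      by (subst cantor_number_Suc) simp
    finally show ?case by blast
  qed (auto intro: exI[of _ 0])
  with that show ?thesis by blast
qed

lemma schoenberg_wave_cantor_number: "schoenberg_wave (3 ^ m * cantor_number a) = of_bool (a m)"
proof -
  have leading: "schoenberg_wave (cantor_number b) = of_bool (b 0)" for b
    using cantor_number_bounds[of "\<lambda>i. b (Suc i)"]
    by (cases "b 0") (auto simp: cantor_number_Suc[of b] intro!: schoenberg_wave_eq_0 schoenberg_wave_eq_1)
  obtain k :: nat where "3 ^ m * cantor_number a = cantor_number (\<lambda>i. a (m + i)) + 2 * of_nat k"
    by (rule power_3_mult_cantor_number)
  then show ?thesis by (simp add: schoenberg_wave_periodic leading)
qed

lemma exists_binary_expansion:
  fixes y :: real
  assumes "0 \<le> y" "y \<le> 1"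
  obtains a :: "nat \<Rightarrow> bool" where "(\<lambda>k. of_bool (a k) * (1/2) ^ Suc k) sums y"
proof -
  define r where "r = rec_nat y (\<lambda>_ z. 2 * z - of_bool (1/2 \<le> z))"
  have r_rec: "r 0 = y" "\<And>k. r (Suc k) = 2 * r k - of_bool (1/2 \<le> r k)"
    by (simp_all add: r_def)
  have r_bounds: "0 \<le> r k \<and> r k \<le> 1" for k
    by (induction k) (use assms in \<open>auto simp: r_rec\<close>)
  have partial_sum: "(\<Sum>i<k. of_bool (1/2 \<le> r i) * (1/2) ^ Suc i) = y - r k * (1/2) ^ k" for k
    by (induction k) (simp_all add: r_rec field_simps)
  have "(\<lambda>k. r k * (1/2) ^ k) \<longlonglongrightarrow> 0"
  proof (rule tendsto_sandwich[OF _ _ tendsto_const])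
    show "\<forall>\<^sub>F k in sequentially. 0 \<le> r k * (1/2) ^ k" using r_bounds by auto
    show "\<forall>\<^sub>F k in sequentially. r k * (1/2) ^ k \<le> (1/2) ^ k" using r_bounds by (simp add: mult_left_le_one_le)
    show "(\<lambda>k. (1/2::real) ^ k) \<longlonglongrightarrow> 0" by (rule LIMSEQ_power_zero) simp
  qed
  from tendsto_diff[OF tendsto_const[of y] this]
  have "(\<lambda>k. of_bool (1/2 \<le> r k) * (1/2) ^ Suc k) sums y"
    unfolding sums_def partial_sum by simp
  then show ?thesis by (rule that[of "\<lambda>k. 1/2 \<le> r k"])
qed

text \<open>The coordinates of Schoenberg's curve onto the Hilbert cube: coordinate \<open>j\<close> reads its \<open>k\<close>-th
  binary digit off the ternary digit of \<open>t\<close> at position \<open>prod_encode (j, k)\<close>.\<close>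

definition schoenberg_coordinate :: "nat \<Rightarrow> real \<Rightarrow> real" where
  "schoenberg_coordinate j t = (\<Sum>k. schoenberg_wave (3 ^ prod_encode (j, k) * t) * (1/2) ^ Suc k)"

lemma norm_schoenberg_term_le: "norm (schoenberg_wave x * (1/2) ^ Suc k) \<le> (1/2) ^ Suc k"
  using schoenberg_wave_bounds[of x] by (simp add: mult_left_le_one_le)

lemma summable_schoenberg_coordinate:
  "summable (\<lambda>k. schoenberg_wave (3 ^ prod_encode (j, k) * t) * (1/2) ^ Suc k)"
  by (rule summable_comparison_test[OF _ sums_summable[OF power_half_series]])
    (use norm_schoenberg_term_le in blast)

lemma schoenberg_coordinate_bounds: "0 \<le> schoenberg_coordinate j t" "schoenberg_coordinate j t \<le> 1"
proof -
  show "0 \<le> schoenberg_coordinate j t"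
    unfolding schoenberg_coordinate_def
    by (intro suminf_nonneg summable_schoenberg_coordinate) (simp add: schoenberg_wave_bounds)
  have "schoenberg_coordinate j t \<le> (\<Sum>k. (1/2) ^ Suc k)"
    unfolding schoenberg_coordinate_def
    by (intro suminf_le summable_schoenberg_coordinate sums_summable[OF power_half_series])
      (metis abs_le_D1 norm_schoenberg_term_le real_norm_def)
  then show "schoenberg_coordinate j t \<le> 1" using sums_unique[OF power_half_series] by simp
qed

lemma continuous_on_schoenberg_coordinate: "continuous_on UNIV (schoenberg_coordinate j)"
proof (rule uniform_limit_theorem[OF always_eventually])
  show "uniform_limit UNIV (\<lambda>n t. \<Sum>k<n. schoenberg_wave (3 ^ prod_encode (j, k) * t) * (1/2) ^ Suc k)
      (schoenberg_coordinate j) sequentially"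
    unfolding schoenberg_coordinate_def
    by (rule Weierstrass_m_test[OF norm_schoenberg_term_le sums_summable[OF power_half_series]])
  show "\<forall>n. continuous_on UNIV (\<lambda>t. \<Sum>k<n. schoenberg_wave (3 ^ prod_encode (j, k) * t) * (1/2) ^ Suc k)"
    unfolding schoenberg_wave_def by (intro allI continuous_intros)
qed simp

lemma schoenberg_coordinate_onto:
  fixes z :: "nat \<Rightarrow> real"
  assumes z: "\<And>j. 0 \<le> z j" "\<And>j. z j \<le> 1"
  obtains t where "0 \<le> t" "t \<le> 1" "\<And>j. schoenberg_coordinate j t = z j"
proof -
  have "\<exists>a::nat \<Rightarrow> bool. (\<lambda>k. of_bool (a k) * (1/2) ^ Suc k) sums z j" for j
    using exists_binary_expansion[OF z] by blast
  then obtain a :: "nat \<Rightarrow> nat \<Rightarrow> bool"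
    where a: "\<And>j. (\<lambda>k. of_bool (a j k) * (1/2) ^ Suc k) sums z j" by metis
  define t where "t = cantor_number (\<lambda>m. case prod_decode m of (j, k) \<Rightarrow> a j k)"
  have "schoenberg_coordinate j t = z j" for j
    using sums_unique[OF a] by (simp add: schoenberg_coordinate_def t_def schoenberg_wave_cantor_number)
  with that cantor_number_bounds show ?thesis unfolding t_def by blast
qed

definition schoenberg_curve :: "real \<Rightarrow> real \<Rightarrow> 'a::euclidean_space" where
  "schoenberg_curve R t = (\<Sum>b\<in>Basis. (2 * R * schoenberg_coordinate (to_nat_on Basis b) t - R) *\<^sub>R b)"

lemma continuous_on_schoenberg_curve: "continuous_on UNIV (schoenberg_curve R)"
  unfolding schoenberg_curve_def by (intro continuous_intros continuous_on_schoenberg_coordinate)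

lemma norm_schoenberg_curve_le:
  fixes R :: real
  assumes R: "0 \<le> R"
  shows "norm (schoenberg_curve R t :: 'a::euclidean_space) \<le> DIM('a) * R"
proof -
  have "norm (schoenberg_curve R t :: 'a) \<le> (\<Sum>b\<in>(Basis :: 'a set). R)"
    unfolding schoenberg_curve_def
  proof (rule sum_norm_le)
    fix b :: 'a assume b: "b \<in> Basis"
    let ?z = "schoenberg_coordinate (to_nat_on Basis b) t"
    have "0 \<le> R * ?z" "R * ?z \<le> R * 1"
      using schoenberg_coordinate_bounds R by (auto intro!: mult_nonneg_nonneg mult_left_mono simp del: mult_1_right)
    then have "\<bar>2 * R * ?z - R\<bar> \<le> R" by (simp add: abs_le_iff)
    then show "norm ((2 * R * ?z - R) *\<^sub>R b) \<le> R" using b by simp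
  qed
  then show ?thesis by simp
qed

lemma cball_subset_schoenberg_curve:
  assumes R: "0 < R"
  shows "cball (0 :: 'a::euclidean_space) R \<subseteq> schoenberg_curve R ` {0..1}"
proof
  fix y :: 'a assume y: "y \<in> cball 0 R"
  define z where "z j = (y \<bullet> from_nat_into Basis j + R) / (2 * R)" for j
  have "0 \<le> y \<bullet> from_nat_into Basis j + R" "y \<bullet> from_nat_into Basis j \<le> R" for j
    using Basis_le_norm[OF from_nat_into[of Basis j], of y] y by (auto simp: abs_le_iff)
  then have "0 \<le> z j" "z j \<le> 1" for j
    using R by (simp_all add: z_def divide_le_eq)
  then obtain t where t: "0 \<le> t" "t \<le> 1" "\<And>j. schoenberg_coordinate j t = z j"
    using schoenberg_coordinate_onto[of z] by blast
  have "z (to_nat_on Basis b) = (y \<bullet> b + R) / (2 * R)" if "b \<in> Basis" for b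
    using that by (simp add: z_def countable_finite)
  then have "schoenberg_curve R t = (\<Sum>b\<in>Basis. (y \<bullet> b) *\<^sub>R b)"
    unfolding schoenberg_curve_def t(3) using R by (intro sum.cong) auto
  then show "y \<in> schoenberg_curve R ` {0..1}" using t(1,2) by (auto simp: euclidean_representation)
qed

text \<open>The default value 1 keeps \<open>first_hit\<close> in the unit interval at points which are not hit.\<close>

definition first_hit :: "(real \<Rightarrow> 'a) \<Rightarrow> 'a \<Rightarrow> real" where
  "first_hit g y = Inf (insert 1 {t \<in> {0..1}. g t = y})"

lemma first_hit_le:
  assumes "t \<in> insert 1 {t \<in> {0..1}. g t = y}"
  shows "first_hit g y \<le> t"
  unfolding first_hit_def using assms by (rule cInf_lower) (auto intro: bdd_belowI[of _ 0])

lemma first_hit_mem: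
  fixes g :: "real \<Rightarrow> 'a::t1_space"
  assumes "continuous_on UNIV g"
  shows "first_hit g y \<in> insert 1 {t \<in> {0..1}. g t = y}"
  unfolding first_hit_def
proof (rule closed_contains_Inf)
  have "closed ({0..1} \<inter> g -` {y})"
    using assms by (intro continuous_closed_preimage) (auto intro: continuous_on_subset)
  moreover have "{t \<in> {0..1}. g t = y} = {0..1} \<inter> g -` {y}" by auto
  ultimately show "closed (insert 1 {t \<in> {0..1}. g t = y})" by simp
qed (auto intro: bdd_belowI[of _ 0])

lemma first_hit_bounds:
  fixes g :: "real \<Rightarrow> 'a::t1_space"
  assumes "continuous_on UNIV g"
  shows "0 \<le> first_hit g y" "first_hit g y \<le> 1"
  using first_hit_mem[OF assms, of y] by auto

lemma first_hit_right_inverse: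
  fixes g :: "real \<Rightarrow> 'a::t1_space"
  assumes g: "continuous_on UNIV g" and y: "y \<in> g ` {0..1}"
  shows "g (first_hit g y) = y"
proof -
  obtain t where t: "t \<in> {0..1}" "g t = y" using y by blast
  then have "first_hit g y \<le> t" by (intro first_hit_le) simp
  then show ?thesis using first_hit_mem[OF g, of y] t by auto
qed

lemma first_hit_le_iff:
  fixes g :: "real \<Rightarrow> 'a::t1_space"
  assumes g: "continuous_on UNIV g" and c: "c < 1"
  shows "first_hit g y \<le> c \<longleftrightarrow> y \<in> g ` {0..c}"
proof
  assume "first_hit g y \<le> c"
  then show "y \<in> g ` {0..c}"
    using c first_hit_mem[OF g, of y] by (intro image_eqI[of _ _ "first_hit g y"]) auto
next
  assume "y \<in> g ` {0..c}"
  then obtain t where "t \<in> {0..c}" "g t = y" by blast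
  then show "first_hit g y \<le> c" using c first_hit_le[of t g y] by auto
qed

lemma borel_measurable_first_hit:
  fixes g :: "real \<Rightarrow> 'a::t2_space"
  assumes g: "continuous_on UNIV g"
  shows "first_hit g \<in> borel_measurable borel"
proof (rule borel_measurableI_le)
  fix c :: real
  show "{y \<in> space borel. first_hit g y \<le> c} \<in> sets borel"
  proof (cases "1 \<le> c")
    case True
    then have "{y \<in> space borel. first_hit g y \<le> c} = UNIV"
      using order_trans[OF first_hit_bounds(2)[OF g]] by auto
    then show ?thesis by simp
  next
    case False
    then have "{y \<in> space borel. first_hit g y \<le> c} = g ` {0..c}"
      using first_hit_le_iff[OF g, of c] by auto
    moreover have "compact (g ` {0..c})"
      using g by (intro compact_continuous_image) (auto intro: continuous_on_subset)
    ultimately show ?thesis by (simp add: borel_compact)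
  qed
qed

lemma real_distributions_on_unit_interval_subseq:
  fixes M :: "nat \<Rightarrow> real measure"
  assumes distr: "\<And>k. real_distribution (M k)" and unit: "\<And>k. AE t in M k. 0 \<le> t \<and> t \<le> 1"
  obtains r L where "strict_mono r" "real_distribution L" "weak_conv_m (M \<circ> r) L"
proof -
  have "measure (M k) {-1<..1} = 1" for k
  proof -
    interpret real_distribution "M k" by (rule distr)
    have "AE t in M k. t \<in> {-1<..1}" using unit[of k] by eventually_elim auto
    then show ?thesis by (subst prob_eq_1) auto
  qed
  then have "tight M"
    unfolding tight_def by (intro conjI allI impI distr exI[of _ "-1"] exI[of _ 1]) auto
  from tight_imp_convergent_subsubsequence[OF this strict_mono_id] that show ?thesis
    by (auto simp: comp_def)
qed

lemma weak_conv_imp_integral_compose_tendsto: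
  fixes g :: "real \<Rightarrow> 'a::heine_borel" and \<phi> :: "'a \<Rightarrow> real"
  assumes M: "\<And>k. real_distribution (M k)" "real_distribution L" "weak_conv_m M L"
    and g: "continuous_on UNIV g" "bounded (range g)" and \<phi>: "continuous_on UNIV \<phi>"
  shows "(\<lambda>k. \<integral>t. \<phi> (g t) \<partial>M k) \<longlonglongrightarrow> (\<integral>t. \<phi> (g t) \<partial>L)"
proof -
  have "compact (closure (range g))" using g(2) by simp
  then have "bounded (\<phi> ` closure (range g))"
    using \<phi> by (intro compact_imp_bounded compact_continuous_image) (auto intro: continuous_on_subset)
  then obtain C where C: "\<And>t. norm (\<phi> (g t)) \<le> C"
    using closure_subset[of "range g"] by (fastforce simp: bounded_iff)
  have "isCont (\<lambda>t. \<phi> (g t)) t" for t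
    using continuous_on_compose2[OF \<phi> g(1)] by (simp add: continuous_on_eq_continuous_at)
  then show ?thesis
    using M by (intro weak_conv_imp_integral_bdd_continuous_conv[OF _ _ _ _ C])
qed

lemma integral_distr_right_inverse:
  fixes g :: "real \<Rightarrow> 'a::euclidean_space" and \<phi> :: "'a \<Rightarrow> real"
  assumes sets [measurable_cong]: "sets P = sets borel"
    and [measurable]: "s \<in> borel_measurable borel" "g \<in> borel_measurable borel" "\<phi> \<in> borel_measurable borel"
    and inverse: "AE x in P. g (s x) = x"
  shows "(\<integral>t. \<phi> (g t) \<partial>distr P borel s) = (\<integral>x. \<phi> x \<partial>P)"
proof -
  have "(\<integral>t. \<phi> (g t) \<partial>distr P borel s) = (\<integral>x. \<phi> (g (s x)) \<partial>P)"
    by (rule integral_distr) measurable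
  also have "\<dots> = (\<integral>x. \<phi> x \<partial>P)"
    using inverse by (intro integral_cong_AE) (auto elim: eventually_mono)
  finally show ?thesis .
qed

lemma prob_measures_on_ball_subseq:
  fixes P :: "nat \<Rightarrow> 'a::euclidean_space measure"
  assumes prob: "\<And>k. prob_space (P k)" and sets [measurable_cong]: "\<And>k. sets (P k) = sets borel"
    and ball: "\<And>k. AE x in P k. norm x \<le> R"
  obtains r Q B where "strict_mono (r :: nat \<Rightarrow> nat)" "prob_space Q" "sets Q = sets borel"
    "AE x in Q. norm x \<le> B"
    "\<And>\<phi> :: 'a \<Rightarrow> real. continuous_on UNIV \<phi> \<Longrightarrow> (\<lambda>k. \<integral>x. \<phi> x \<partial>P (r k)) \<longlonglongrightarrow> (\<integral>x. \<phi> x \<partial>Q)"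
proof -
  define g :: "real \<Rightarrow> 'a" where "g = schoenberg_curve (max R 1)"
  have g: "continuous_on UNIV g" and B: "norm (g t) \<le> DIM('a) * max R 1" for t
    unfolding g_def by (simp_all only: continuous_on_schoenberg_curve, intro norm_schoenberg_curve_le) simp
  have [measurable]: "g \<in> borel_measurable borel" "first_hit g \<in> borel_measurable borel"
    using g by (auto intro: borel_measurable_continuous_onI borel_measurable_first_hit)
  have "cball 0 R \<subseteq> cball (0 :: 'a) (max R 1)" by (rule subset_cball) simp
  also have "\<dots> \<subseteq> g ` {0..1}" unfolding g_def by (rule cball_subset_schoenberg_curve) simp
  finally have inverse: "AE x in P k. g (first_hit g x) = x" for k
    using ball[of k] by (auto elim!: eventually_mono intro!: first_hit_right_inverse[OF g])
  define M where "M k = distr (P k) borel (first_hit g)" for k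
  have M_distr: "real_distribution (M k)" for k
    unfolding M_def real_distribution_def real_distribution_axioms_def
    by (simp add: prob_space.prob_space_distr[OF prob])
  moreover have "AE t in M k. 0 \<le> t \<and> t \<le> 1" for k
    unfolding M_def using first_hit_bounds[OF g] by (subst AE_distr_iff) auto
  ultimately obtain r L where r: "strict_mono r" and L: "real_distribution L" and conv: "weak_conv_m (M \<circ> r) L"
    by (rule real_distributions_on_unit_interval_subseq)
  interpret L: real_distribution L by fact
  show ?thesis
  proof (rule that[OF r])
    show "prob_space (distr L borel g)" by (rule L.prob_space_distr) simp
    show "sets (distr L borel g) = sets borel" by simp
    show "AE x in distr L borel g. norm x \<le> DIM('a) * max R 1" using B by (subst AE_distr_iff) auto
    fix \<phi> :: "'a \<Rightarrow> real" assume \<phi>: "continuous_on UNIV \<phi>"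
    then have [measurable]: "\<phi> \<in> borel_measurable borel" by (rule borel_measurable_continuous_onI)
    have "bounded (range g)" using B by (auto simp: bounded_iff)
    then have "(\<lambda>k. \<integral>t. \<phi> (g t) \<partial>(M \<circ> r) k) \<longlonglongrightarrow> (\<integral>t. \<phi> (g t) \<partial>L)"
      using M_distr by (intro weak_conv_imp_integral_compose_tendsto[OF _ L conv g _ \<phi>]) simp_all
    moreover have "(\<integral>t. \<phi> (g t) \<partial>(M \<circ> r) k) = (\<integral>x. \<phi> x \<partial>P (r k))" for k
      using inverse by (simp add: M_def integral_distr_right_inverse[OF sets])
    ultimately show "(\<lambda>k. \<integral>x. \<phi> x \<partial>P (r k)) \<longlonglongrightarrow> (\<integral>x. \<phi> x \<partial>distr L borel g)"
      by (simp add: integral_distr)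
  qed
qed

section \<open>The total variation\<close>

lemma test_fun_iff_C1_compact:
  fixes \<phi> :: "real^'n \<Rightarrow> real^'n^'m"
  shows "test_fun \<Omega> \<phi> \<longleftrightarrow> C1_compact \<Omega> \<phi>"
proof
  assume "C1_compact \<Omega> \<phi>"
  then obtain f' where f': "\<And>x. (\<phi> has_derivative f' x) (at x)" "\<And>h. continuous_on UNIV (\<lambda>x. f' x h)"
    and supp: "compact (supp \<phi>)" "supp \<phi> \<subseteq> \<Omega>"
    unfolding C1_compact_def C1_def by blast
  have "frechet_derivative \<phi> (at x) = f' x" for x
    using frechet_derivative_at[OF f'(1)] by simp
  then show "test_fun \<Omega> \<phi>"
    using f' supp by (simp add: test_fun_def) (blast intro: differentiableI)
next
  assume \<phi>: "test_fun \<Omega> \<phi>"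
  have "C1 \<phi>"
  proof (rule C1I)
    show deriv: "(\<phi> has_derivative frechet_derivative \<phi> (at x)) (at x)" for x
      using \<phi> by (simp add: test_fun_def frechet_derivative_works[symmetric])
    have expansion: "frechet_derivative \<phi> (at x) h = (\<Sum>j\<in>UNIV. h $ j *\<^sub>R frechet_derivative \<phi> (at x) (axis j 1))" for x h
    proof -
      interpret bounded_linear "frechet_derivative \<phi> (at x)"
        by (rule has_derivative_bounded_linear[OF deriv])
      have "frechet_derivative \<phi> (at x) (\<Sum>j\<in>UNIV. h $ j *\<^sub>R axis j 1)
          = (\<Sum>j\<in>UNIV. h $ j *\<^sub>R frechet_derivative \<phi> (at x) (axis j 1))"
        by (simp add: sum scaleR)
      then show ?thesis using basis_expansion[of h] by (simp add: scalar_mult_eq_scaleR)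
    qed
    have "continuous_on UNIV (\<lambda>x. frechet_derivative \<phi> (at x) (axis j 1))" for j
      using \<phi> by (simp add: test_fun_def)
    then show "continuous_on UNIV (\<lambda>x. frechet_derivative \<phi> (at x) h)" for h
      unfolding expansion[of _ h] by (intro continuous_intros)
  qed
  with \<phi> show "C1_compact \<Omega> \<phi>" by (simp add: test_fun_def C1_compact_def)
qed

lemma mdiv_eq:
  assumes "(\<phi> has_derivative f') (at x)"
  shows "mdiv \<phi> x = (\<chi> i. \<Sum>j\<in>UNIV. f' (axis j 1) $ i $ j)"
  using frechet_derivative_at[OF assms] by (simp add: mdiv_def)

lemma C1_compact_mdiv:
  assumes \<phi>: "C1_compact \<Omega> \<phi>"
  shows "continuous_on UNIV (mdiv \<phi>)" "\<exists>B. \<forall>x. norm (mdiv \<phi> x) \<le> B"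
proof -
  obtain f' where f': "\<And>x. (\<phi> has_derivative f' x) (at x)" "\<And>h. continuous_on UNIV (\<lambda>x. f' x h)"
    using C1_compactD(1)[OF \<phi>] unfolding C1_def by blast
  show cont: "continuous_on UNIV (mdiv \<phi>)"
    unfolding mdiv_eq[OF f'(1)] by (intro continuous_intros f'(2))
  have "mdiv \<phi> x = 0" if "x \<notin> supp \<phi>" for x
  proof -
    have "(\<phi> has_derivative (\<lambda>h. 0)) (at x)"
    proof (rule has_derivative_transform_within_open[OF has_derivative_const[of 0]])
      show "open (- supp \<phi>)" "x \<in> - supp \<phi>" using that by auto
      show "0 = \<phi> y" if "y \<in> - supp \<phi>" for y using that zero_outside_supp[of y \<phi>] by simp
    qed
    then show ?thesis by (simp add: mdiv_eq vec_eq_iff)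
  qed
  then show "\<exists>B. \<forall>x. norm (mdiv \<phi> x) \<le> B"
    using bounded_of_compact_support[OF cont C1_compactD(2)[OF \<phi>]] by metis
qed

lemma borel_measurable_lebesgue_on:
  "f \<in> borel_measurable borel \<Longrightarrow> f \<in> borel_measurable (lebesgue_on \<Omega>)"
  by (intro measurable_restrict_space1 measurable_completion) simp

lemma borel_measurable_mdiv:
  "C1_compact \<Omega> \<phi> \<Longrightarrow> mdiv \<phi> \<in> borel_measurable (lebesgue_on \<Omega>')"
  by (intro borel_measurable_lebesgue_on borel_measurable_continuous_onI C1_compact_mdiv(1))

lemma integrable_inner_mdiv:
  assumes \<phi>: "C1_compact \<Omega> \<phi>" and w: "integrable (lebesgue_on \<Omega>) w"
  shows "integrable (lebesgue_on \<Omega>) (\<lambda>x. w x \<bullet> mdiv \<phi> x)"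
proof -
  obtain B where "\<And>x. norm (mdiv \<phi> x) \<le> B" using C1_compact_mdiv(2)[OF \<phi>] by blast
  from integrable_inner_bounded[OF w borel_measurable_mdiv[OF \<phi>] this] show ?thesis
    by (simp add: inner_commute)
qed

lemma integral_inner_mdiv_tendsto:
  assumes \<phi>: "C1_compact \<Omega> \<phi>" and w: "\<And>k. integrable (lebesgue_on \<Omega>) (w k)" "integrable (lebesgue_on \<Omega>) v"
    and lim: "(\<lambda>k. \<integral>x. norm (w k x - v x) \<partial>lebesgue_on \<Omega>) \<longlonglongrightarrow> 0"
  shows "(\<lambda>k. \<integral>x. w k x \<bullet> mdiv \<phi> x \<partial>lebesgue_on \<Omega>) \<longlonglongrightarrow> (\<integral>x. v x \<bullet> mdiv \<phi> x \<partial>lebesgue_on \<Omega>)"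
proof -
  obtain B where B: "\<And>x. norm (mdiv \<phi> x) \<le> B" using C1_compact_mdiv(2)[OF \<phi>] by blast
  have zero: "(\<lambda>k. B * (\<integral>x. norm (w k x - v x) \<partial>lebesgue_on \<Omega>)) \<longlonglongrightarrow> 0"
    using tendsto_mult_left[OF lim, of B] by simp
  have diff_le: "norm ((\<integral>x. w k x \<bullet> mdiv \<phi> x \<partial>lebesgue_on \<Omega>) - (\<integral>x. v x \<bullet> mdiv \<phi> x \<partial>lebesgue_on \<Omega>))
      \<le> B * (\<integral>x. norm (w k x - v x) \<partial>lebesgue_on \<Omega>)" for k
  proof -
    have "(\<integral>x. w k x \<bullet> mdiv \<phi> x \<partial>lebesgue_on \<Omega>) - (\<integral>x. v x \<bullet> mdiv \<phi> x \<partial>lebesgue_on \<Omega>)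
        = (\<integral>x. (w k x - v x) \<bullet> mdiv \<phi> x \<partial>lebesgue_on \<Omega>)"
      using integrable_inner_mdiv[OF \<phi> w(1)[of k]] integrable_inner_mdiv[OF \<phi> w(2)]
      by (simp add: inner_diff_left)
    also have "\<dots> = (\<integral>x. mdiv \<phi> x \<bullet> (w k x - v x) \<partial>lebesgue_on \<Omega>)"
      by (simp only: inner_commute)
    finally show ?thesis
      using integral_inner_bounded_le[OF Bochner_Integration.integrable_diff[OF w(1)[of k] w(2)]
          borel_measurable_mdiv[OF \<phi>] B] by simp
  qed
  show ?thesis
    by (rule LIM_zero_cancel[OF Lim_null_comparison[OF always_eventually zero]]) (use diff_le in blast)
qed

lemma grad_reprD:
  assumes "grad_repr \<Omega> w \<nu> \<sigma>"
  shows "sets \<nu> = sets borel" "space \<nu> = UNIV" "finite_measure \<nu>" "emeasure \<nu> (UNIV - \<Omega>) = 0"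
    "\<sigma> \<in> borel_measurable borel" "AE x in \<nu>. norm (\<sigma> x) = 1"
    "C1_compact \<Omega> \<phi> \<Longrightarrow> (\<integral>x. w x \<bullet> mdiv \<phi> x \<partial>lebesgue_on \<Omega>) = - (\<integral>x. \<phi> x \<bullet> \<sigma> x \<partial>\<nu>)"
  using assms sets_eq_imp_space_eq[of \<nu> borel] by (auto simp: grad_repr_def test_fun_iff_C1_compact)

lemma integral_inner_direction_le:
  fixes f \<sigma> :: "'a::topological_space \<Rightarrow> 'b::euclidean_space"
  assumes [measurable_cong]: "sets \<nu> = sets borel" and [measurable]: "\<sigma> \<in> borel_measurable borel"
    and \<sigma>: "AE x in \<nu>. norm (\<sigma> x) = 1" and f: "integrable \<nu> f"
  shows "integrable \<nu> (\<lambda>x. f x \<bullet> \<sigma> x)" "\<bar>\<integral>x. f x \<bullet> \<sigma> x \<partial>\<nu>\<bar> \<le> (\<integral>x. norm (f x) \<partial>\<nu>)"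
proof -
  have [measurable]: "f \<in> borel_measurable \<nu>" using f by simp
  have norm_le: "AE x in \<nu>. norm (f x \<bullet> \<sigma> x) \<le> norm (f x)"
    using \<sigma>
  proof eventually_elim
    case (elim x)
    then show ?case using Cauchy_Schwarz_ineq2[of "f x" "\<sigma> x"] by simp
  qed
  show int: "integrable \<nu> (\<lambda>x. f x \<bullet> \<sigma> x)"
    using norm_le by (intro Bochner_Integration.integrable_bound[OF f]) measurable
  have "\<bar>\<integral>x. f x \<bullet> \<sigma> x \<partial>\<nu>\<bar> \<le> (\<integral>x. norm (f x \<bullet> \<sigma> x) \<partial>\<nu>)"
    using integral_norm_bound[of \<nu> "\<lambda>x. f x \<bullet> \<sigma> x"] by simp
  also have "\<dots> \<le> (\<integral>x. norm (f x) \<partial>\<nu>)"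
    using int f norm_le by (intro integral_mono_AE) auto
  finally show "\<bar>\<integral>x. f x \<bullet> \<sigma> x \<partial>\<nu>\<bar> \<le> (\<integral>x. norm (f x) \<partial>\<nu>)" .
qed

text \<open>Test functions are dense in \<open>L\<^sup>1(\<nu> + \<nu>')\<close>, so the two representations also agree on integrable
  functions.\<close>

lemma grad_repr_pairing_unique:
  assumes \<Omega>: "open \<Omega>" and repr: "grad_repr \<Omega> w \<nu> \<sigma>" and repr': "grad_repr \<Omega> w \<nu>' \<sigma>'"
    and \<tau>: "integrable \<nu> \<tau>" "integrable \<nu>' \<tau>"
  shows "(\<integral>x. \<tau> x \<bullet> \<sigma> x \<partial>\<nu>) = (\<integral>x. \<tau> x \<bullet> \<sigma>' x \<partial>\<nu>')"
proof -
  note grad = grad_reprD[OF repr] and grad' = grad_reprD[OF repr']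
  have sets: "sets \<nu>' = sets \<nu>" by (simp add: grad(1) grad'(1))
  have "UNIV - \<Omega> \<in> sets \<nu>" using \<Omega> by (auto simp: grad(1))
  then have outside: "emeasure (add_measure \<nu> \<nu>') (UNIV - \<Omega>) = 0"
    using grad(4) grad'(4) by (simp add: emeasure_add_measure[OF sets])
  have "\<bar>(\<integral>x. \<tau> x \<bullet> \<sigma> x \<partial>\<nu>) - (\<integral>x. \<tau> x \<bullet> \<sigma>' x \<partial>\<nu>')\<bar> \<le> 0 + e" if e: "0 < e" for e
  proof -
    obtain g where g: "C1_compact \<Omega> g" "integrable (add_measure \<nu> \<nu>') g"
      "(\<integral>x. norm (\<tau> x - g x) \<partial>add_measure \<nu> \<nu>') < e"
      using integrable_approx_C1_compact[OF finite_measure_add_measure[OF sets grad(3) grad'(3)] _ \<Omega> outside _ e, of \<tau>]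
        \<tau> by (auto simp: grad(1) integrable_add_measure_iff[OF sets])
    have g_int: "integrable \<nu> g" "integrable \<nu>' g" using g(2) by (simp_all add: integrable_add_measure_iff[OF sets])
    have diff_int: "integrable \<nu> (\<lambda>x. \<tau> x - g x)" "integrable \<nu>' (\<lambda>x. \<tau> x - g x)" using \<tau> g_int by simp_all
    have small: "(\<integral>x. norm (\<tau> x - g x) \<partial>\<nu>) + (\<integral>x. norm (\<tau> x - g x) \<partial>\<nu>') < e"
      using g(3) diff_int by (simp add: integral_add_measure[OF sets])
    note dir = integral_inner_direction_le[OF grad(1,5,6)] and dir' = integral_inner_direction_le[OF grad'(1,5,6)]
    have "(\<integral>x. g x \<bullet> \<sigma> x \<partial>\<nu>) = (\<integral>x. g x \<bullet> \<sigma>' x \<partial>\<nu>')"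
      using grad(7)[OF g(1)] grad'(7)[OF g(1)] by simp
    then have "(\<integral>x. \<tau> x \<bullet> \<sigma> x \<partial>\<nu>) - (\<integral>x. \<tau> x \<bullet> \<sigma>' x \<partial>\<nu>')
        = (\<integral>x. (\<tau> x - g x) \<bullet> \<sigma> x \<partial>\<nu>) - (\<integral>x. (\<tau> x - g x) \<bullet> \<sigma>' x \<partial>\<nu>')"
      using dir(1)[OF \<tau>(1)] dir(1)[OF g_int(1)] dir'(1)[OF \<tau>(2)] dir'(1)[OF g_int(2)]
      by (simp add: inner_diff_left)
    then show ?thesis using dir(2)[OF diff_int(1)] dir'(2)[OF diff_int(2)] small by linarith
  qed
  then have "\<bar>(\<integral>x. \<tau> x \<bullet> \<sigma> x \<partial>\<nu>) - (\<integral>x. \<tau> x \<bullet> \<sigma>' x \<partial>\<nu>')\<bar> \<le> 0" by (rule field_le_epsilon)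
  then show ?thesis by simp
qed

lemma grad_repr_measure_le:
  assumes \<Omega>: "open \<Omega>" and repr: "grad_repr \<Omega> w \<nu> \<sigma>" and repr': "grad_repr \<Omega> w \<nu>' \<sigma>'"
  shows "measure \<nu> UNIV \<le> measure \<nu>' UNIV"
proof -
  note grad = grad_reprD[OF repr] and grad' = grad_reprD[OF repr']
  interpret \<nu>: finite_measure \<nu> by (rule grad(3))
  interpret \<nu>': finite_measure \<nu>' by (rule grad'(3))
  note [measurable_cong] = grad(1) grad'(1) and [measurable] = grad(5)
  define \<tau> where "\<tau> x = sgn (\<sigma> x)" for x
  have \<tau>_le: "norm (\<tau> x) \<le> 1" for x by (simp add: \<tau>_def norm_sgn)
  have [measurable]: "\<tau> \<in> borel_measurable borel" unfolding \<tau>_def sgn_div_norm by measurable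
  have \<tau>_int: "integrable \<nu> \<tau>" "integrable \<nu>' \<tau>"
    using \<tau>_le by (auto intro!: \<nu>.integrable_const_bound[of _ 1] \<nu>'.integrable_const_bound[of _ 1])
  have "\<tau> x \<bullet> \<sigma> x = 1" if "norm (\<sigma> x) = 1" for x
    using that by (simp add: \<tau>_def sgn_div_norm dot_square_norm)
  then have "(\<integral>x. 1 \<partial>\<nu>) = (\<integral>x. \<tau> x \<bullet> \<sigma> x \<partial>\<nu>)"
    using grad(6) by (intro integral_cong_AE) (auto elim!: eventually_mono)
  then have "measure \<nu> UNIV = (\<integral>x. \<tau> x \<bullet> \<sigma> x \<partial>\<nu>)" by (simp add: grad(2))
  also have "\<dots> = (\<integral>x. \<tau> x \<bullet> \<sigma>' x \<partial>\<nu>')" by (rule grad_repr_pairing_unique[OF \<Omega> repr repr' \<tau>_int])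
  also have "\<dots> \<le> (\<integral>x. norm (\<tau> x) \<partial>\<nu>')"
    using integral_inner_direction_le(2)[OF grad'(1,5,6) \<tau>_int(2)] by linarith
  also have "\<dots> \<le> (\<integral>x. 1 \<partial>\<nu>')" using \<tau>_int(2) \<tau>_le by (intro integral_mono) auto
  also have "\<dots> = measure \<nu>' UNIV" by (simp add: grad'(2))
  finally show ?thesis .
qed

definition total_variation :: "(real^'n) set \<Rightarrow> (real^'n \<Rightarrow> real^'m) \<Rightarrow> real" where
  "total_variation \<Omega> w = (THE V. \<exists>\<nu> \<sigma>. grad_repr \<Omega> w \<nu> \<sigma> \<and> V = measure \<nu> UNIV)"

lemma total_variation_eq:
  assumes "open \<Omega>" "grad_repr \<Omega> w \<nu> \<sigma>"
  shows "total_variation \<Omega> w = measure \<nu> UNIV"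
  unfolding total_variation_def
  using assms grad_repr_measure_le[OF assms(1)] by (intro the_equality) (auto intro!: antisym)

lemma grad_repr_zero: "grad_repr \<Omega> (\<lambda>_. 0) (null_measure borel) (\<lambda>_. 0)"
  by (auto simp: grad_repr_def intro!: finite_measureI AE_I'[of UNIV])

lemma is_BV_zero: "is_BV \<Omega> (\<lambda>_. 0)"
  using grad_repr_zero by (auto simp: is_BV_def)

lemma total_variation_nonneg:
  assumes "open \<Omega>" "is_BV \<Omega> w"
  shows "0 \<le> total_variation \<Omega> w"
  using assms by (metis is_BV_def measure_nonneg total_variation_eq)

lemma integral_inner_mdiv_le:
  assumes \<Omega>: "open \<Omega>" and w: "is_BV \<Omega> w" and \<phi>: "C1_compact \<Omega> \<phi>" "\<And>x. norm (\<phi> x) \<le> B"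
  shows "\<bar>\<integral>x. w x \<bullet> mdiv \<phi> x \<partial>lebesgue_on \<Omega>\<bar> \<le> B * total_variation \<Omega> w"
proof -
  obtain \<nu> \<sigma> where repr: "grad_repr \<Omega> w \<nu> \<sigma>" using w by (auto simp: is_BV_def)
  note grad = grad_reprD[OF repr]
  interpret finite_measure \<nu> by (rule grad(3))
  have [measurable]: "\<phi> \<in> borel_measurable \<nu>"
    using C1_compactD(5)[OF \<phi>(1)] by (simp add: measurable_cong_sets[OF grad(1) refl])
  have \<phi>_int: "integrable \<nu> \<phi>"
    using \<phi>(2) by (intro integrable_const_bound[of _ B]) auto
  have "\<bar>\<integral>x. w x \<bullet> mdiv \<phi> x \<partial>lebesgue_on \<Omega>\<bar> \<le> (\<integral>x. norm (\<phi> x) \<partial>\<nu>)"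
    using integral_inner_direction_le(2)[OF grad(1,5,6) \<phi>_int] grad(7)[OF \<phi>(1)] by simp
  also have "\<dots> \<le> (\<integral>x. B \<partial>\<nu>)" using \<phi>_int \<phi>(2) by (intro integral_mono) auto
  finally show ?thesis using total_variation_eq[OF \<Omega> repr] by (simp add: grad(2) mult.commute)
qed

text \<open>Encoding the gradient as a positive measure on pairs of points and matrices makes sums and weak
  limits accessible; a polar representation is recovered by conditioning on the point.\<close>

definition gradient_lift :: "(real^'n) set \<Rightarrow> (real^'n \<Rightarrow> real^'m) \<Rightarrow> ((real^'n) \<times> (real^'n^'m)) measure \<Rightarrow> bool" where
  "gradient_lift \<Omega> w N \<longleftrightarrow> finite_measure N \<and> sets N = sets borel \<and> integrable N snd \<and>
     (\<forall>\<phi>. C1_compact \<Omega> \<phi> \<longrightarrow>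
        (\<integral>x. w x \<bullet> mdiv \<phi> x \<partial>lebesgue_on \<Omega>) = - (\<integral>z. \<phi> (fst z) \<bullet> snd z \<partial>N))"

lemma borel_measurable_fst_snd [measurable]:
  "fst \<in> borel_measurable (borel :: ('a::euclidean_space \<times> 'b::euclidean_space) measure)"
  "snd \<in> borel_measurable (borel :: ('a::euclidean_space \<times> 'b::euclidean_space) measure)"
  by (simp_all add: borel_prod[symmetric])

lemma gradient_liftD:
  assumes "gradient_lift \<Omega> w N"
  shows "finite_measure N" "sets N = sets borel" "integrable N snd"
    "C1_compact \<Omega> \<phi> \<Longrightarrow> (\<integral>x. w x \<bullet> mdiv \<phi> x \<partial>lebesgue_on \<Omega>) = - (\<integral>z. \<phi> (fst z) \<bullet> snd z \<partial>N)"
  using assms by (auto simp: gradient_lift_def)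

lemma integrable_lift_pairing:
  fixes N :: "((real^'n) \<times> (real^'n^'m)) measure"
  assumes \<phi>: "C1_compact \<Omega> \<phi>" and N [measurable_cong]: "sets N = sets borel" and snd: "integrable N snd"
  shows "integrable N (\<lambda>z. \<phi> (fst z) \<bullet> snd z)"
proof -
  obtain B where "\<And>x. norm (\<phi> x) \<le> B" using C1_compact_bounded[OF \<phi>] by blast
  moreover have [measurable]: "\<phi> \<in> borel_measurable borel" by (rule C1_compactD(5)[OF \<phi>])
  ultimately show ?thesis by (intro integrable_inner_bounded[OF snd, of _ B]) measurable
qed

lemma total_variation_le_of_lift:
  assumes \<Omega>: "open \<Omega>" and w: "integrable (lebesgue_on \<Omega>) w" and N: "gradient_lift \<Omega> w N"
  shows "is_BV \<Omega> w" "total_variation \<Omega> w \<le> (\<integral>z. norm (snd z) \<partial>N)"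
proof -
  note lift = gradient_liftD[OF N]
  note [measurable_cong] = lift(2)
  have [measurable]: "\<Omega> \<in> sets borel" using \<Omega> by simp
  let ?y = "\<lambda>z. indicat_real \<Omega> (fst z) *\<^sub>R snd z"
  have "fst \<in> borel_measurable N" by measurable
  moreover have masked_int: "integrable N ?y"
    using lift(3) by (intro Bochner_Integration.integrable_bound[OF lift(3)]) (auto simp: indicator_def)
  ultimately obtain \<nu> \<sigma> where \<nu>: "sets \<nu> = sets borel" "finite_measure \<nu>"
    and \<sigma>: "\<sigma> \<in> borel_measurable borel" "AE x in \<nu>. norm (\<sigma> x) = 1"
    and mass: "\<And>A. A \<in> sets borel \<Longrightarrow> measure \<nu> A \<le> (\<integral>z. indicator A (fst z) * norm (?y z) \<partial>N)"
    and pairing: "\<And>\<phi> B. \<phi> \<in> borel_measurable borel \<Longrightarrow> (\<And>x. norm (\<phi> x) \<le> B) \<Longrightarrow>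
      (\<integral>z. \<phi> (fst z) \<bullet> ?y z \<partial>N) = (\<integral>x. \<phi> x \<bullet> \<sigma> x \<partial>\<nu>)"
    by (rule exists_polar_representation[OF lift(1)]) blast
  have "measure \<nu> (UNIV - \<Omega>) \<le> (\<integral>z. indicator (UNIV - \<Omega>) (fst z) * norm (?y z) \<partial>N)"
    by (rule mass) measurable
  also have "\<dots> = (\<integral>z. 0 \<partial>N)"
    by (intro Bochner_Integration.integral_cong) (auto simp: indicator_def)
  finally have "emeasure \<nu> (UNIV - \<Omega>) = 0"
    by (simp add: finite_measure.emeasure_eq_measure[OF \<nu>(2)] measure_le_0_iff)
  moreover have "(\<integral>x. w x \<bullet> mdiv \<phi> x \<partial>lebesgue_on \<Omega>) = - (\<integral>x. \<phi> x \<bullet> \<sigma> x \<partial>\<nu>)"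
    if \<phi>: "C1_compact \<Omega> \<phi>" for \<phi>
  proof -
    obtain B where B: "\<And>x. norm (\<phi> x) \<le> B" using C1_compact_bounded[OF \<phi>] by blast
    have "(\<integral>z. \<phi> (fst z) \<bullet> snd z \<partial>N) = (\<integral>z. \<phi> (fst z) \<bullet> ?y z \<partial>N)"
      using C1_compactD(6)[OF \<phi>] by (intro Bochner_Integration.integral_cong) (auto simp: indicator_def)
    then show ?thesis using lift(4)[OF \<phi>] pairing[OF C1_compactD(5)[OF \<phi>] B] by simp
  qed
  ultimately have repr: "grad_repr \<Omega> w \<nu> \<sigma>"
    using \<nu> \<sigma> by (auto simp: grad_repr_def test_fun_iff_C1_compact)
  then show "is_BV \<Omega> w" using w by (auto simp: is_BV_def)
  have "total_variation \<Omega> w \<le> (\<integral>z. norm (?y z) \<partial>N)"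
    using mass[of UNIV] total_variation_eq[OF \<Omega> repr] by simp
  also have "\<dots> \<le> (\<integral>z. norm (snd z) \<partial>N)"
    by (intro integral_mono integrable_norm masked_int lift(3)) (simp add: indicator_def)
  finally show "total_variation \<Omega> w \<le> (\<integral>z. norm (snd z) \<partial>N)" .
qed

lemma gradient_lift_return_0:
  assumes \<Omega>: "open \<Omega>" and w: "is_BV \<Omega> w" and zero: "total_variation \<Omega> w = 0"
  shows "gradient_lift \<Omega> w (return borel 0)"
  unfolding gradient_lift_def
proof (intro conjI allI impI)
  fix \<phi> :: "real^'a \<Rightarrow> real^'a^'b" assume \<phi>: "C1_compact \<Omega> \<phi>"
  note [measurable] = C1_compactD(5)[OF \<phi>]
  obtain B where "\<And>x. norm (\<phi> x) \<le> B" using C1_compact_bounded[OF \<phi>] by blast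
  from integral_inner_mdiv_le[OF \<Omega> w \<phi> this] have "(\<integral>x. w x \<bullet> mdiv \<phi> x \<partial>lebesgue_on \<Omega>) = 0"
    by (simp add: zero)
  also have "\<dots> = - (\<integral>z. \<phi> (fst z) \<bullet> snd z \<partial>return borel 0)"
    by (subst integral_return) auto
  finally show "(\<integral>x. w x \<bullet> mdiv \<phi> x \<partial>lebesgue_on \<Omega>) = - (\<integral>z. \<phi> (fst z) \<bullet> snd z \<partial>return borel 0)" .
qed (auto simp: prob_space.finite_measure prob_space_return integrable_iff_bounded nn_integral_return)

lemma prob_space_density_inverse_measure:
  assumes "finite_measure \<nu>" and pos: "0 < measure \<nu> (space \<nu>)"
  shows "prob_space (density \<nu> (\<lambda>_. ennreal (1 / measure \<nu> (space \<nu>))))"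
proof (rule prob_spaceI)
  interpret finite_measure \<nu> by fact
  let ?\<rho> = "density \<nu> (\<lambda>_. ennreal (1 / measure \<nu> (space \<nu>)))"
  have "emeasure ?\<rho> (space \<nu>) = ennreal (1 / measure \<nu> (space \<nu>)) * emeasure \<nu> (space \<nu>)"
    by (subst emeasure_density) (auto simp: nn_integral_cmult)
  then show "emeasure ?\<rho> (space ?\<rho>) = 1"
    using pos by (simp add: emeasure_eq_measure ennreal_mult[symmetric])
qed

lemma exists_prob_lift_of_pos:
  fixes w :: "real^'n \<Rightarrow> real^'m"
  assumes \<Omega>: "open \<Omega>" and w: "is_BV \<Omega> w" and pos: "0 < total_variation \<Omega> w"
  obtains P where "prob_space P" "gradient_lift \<Omega> w P"
    "AE z in P. fst z \<in> \<Omega>" "AE z in P. norm (snd z) = total_variation \<Omega> w"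
proof -
  obtain \<nu> \<sigma> where repr: "grad_repr \<Omega> w \<nu> \<sigma>" using w by (auto simp: is_BV_def)
  note grad = grad_reprD[OF repr]
  define m where "m = total_variation \<Omega> w"
  have m: "0 < m" "measure \<nu> UNIV = m" using total_variation_eq[OF \<Omega> repr] pos by (simp_all add: m_def)
  have [measurable]: "\<Omega> \<in> sets borel" using \<Omega> by simp
  note [measurable_cong] = grad(1) and [measurable] = grad(5)
  define P where "P = distr (density \<nu> (\<lambda>_. ennreal (1 / m))) borel (\<lambda>x. (x, m *\<^sub>R \<sigma> x))"
  have [measurable_cong, simp]: "sets P = sets borel" by (simp add: P_def)
  have "prob_space (density \<nu> (\<lambda>_. ennreal (1 / m)))"
    using prob_space_density_inverse_measure[OF grad(3)] m by (simp add: grad(2))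
  then have prob: "prob_space P"
    unfolding P_def by (rule prob_space.prob_space_distr) measurable
  then interpret P: prob_space P .
  have "AE x in \<nu>. x \<in> \<Omega>"
    using grad(4) \<Omega> by (intro AE_I'[of "UNIV - \<Omega>"]) (auto simp: null_sets_def grad(1,2))
  then have point: "AE z in P. fst z \<in> \<Omega>"
    unfolding P_def by (subst AE_distr_iff) (auto simp: AE_density elim: eventually_mono)
  have matrix: "AE z in P. norm (snd z) = m"
    unfolding P_def using grad(6) m(1) by (subst AE_distr_iff) (auto simp: AE_density elim: eventually_mono)
  then have snd: "integrable P snd"
    by (intro P.integrable_const_bound[of _ m]) (auto elim: eventually_mono)
  have "(\<integral>x. w x \<bullet> mdiv \<phi> x \<partial>lebesgue_on \<Omega>) = - (\<integral>z. \<phi> (fst z) \<bullet> snd z \<partial>P)"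
    if \<phi>: "C1_compact \<Omega> \<phi>" for \<phi>
  proof -
    note [measurable] = C1_compactD(5)[OF \<phi>]
    have "(\<integral>z. \<phi> (fst z) \<bullet> snd z \<partial>P) = (\<integral>x. (1 / m) * (\<phi> x \<bullet> (m *\<^sub>R \<sigma> x)) \<partial>\<nu>)"
      unfolding P_def using m(1) by (subst integral_distr) (auto simp: integral_density)
    then show ?thesis using grad(7)[OF \<phi>] m(1) by simp
  qed
  then have "gradient_lift \<Omega> w P"
    using P.finite_measure_axioms snd by (simp add: gradient_lift_def)
  with prob point matrix show ?thesis using that by (simp add: m_def)
qed

lemma exists_prob_lift:
  fixes w :: "real^'n \<Rightarrow> real^'m"
  assumes \<Omega>: "open \<Omega>" and w: "is_BV \<Omega> w"
  obtains P where "prob_space P" "gradient_lift \<Omega> w P"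
    "AE z in P. fst z \<in> insert 0 \<Omega>" "AE z in P. norm (snd z) = total_variation \<Omega> w"
proof (cases "total_variation \<Omega> w = 0")
  case True
  have [measurable]: "\<Omega> \<in> sets borel" using \<Omega> by simp
  show ?thesis
  proof (rule that)
    show "gradient_lift \<Omega> w (return borel 0)" by (rule gradient_lift_return_0[OF \<Omega> w True])
    show "prob_space (return borel (0 :: (real^'n) \<times> (real^'n^'m)))" by (simp add: prob_space_return)
    show "AE z in return borel (0 :: (real^'n) \<times> (real^'n^'m)). fst z \<in> insert 0 \<Omega>"
      by (subst AE_return) auto
    show "AE z in return borel (0 :: (real^'n) \<times> (real^'n^'m)). norm (snd z) = total_variation \<Omega> w"
      using True by (subst AE_return) auto
  qed
next
  case False
  then have "0 < total_variation \<Omega> w" using total_variation_nonneg[OF \<Omega> w] by simp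
  then obtain P where "prob_space P" "gradient_lift \<Omega> w P" "AE z in P. fst z \<in> \<Omega>"
    "AE z in P. norm (snd z) = total_variation \<Omega> w"
    by (rule exists_prob_lift_of_pos[OF \<Omega> w])
  moreover from this(3) have "AE z in P. fst z \<in> insert 0 \<Omega>" by eventually_elim simp
  ultimately show ?thesis using that by blast
qed

lemma integral_norm_snd_prob_lift:
  assumes "prob_space P" "AE z in P. norm (snd z) = m" and [measurable_cong]: "sets P = sets borel"
  shows "(\<integral>z. norm (snd z :: 'b::euclidean_space) \<partial>(P :: ('a::euclidean_space \<times> 'b) measure)) = m"
proof -
  interpret prob_space P by fact
  have "(\<integral>z. norm (snd z) \<partial>P) = (\<integral>z. m \<partial>P)"
    using assms(2) by (intro integral_cong_AE) measurable
  then show ?thesis by (simp add: prob_space)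
qed

lemma total_variation_add_le:
  fixes v w :: "real^'n \<Rightarrow> real^'m"
  assumes \<Omega>: "open \<Omega>" and v: "is_BV \<Omega> v" and w: "is_BV \<Omega> w"
  shows "is_BV \<Omega> (\<lambda>x. v x + w x)"
    "total_variation \<Omega> (\<lambda>x. v x + w x) \<le> total_variation \<Omega> v + total_variation \<Omega> w"
proof -
  obtain P where P: "prob_space P" "gradient_lift \<Omega> v P" "AE z in P. norm (snd z) = total_variation \<Omega> v"
    by (rule exists_prob_lift[OF \<Omega> v])
  obtain Q where Q: "prob_space Q" "gradient_lift \<Omega> w Q" "AE z in Q. norm (snd z) = total_variation \<Omega> w"
    by (rule exists_prob_lift[OF \<Omega> w])
  have int: "integrable (lebesgue_on \<Omega>) v" "integrable (lebesgue_on \<Omega>) w"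
    using v w by (auto simp: is_BV_def)
  note P_lift = gradient_liftD[OF P(2)] and Q_lift = gradient_liftD[OF Q(2)]
  have sets: "sets Q = sets P" by (simp add: P_lift(2) Q_lift(2))
  have "(\<integral>x. (v x + w x) \<bullet> mdiv \<phi> x \<partial>lebesgue_on \<Omega>) = - (\<integral>z. \<phi> (fst z) \<bullet> snd z \<partial>add_measure P Q)"
    if \<phi>: "C1_compact \<Omega> \<phi>" for \<phi>
  proof -
    have "(\<integral>x. (v x + w x) \<bullet> mdiv \<phi> x \<partial>lebesgue_on \<Omega>)
        = (\<integral>x. v x \<bullet> mdiv \<phi> x \<partial>lebesgue_on \<Omega>) + (\<integral>x. w x \<bullet> mdiv \<phi> x \<partial>lebesgue_on \<Omega>)"
      using int by (simp add: inner_add_left integrable_inner_mdiv[OF \<phi>])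
    also have "\<dots> = - (\<integral>z. \<phi> (fst z) \<bullet> snd z \<partial>P) - (\<integral>z. \<phi> (fst z) \<bullet> snd z \<partial>Q)"
      by (simp add: P_lift(4)[OF \<phi>] Q_lift(4)[OF \<phi>])
    finally show ?thesis
      using integral_add_measure[OF sets integrable_lift_pairing[OF \<phi> P_lift(2,3)] integrable_lift_pairing[OF \<phi> Q_lift(2,3)]]
      by simp
  qed
  then have lift: "gradient_lift \<Omega> (\<lambda>x. v x + w x) (add_measure P Q)"
    using finite_measure_add_measure[OF sets P_lift(1) Q_lift(1)] P_lift(2,3) Q_lift(3)
    by (simp add: gradient_lift_def integrable_add_measure_iff[OF sets])
  note bounds = total_variation_le_of_lift[OF \<Omega> Bochner_Integration.integrable_add[OF int] lift]
  show "is_BV \<Omega> (\<lambda>x. v x + w x)" by (rule bounds(1))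
  have "(\<integral>z. norm (snd z) \<partial>add_measure P Q) = total_variation \<Omega> v + total_variation \<Omega> w"
    using P_lift(3) Q_lift(3) by (simp add: integral_add_measure[OF sets]
        integral_norm_snd_prob_lift[OF P(1,3) P_lift(2)] integral_norm_snd_prob_lift[OF Q(1,3) Q_lift(2)])
  with bounds(2) show "total_variation \<Omega> (\<lambda>x. v x + w x) \<le> total_variation \<Omega> v + total_variation \<Omega> w"
    by simp
qed

lemma total_variation_scaleR_le:
  fixes w :: "real^'n \<Rightarrow> real^'m"
  assumes \<Omega>: "open \<Omega>" and w: "is_BV \<Omega> w"
  shows "is_BV \<Omega> (\<lambda>x. c *\<^sub>R w x)"
    "total_variation \<Omega> (\<lambda>x. c *\<^sub>R w x) \<le> \<bar>c\<bar> * total_variation \<Omega> w"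
proof -
  obtain P where P: "prob_space P" "gradient_lift \<Omega> w P" "AE z in P. norm (snd z) = total_variation \<Omega> w"
    by (rule exists_prob_lift[OF \<Omega> w])
  note lift = gradient_liftD[OF P(2)]
  note [measurable_cong] = lift(2)
  have int: "integrable (lebesgue_on \<Omega>) w" using w by (simp add: is_BV_def)
  define Q where "Q = distr P borel (\<lambda>z. (fst z, c *\<^sub>R snd z))"
  have "gradient_lift \<Omega> (\<lambda>x. c *\<^sub>R w x) Q"
    unfolding gradient_lift_def
  proof (intro conjI allI impI)
    show "finite_measure Q" unfolding Q_def by (rule finite_measure.finite_measure_distr[OF lift(1)]) measurable
    show "sets Q = sets borel" by (simp add: Q_def)
    show "integrable Q snd" unfolding Q_def using lift(3) by (subst integrable_distr_eq) auto
    fix \<phi> :: "real^'n \<Rightarrow> real^'n^'m" assume \<phi>: "C1_compact \<Omega> \<phi>"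
    note [measurable] = C1_compactD(5)[OF \<phi>]
    have "(\<integral>z. \<phi> (fst z) \<bullet> snd z \<partial>Q) = c * (\<integral>z. \<phi> (fst z) \<bullet> snd z \<partial>P)"
      unfolding Q_def by (subst integral_distr) auto
    then show "(\<integral>x. (c *\<^sub>R w x) \<bullet> mdiv \<phi> x \<partial>lebesgue_on \<Omega>) = - (\<integral>z. \<phi> (fst z) \<bullet> snd z \<partial>Q)"
      by (simp add: lift(4)[OF \<phi>])
  qed
  note bounds = total_variation_le_of_lift[OF \<Omega> _ this]
  show "is_BV \<Omega> (\<lambda>x. c *\<^sub>R w x)" using int by (intro bounds(1)) simp
  have "(\<integral>z. norm (snd z) \<partial>Q) = \<bar>c\<bar> * total_variation \<Omega> w"
    unfolding Q_def by (subst integral_distr) (auto simp: integral_norm_snd_prob_lift[OF P(1,3) lift(2)])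
  with bounds(2) int show "total_variation \<Omega> (\<lambda>x. c *\<^sub>R w x) \<le> \<bar>c\<bar> * total_variation \<Omega> w"
    by simp
qed

lemma gradient_lift_of_weak_limit:
  fixes w :: "nat \<Rightarrow> real^'n \<Rightarrow> real^'m"
  assumes w: "\<And>k. integrable (lebesgue_on \<Omega>) (w k)" and v: "integrable (lebesgue_on \<Omega>) v"
    and lim: "(\<lambda>k. \<integral>x. norm (w k x - v x) \<partial>lebesgue_on \<Omega>) \<longlonglongrightarrow> 0"
    and P: "\<And>k. gradient_lift \<Omega> (w k) (P k)"
    and Q: "finite_measure Q" "sets Q = sets borel" "integrable Q snd"
    and weak: "\<And>\<phi> :: (real^'n) \<times> (real^'n^'m) \<Rightarrow> real. continuous_on UNIV \<phi> \<Longrightarrow>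
      (\<lambda>k. \<integral>z. \<phi> z \<partial>P k) \<longlonglongrightarrow> (\<integral>z. \<phi> z \<partial>Q)"
  shows "gradient_lift \<Omega> v Q"
  unfolding gradient_lift_def
proof (intro conjI allI impI)
  fix \<phi> :: "real^'n \<Rightarrow> real^'n^'m" assume \<phi>: "C1_compact \<Omega> \<phi>"
  have "continuous_on UNIV (\<lambda>z :: (real^'n) \<times> (real^'n^'m). \<phi> (fst z) \<bullet> snd z)"
    by (intro continuous_intros continuous_on_compose2[OF C1_compactD(4)[OF \<phi>]]) auto
  then have "(\<lambda>k. - (\<integral>z. \<phi> (fst z) \<bullet> snd z \<partial>P k)) \<longlonglongrightarrow> - (\<integral>z. \<phi> (fst z) \<bullet> snd z \<partial>Q)"
    by (intro tendsto_minus weak)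
  then have "(\<lambda>k. \<integral>x. w k x \<bullet> mdiv \<phi> x \<partial>lebesgue_on \<Omega>) \<longlonglongrightarrow> - (\<integral>z. \<phi> (fst z) \<bullet> snd z \<partial>Q)"
    by (simp add: gradient_liftD(4)[OF P \<phi>])
  with integral_inner_mdiv_tendsto[OF \<phi> w v lim]
  show "(\<integral>x. v x \<bullet> mdiv \<phi> x \<partial>lebesgue_on \<Omega>) = - (\<integral>z. \<phi> (fst z) \<bullet> snd z \<partial>Q)"
    by (rule LIMSEQ_unique)
qed (fact Q)+

lemma exists_bounded_prob_lift:
  fixes w :: "real^'n \<Rightarrow> real^'m"
  assumes \<Omega>: "open \<Omega>" "\<Omega> \<subseteq> cball 0 R" and R: "0 \<le> R"
    and w: "is_BV \<Omega> w" "total_variation \<Omega> w \<le> D"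
  obtains P where "prob_space P" "gradient_lift \<Omega> w P" "AE z in P. norm z \<le> R + D"
    "(\<integral>z. norm (snd z) \<partial>P) = total_variation \<Omega> w"
proof -
  obtain P where P: "prob_space P" "gradient_lift \<Omega> w P"
    "AE z in P. fst z \<in> insert 0 \<Omega>" "AE z in P. norm (snd z) = total_variation \<Omega> w"
    by (rule exists_prob_lift[OF \<Omega>(1) w(1)])
  have "AE z in P. norm z \<le> R + D"
    using P(3,4)
  proof eventually_elim
    case (elim z)
    then have "norm (fst z) \<le> R" "norm (snd z) \<le> D" using \<Omega>(2) R w(2) by (auto simp: subset_iff)
    then show ?case using norm_Pair_le[of "fst z" "snd z"] by simp
  qed
  moreover have "(\<integral>z. norm (snd z) \<partial>P) = total_variation \<Omega> w"
    by (rule integral_norm_snd_prob_lift[OF P(1,4) gradient_liftD(2)[OF P(2)]])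
  ultimately show ?thesis using P(1,2) that by blast
qed

lemma total_variation_le_of_tendsto:
  fixes w :: "nat \<Rightarrow> real^'n \<Rightarrow> real^'m"
  assumes \<Omega>: "open \<Omega>" "bounded \<Omega>" and w: "\<And>k. is_BV \<Omega> (w k)" and v: "integrable (lebesgue_on \<Omega>) v"
    and lim: "(\<lambda>k. \<integral>x. norm (w k x - v x) \<partial>lebesgue_on \<Omega>) \<longlonglongrightarrow> 0"
    and c: "\<And>k. total_variation \<Omega> (w k) \<le> c k" "c \<longlonglongrightarrow> C"
  shows "is_BV \<Omega> v" "total_variation \<Omega> v \<le> C"
proof -
  obtain R where R: "0 < R" "\<Omega> \<subseteq> cball 0 R" using bounded_subset_ballD[OF \<Omega>(2), of 0] ball_subset_cball by blast
  obtain D where D: "\<And>k. c k \<le> D"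
    using convergent_imp_Bseq[OF convergentI[OF c(2)]] by (auto simp: Bseq_def abs_le_iff)
  have "\<exists>P. prob_space P \<and> gradient_lift \<Omega> (w k) P \<and> (AE z in P. norm z \<le> R + D) \<and>
      (\<integral>z. norm (snd z) \<partial>P) = total_variation \<Omega> (w k)" for k
    by (rule exists_bounded_prob_lift[OF \<Omega>(1) R(2) less_imp_le[OF R(1)] w[of k] order_trans[OF c(1) D]]) blast
  then obtain P where P: "\<And>k. prob_space (P k)" "\<And>k. gradient_lift \<Omega> (w k) (P k)"
    "\<And>k. AE z in P k. norm z \<le> R + D" "\<And>k. (\<integral>z. norm (snd z) \<partial>P k) = total_variation \<Omega> (w k)"
    by metis
  obtain r Q B where r: "strict_mono (r :: nat \<Rightarrow> nat)" and Q: "prob_space Q" "sets Q = sets borel"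
    and B: "AE z in Q. norm z \<le> B"
    and weak: "\<And>\<phi> :: (real^'n) \<times> (real^'n^'m) \<Rightarrow> real. continuous_on UNIV \<phi> \<Longrightarrow>
      (\<lambda>k. \<integral>z. \<phi> z \<partial>P (r k)) \<longlonglongrightarrow> (\<integral>z. \<phi> z \<partial>Q)"
    by (rule prob_measures_on_ball_subseq[of P, OF P(1) gradient_liftD(2)[OF P(2)] P(3)]) blast
  interpret Q: prob_space Q by (rule Q(1))
  note [measurable_cong] = Q(2)
  have "AE z in Q. norm (snd z) \<le> B"
    using B by eventually_elim (metis norm_snd_le order_trans prod.collapse)
  then have "integrable Q snd" by (intro Q.integrable_const_bound[of _ B]) measurable
  then have "gradient_lift \<Omega> v Q"
    using LIMSEQ_subseq_LIMSEQ[OF lim r] w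
    by (intro gradient_lift_of_weak_limit[OF _ v _ P(2) Q.finite_measure_axioms Q(2) _ weak])
      (auto simp: comp_def is_BV_def)
  note bounds = total_variation_le_of_lift[OF \<Omega>(1) v this]
  show "is_BV \<Omega> v" by (rule bounds(1))
  have "(\<lambda>k. total_variation \<Omega> (w (r k))) \<longlonglongrightarrow> (\<integral>z. norm (snd z) \<partial>Q)"
    using weak[of "\<lambda>z. norm (snd z)"] by (simp add: P(4) continuous_on_norm continuous_on_snd)
  moreover have "(\<lambda>k. c (r k)) \<longlonglongrightarrow> C" using LIMSEQ_subseq_LIMSEQ[OF c(2) r] by (simp add: comp_def)
  ultimately have "(\<integral>z. norm (snd z) \<partial>Q) \<le> C"
    by (rule LIMSEQ_le) (use c(1) in blast)
  with bounds(2) show "total_variation \<Omega> v \<le> C" by simp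
qed

section \<open>Almost minimizers of the total variation energy\<close>

locale bounded_domain =
  fixes \<Omega> :: "(real^'n) set"
  assumes open_domain: "open \<Omega>" and bounded_domain: "bounded \<Omega>"
begin

abbreviation "M \<equiv> lebesgue_on \<Omega>"

lemma domain_lmeasurable: "\<Omega> \<in> lmeasurable"
  using open_domain bounded_domain by (simp add: lmeasurable_open)

lemma domain_lebesgue [measurable]: "\<Omega> \<in> sets lebesgue"
  by (rule fmeasurableD[OF domain_lmeasurable])

sublocale M: finite_measure M
proof
  have "emeasure M (space M) = emeasure lebesgue \<Omega>"
    by (subst emeasure_restrict_space) auto
  then show "emeasure M (space M) \<noteq> \<infinity>"
    using fmeasurableD2[OF domain_lmeasurable] by (simp only: infinity_ennreal_def not_False_eq_True)
qed

end

locale denoising = bounded_domain \<Omega>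
  for \<Omega> :: "(real^'n) set" +
  fixes lam :: real and f :: "real^'n \<Rightarrow> real^'m"
  assumes lam: "0 < lam" and f: "square_integrable (lebesgue_on \<Omega>) f"
begin

definition energy :: "(real^'n \<Rightarrow> real^'m) \<Rightarrow> ennreal" where
  "energy w = ennreal (total_variation \<Omega> w) + ennreal (lam/2) * (\<integral>\<^sup>+x. ennreal ((norm (w x - f x))\<^sup>2) \<partial>M)"

definition almost_minimizer :: "real \<Rightarrow> (real^'n \<Rightarrow> real^'m) \<Rightarrow> bool" where
  "almost_minimizer \<epsilon> w \<longleftrightarrow> is_BV \<Omega> w \<and> (\<forall>v. is_BV \<Omega> v \<longrightarrow> energy w \<le> energy v + ennreal \<epsilon>)"

lemma TV_energy_iff:
  assumes "is_BV \<Omega> w"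
  shows "TV_energy \<Omega> lam f w k \<longleftrightarrow> k = energy w"
proof -
  have mass: "emeasure \<nu> UNIV = ennreal (total_variation \<Omega> w)" if repr: "grad_repr \<Omega> w \<nu> \<sigma>" for \<nu> \<sigma>
    using finite_measure.emeasure_eq_measure[OF grad_reprD(3)[OF repr]] total_variation_eq[OF open_domain repr] by simp
  show ?thesis
  proof
    assume "TV_energy \<Omega> lam f w k"
    then obtain \<nu> \<sigma> where repr: "grad_repr \<Omega> w \<nu> \<sigma>"
      and k: "k = emeasure \<nu> UNIV + ennreal (lam/2) * (\<integral>\<^sup>+x. ennreal ((norm (w x - f x))\<^sup>2) \<partial>M)"
      unfolding TV_energy_def by blast
    show "k = energy w" unfolding k energy_def mass[OF repr] ..
  next
    assume k: "k = energy w"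
    obtain \<nu> \<sigma> where repr: "grad_repr \<Omega> w \<nu> \<sigma>" using assms by (auto simp: is_BV_def)
    have "k = emeasure \<nu> UNIV + ennreal (lam/2) * (\<integral>\<^sup>+x. ennreal ((norm (w x - f x))\<^sup>2) \<partial>M)"
      unfolding k energy_def mass[OF repr] ..
    with repr show "TV_energy \<Omega> lam f w k" unfolding TV_energy_def by blast
  qed
qed

lemma TV_minimizer_iff_almost_minimizer_0:
  "BV_minimizer \<Omega> (TV_energy \<Omega> lam f) w \<longleftrightarrow> almost_minimizer 0 w"
  unfolding BV_minimizer_def almost_minimizer_def by (simp add: TV_energy_iff cong: conj_cong)

definition admissible :: "(real^'n \<Rightarrow> real^'m) \<Rightarrow> bool" where
  "admissible w \<longleftrightarrow> is_BV \<Omega> w \<and> square_integrable M w"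

definition real_energy :: "(real^'n \<Rightarrow> real^'m) \<Rightarrow> real" where
  "real_energy w = total_variation \<Omega> w + lam/2 * (L2_norm M (\<lambda>x. w x - f x))\<^sup>2"

lemma admissible_zero: "admissible (\<lambda>_. 0)"
  by (simp add: admissible_def is_BV_zero M.square_integrable_const)

lemma real_energy_nonneg: "admissible w \<Longrightarrow> 0 \<le> real_energy w"
  using lam total_variation_nonneg[OF open_domain, of w] by (simp add: real_energy_def admissible_def)

lemma energy_eq_real_energy:
  assumes "admissible w"
  shows "energy w = ennreal (real_energy w)"
proof -
  have "square_integrable M (\<lambda>x. w x - f x)"
    using assms f by (simp add: admissible_def square_integrable_diff)
  moreover have "0 \<le> total_variation \<Omega> w"
    using assms total_variation_nonneg[OF open_domain, of w] by (simp add: admissible_def)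
  ultimately show ?thesis
    using lam by (simp add: energy_def real_energy_def nn_integral_norm_power2 ennreal_mult[symmetric])
qed

lemma admissible_of_finite_fidelity:
  assumes w: "is_BV \<Omega> w"
    and fin: "ennreal (lam/2) * (\<integral>\<^sup>+x. ennreal ((norm (w x - f x))\<^sup>2) \<partial>M) < \<infinity>"
  shows "admissible w"
proof -
  note [measurable] = square_integrableD(1)[OF f]
  have [measurable]: "w \<in> borel_measurable M" using w by (auto simp: is_BV_def)
  have "(\<integral>\<^sup>+x. ennreal ((norm (w x - f x))\<^sup>2) \<partial>M) < \<infinity>"
    using fin lam by (auto simp: ennreal_mult_less_top)
  then have "square_integrable M (\<lambda>x. w x - f x)"
    by (auto simp: square_integrable_def intro: integrableI_nonneg)
  from square_integrable_add[OF this f] w show ?thesis by (simp add: admissible_def)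
qed

lemma admissible_of_finite_energy: "is_BV \<Omega> w \<Longrightarrow> energy w < \<infinity> \<Longrightarrow> admissible w"
  by (rule admissible_of_finite_fidelity) (simp_all add: energy_def)

lemma almost_minimizer_iff:
  assumes "0 \<le> \<epsilon>"
  shows "almost_minimizer \<epsilon> w \<longleftrightarrow> admissible w \<and> (\<forall>v. admissible v \<longrightarrow> real_energy w \<le> real_energy v + \<epsilon>)"
proof
  assume w: "almost_minimizer \<epsilon> w"
  have "energy w \<le> ennreal (real_energy (\<lambda>_. 0)) + ennreal \<epsilon>"
    using w admissible_zero energy_eq_real_energy unfolding almost_minimizer_def admissible_def by metis
  also have "\<dots> < \<infinity>" by simp
  finally have "admissible w"
    using w by (intro admissible_of_finite_energy) (auto simp: almost_minimizer_def)
  moreover have "real_energy w \<le> real_energy v + \<epsilon>" if v: "admissible v" for v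
  proof -
    have "ennreal (real_energy w) \<le> ennreal (real_energy v + \<epsilon>)"
      using w v \<open>admissible w\<close> real_energy_nonneg[OF v] assms
      by (simp add: almost_minimizer_def energy_eq_real_energy[symmetric] admissible_def)
    then show ?thesis using real_energy_nonneg[OF v] assms by (simp del: ennreal_plus)
  qed
  ultimately show "admissible w \<and> (\<forall>v. admissible v \<longrightarrow> real_energy w \<le> real_energy v + \<epsilon>)" by blast
next
  assume w: "admissible w \<and> (\<forall>v. admissible v \<longrightarrow> real_energy w \<le> real_energy v + \<epsilon>)"
  have "energy w \<le> energy v + ennreal \<epsilon>" if v: "is_BV \<Omega> v" for v
  proof (cases "energy v = \<infinity>")
    case False
    then have "admissible v" using v by (intro admissible_of_finite_energy) (auto simp: less_top)
    then show ?thesis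
      using w assms real_energy_nonneg[of v]
      by (simp add: energy_eq_real_energy ennreal_plus[symmetric] ennreal_leI del: ennreal_plus)
  qed simp
  with w show "almost_minimizer \<epsilon> w" by (simp add: almost_minimizer_def admissible_def)
qed

lemma real_energy_midpoint_le:
  assumes v: "admissible v" and w: "admissible w"
  defines "z \<equiv> \<lambda>x. (1/2) *\<^sub>R (v x + w x)"
  shows "admissible z"
    "real_energy z \<le> (real_energy v + real_energy w) / 2 - lam / 8 * (L2_norm M (\<lambda>x. v x - w x))\<^sup>2"
proof -
  have BV: "is_BV \<Omega> v" "is_BV \<Omega> w" and square_int: "square_integrable M v" "square_integrable M w"
    using v w by (auto simp: admissible_def)
  note sum = total_variation_add_le[OF open_domain BV]
  have "square_integrable M z"
    unfolding z_def by (intro square_integrable_scaleR square_integrable_add square_int)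
  then show "admissible z"
    using total_variation_scaleR_le(1)[OF open_domain sum(1)] by (simp add: admissible_def z_def)
  have "total_variation \<Omega> z \<le> (1/2) * total_variation \<Omega> (\<lambda>x. v x + w x)"
    using total_variation_scaleR_le(2)[OF open_domain sum(1), of "1/2"] by (simp add: z_def)
  also have "\<dots> \<le> (total_variation \<Omega> v + total_variation \<Omega> w) / 2"
    using sum(2) by simp
  finally have tv: "total_variation \<Omega> z \<le> (total_variation \<Omega> v + total_variation \<Omega> w) / 2" .
  have "z x - f x = (1/2) *\<^sub>R ((v x - f x) + (w x - f x))" for x
    unfolding z_def by (simp add: algebra_simps flip: scaleR_2)
  then have "(L2_norm M (\<lambda>x. z x - f x))\<^sup>2 = (L2_norm M (\<lambda>x. (v x - f x) + (w x - f x)))\<^sup>2 / 4"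
    by (simp only: L2_norm_scaleR) (simp add: power_divide)
  also have "\<dots> = (L2_norm M (\<lambda>x. v x - f x))\<^sup>2 / 2 + (L2_norm M (\<lambda>x. w x - f x))\<^sup>2 / 2
      - (L2_norm M (\<lambda>x. v x - w x))\<^sup>2 / 4"
    using L2_norm_parallelogram[OF square_integrable_diff[OF square_int(1) f] square_integrable_diff[OF square_int(2) f]]
    by simp
  finally have fidelity: "(L2_norm M (\<lambda>x. z x - f x))\<^sup>2 = (L2_norm M (\<lambda>x. v x - f x))\<^sup>2 / 2
      + (L2_norm M (\<lambda>x. w x - f x))\<^sup>2 / 2 - (L2_norm M (\<lambda>x. v x - w x))\<^sup>2 / 4" .
  have "lam/2 * (L2_norm M (\<lambda>x. z x - f x))\<^sup>2 = (lam/2 * (L2_norm M (\<lambda>x. v x - f x))\<^sup>2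
      + lam/2 * (L2_norm M (\<lambda>x. w x - f x))\<^sup>2) / 2 - lam/8 * (L2_norm M (\<lambda>x. v x - w x))\<^sup>2"
    unfolding fidelity by (simp add: algebra_simps)
  then show "real_energy z \<le> (real_energy v + real_energy w) / 2 - lam / 8 * (L2_norm M (\<lambda>x. v x - w x))\<^sup>2"
    using tv unfolding real_energy_def by argo
qed

lemma almost_minimizer_dist:
  assumes \<epsilon>: "0 \<le> \<epsilon>" "0 \<le> \<epsilon>'" and v: "almost_minimizer \<epsilon> v" and w: "almost_minimizer \<epsilon>' w"
  shows "(L2_norm M (\<lambda>x. v x - w x))\<^sup>2 \<le> 4 * (\<epsilon> + \<epsilon>') / lam"
proof -
  let ?z = "\<lambda>x. (1/2) *\<^sub>R (v x + w x)"
  have adm: "admissible v" "admissible w" using v w \<epsilon> by (simp_all add: almost_minimizer_iff)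
  note z = real_energy_midpoint_le[OF adm]
  have "real_energy v \<le> real_energy ?z + \<epsilon>" "real_energy w \<le> real_energy ?z + \<epsilon>'"
    using v w \<epsilon> z(1) by (simp_all add: almost_minimizer_iff)
  with z(2) have "lam / 4 * (L2_norm M (\<lambda>x. v x - w x))\<^sup>2 \<le> \<epsilon> + \<epsilon>'" by argo
  then show ?thesis using lam by (simp add: field_simps)
qed

lemma real_energy_le_of_tendsto:
  fixes w :: "nat \<Rightarrow> real^'n \<Rightarrow> real^'m"
  assumes w: "\<And>k. admissible (w k)" and u: "square_integrable M u"
    and lim: "(\<lambda>k. L2_norm M (\<lambda>x. w k x - u x)) \<longlonglongrightarrow> 0"
    and c: "\<And>k. real_energy (w k) \<le> c k" "c \<longlonglongrightarrow> C"
  shows "admissible u" "real_energy u \<le> C"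
proof -
  have BV: "is_BV \<Omega> (w k)" and square_int: "square_integrable M (w k)" for k using w by (auto simp: admissible_def)
  have L1_lim: "(\<lambda>k. \<integral>x. norm (w k x - u x) \<partial>M) \<longlonglongrightarrow> 0"
  proof (rule tendsto_sandwich[OF _ _ tendsto_const])
    show "(\<lambda>k. sqrt (measure M (space M)) * L2_norm M (\<lambda>x. w k x - u x)) \<longlonglongrightarrow> 0"
      using tendsto_mult_left[OF lim, of "sqrt (measure M (space M))"] by simp
  qed (use M.integral_norm_le_L2_norm[OF square_integrable_diff[OF square_int u]] in auto)
  have "(\<lambda>k. L2_norm M (\<lambda>x. w k x - f x) - L2_norm M (\<lambda>x. u x - f x)) \<longlonglongrightarrow> 0"
  proof (rule Lim_null_comparison[OF always_eventually lim], rule allI)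
    show "norm (L2_norm M (\<lambda>x. w k x - f x) - L2_norm M (\<lambda>x. u x - f x)) \<le> L2_norm M (\<lambda>x. w k x - u x)" for k
      using abs_L2_norm_diff_le[OF square_integrable_diff[OF square_int f] square_integrable_diff[OF u f], of k] by simp
  qed
  then have "(\<lambda>k. L2_norm M (\<lambda>x. w k x - f x)) \<longlonglongrightarrow> L2_norm M (\<lambda>x. u x - f x)"
    by (rule LIM_zero_cancel)
  then have c_lim: "(\<lambda>k. c k - lam/2 * (L2_norm M (\<lambda>x. w k x - f x))\<^sup>2) \<longlonglongrightarrow> C - lam/2 * (L2_norm M (\<lambda>x. u x - f x))\<^sup>2"
    by (intro tendsto_intros c(2))
  have "total_variation \<Omega> (w k) \<le> c k - lam/2 * (L2_norm M (\<lambda>x. w k x - f x))\<^sup>2" for k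
    using c(1)[of k] by (simp add: real_energy_def)
  note tv = total_variation_le_of_tendsto[OF open_domain bounded_domain BV
      M.integrable_of_square_integrable[OF u] L1_lim this c_lim]
  show "admissible u" using tv(1) u by (simp add: admissible_def)
  show "real_energy u \<le> C" using tv(2) by (simp add: real_energy_def)
qed

lemma almost_minimizers_Cauchy:
  assumes w: "\<And>k. almost_minimizer (\<epsilon> k) (w k)" and \<epsilon>: "\<And>k. 0 \<le> \<epsilon> k" "\<epsilon> \<longlonglongrightarrow> 0" and e: "0 < e"
  shows "\<exists>N. \<forall>i\<ge>N. \<forall>j\<ge>N. L2_norm M (\<lambda>x. w i x - w j x) < e"
proof -
  have "0 < lam * e\<^sup>2 / 8" using lam e by simp
  from order_tendstoD(2)[OF \<epsilon>(2) this] obtain N where N: "\<And>k. N \<le> k \<Longrightarrow> \<epsilon> k < lam * e\<^sup>2 / 8"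
    unfolding eventually_sequentially by blast
  have "L2_norm M (\<lambda>x. w i x - w j x) < e" if "N \<le> i" "N \<le> j" for i j
  proof -
    have "(L2_norm M (\<lambda>x. w i x - w j x))\<^sup>2 \<le> 4 * (\<epsilon> i + \<epsilon> j) / lam"
      by (rule almost_minimizer_dist[OF \<epsilon>(1) \<epsilon>(1) w w])
    also have "\<dots> < e\<^sup>2"
    proof -
      have "4 * (\<epsilon> i + \<epsilon> j) < e\<^sup>2 * lam" using N[OF that(1)] N[OF that(2)] by argo
      then show ?thesis by (simp only: pos_divide_less_eq[OF lam])
    qed
    finally show ?thesis by (rule power2_less_imp_less) (use e in simp)
  qed
  then show ?thesis by blast
qed

lemma exists_minimizing_sequence:
  assumes \<epsilon>: "\<And>k::nat. 0 < \<epsilon> k"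
  obtains w I where "\<And>k. almost_minimizer (\<epsilon> k) (w k)" "\<And>k. real_energy (w k) \<le> I + \<epsilon> k"
    "\<And>v. admissible v \<Longrightarrow> I \<le> real_energy v"
proof -
  define I where "I = Inf (real_energy ` {w. admissible w})"
  have nonempty: "real_energy ` {w. admissible w} \<noteq> {}" using admissible_zero by blast
  have bdd: "bdd_below (real_energy ` {w. admissible w})"
    using real_energy_nonneg by (auto intro: bdd_belowI[of _ 0])
  have I_le: "I \<le> real_energy v" if "admissible v" for v
    unfolding I_def using that by (intro cInf_lower bdd) auto
  have "\<exists>w. admissible w \<and> real_energy w < I + \<epsilon> k" for k
    using cInf_lessD[OF nonempty, of "I + \<epsilon> k"] \<epsilon>[of k] by (auto simp: I_def)
  then obtain w where w: "\<And>k. admissible (w k)" "\<And>k. real_energy (w k) < I + \<epsilon> k" by metis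
  have "real_energy (w k) \<le> real_energy v + \<epsilon> k" if "admissible v" for k v
    using w(2)[of k] I_le[OF that] by linarith
  then have "almost_minimizer (\<epsilon> k) (w k)" for k
    using w(1) \<epsilon>[of k] by (simp add: almost_minimizer_iff)
  with w(2) I_le that show ?thesis by (metis less_imp_le)
qed

lemma exists_minimizer: "\<exists>u. almost_minimizer 0 u"
proof -
  define \<epsilon> where "\<epsilon> k = 1 / real (Suc k)" for k
  have \<epsilon>: "0 < \<epsilon> k" for k by (simp add: \<epsilon>_def)
  have \<epsilon>_lim: "\<epsilon> \<longlonglongrightarrow> 0" unfolding \<epsilon>_def by (rule LIMSEQ_Suc[OF lim_1_over_n])
  obtain w I where w: "\<And>k. almost_minimizer (\<epsilon> k) (w k)"
    and I: "\<And>k. real_energy (w k) \<le> I + \<epsilon> k" "\<And>v. admissible v \<Longrightarrow> I \<le> real_energy v"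
    by (rule exists_minimizing_sequence[of \<epsilon>, OF \<epsilon>]) blast
  have adm: "admissible (w k)" for k using w[of k] \<epsilon>[of k] by (simp add: almost_minimizer_iff)
  then have square_int: "square_integrable M (w k)" for k by (simp add: admissible_def)
  obtain u where u: "square_integrable M u" "(\<lambda>k. L2_norm M (\<lambda>x. w k x - u x)) \<longlonglongrightarrow> 0"
    by (rule M.L2_complete[OF square_int almost_minimizers_Cauchy[OF w less_imp_le[OF \<epsilon>] \<epsilon>_lim]])
  have "(\<lambda>k. I + \<epsilon> k) \<longlonglongrightarrow> I" using tendsto_add[OF tendsto_const \<epsilon>_lim, of I] by simp
  note limit = real_energy_le_of_tendsto[OF adm u I(1) this]
  have "almost_minimizer 0 u"
    using limit I(2) by (auto simp: almost_minimizer_iff intro: order_trans)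
  then show ?thesis by blast
qed

lemma minimizer_unique:
  assumes "almost_minimizer 0 u" "almost_minimizer 0 v"
  shows "AE x in M. v x = u x"
proof (rule AE_eq_of_L2_norm_diff_eq_0)
  show "square_integrable M u" "square_integrable M v"
    using assms by (simp_all add: almost_minimizer_iff admissible_def)
  show "L2_norm M (\<lambda>x. v x - u x) = 0"
    using almost_minimizer_dist[OF _ _ assms(2,1)] by simp
qed

lemma almost_minimizer_tendsto:
  assumes u: "almost_minimizer 0 u" and w: "\<forall>\<^sub>F i in F. 0 \<le> \<epsilon> i \<and> almost_minimizer (\<epsilon> i) (w i)"
    and \<epsilon>: "(\<epsilon> \<longlongrightarrow> 0) F"
  shows "((\<lambda>i. L2_norm M (\<lambda>x. w i x - u x)) \<longlongrightarrow> 0) F"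
proof (rule tendsto_sandwich[OF _ _ tendsto_const])
  have "((\<lambda>i. sqrt (4 * \<epsilon> i / lam)) \<longlongrightarrow> sqrt (4 * 0 / lam)) F"
    using lam by (intro tendsto_intros \<epsilon>) auto
  then show "((\<lambda>i. sqrt (4 * \<epsilon> i / lam)) \<longlongrightarrow> 0) F" by simp
  show "\<forall>\<^sub>F i in F. L2_norm M (\<lambda>x. w i x - u x) \<le> sqrt (4 * \<epsilon> i / lam)"
    using w
  proof eventually_elim
    case (elim i)
    then show ?case using almost_minimizer_dist[of "\<epsilon> i" 0 "w i" u] u by (intro real_le_rsqrt) simp
  qed
qed (simp add: L2_norm_nonneg)

end

section \<open>Comparison of the energies\<close>

lemma Psi_0: "Psi \<mu> 0 = 0"
  by (simp add: Psi_def Phi_def)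

lemma integral_one_plus_powr:
  fixes a s :: real
  assumes a: "a \<noteq> -1" and s: "0 \<le> s"
  shows "integral {0..s} (\<lambda>r. (1 + r) powr a) = ((1 + s) powr (a + 1) - 1) / (a + 1)"
proof (rule integral_unique)
  have "((\<lambda>r. (1 + r) powr a) has_integral (1 + s) powr (a + 1) / (a + 1) - (1 + 0) powr (a + 1) / (a + 1)) {0..s}"
  proof (rule fundamental_theorem_of_calculus[OF s])
    fix x assume "x \<in> {0..s}"
    then show "((\<lambda>r. (1 + r) powr (a + 1) / (a + 1)) has_vector_derivative (1 + x) powr a) (at x within {0..s})"
      using a by (auto intro!: derivative_eq_intros simp: has_real_derivative_iff_has_vector_derivative[symmetric])
  qed
  then show "((\<lambda>r. (1 + r) powr a) has_integral ((1 + s) powr (a + 1) - 1) / (a + 1)) {0..s}"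
    by (simp add: diff_divide_distrib)
qed

lemma Psi_closed_form:
  assumes \<mu>: "2 < \<mu>" and t: "0 \<le> t"
  shows "Psi \<mu> t = t - (1 - (1 + t) powr (2 - \<mu>)) / (\<mu> - 2)"
proof -
  have powr_int: "(\<lambda>s. (1 + s) powr (1 - \<mu>)) integrable_on {0..t}"
    by (intro integrable_continuous_real continuous_intros) auto
  have "Phi \<mu> t = integral {0..t} (\<lambda>s. (1 - (1 + s) powr (1 - \<mu>)) / (\<mu> - 1))"
    unfolding Phi_def
  proof (rule integral_cong)
    show "integral {0..s} (\<lambda>r. (1 + r) powr (- \<mu>)) = (1 - (1 + s) powr (1 - \<mu>)) / (\<mu> - 1)" if "s \<in> {0..t}" for s
      using integral_one_plus_powr[of "- \<mu>" s] \<mu> that by (simp add: divide_simps) (simp add: algebra_simps)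
  qed
  then have "Psi \<mu> t = integral {0..t} (\<lambda>s. 1 - (1 + s) powr (1 - \<mu>))"
    using \<mu> by (simp add: Psi_def)
  also have "\<dots> = t - integral {0..t} (\<lambda>s. (1 + s) powr (1 - \<mu>))"
    by (subst Henstock_Kurzweil_Integration.integral_diff) (use powr_int t in auto)
  also have "integral {0..t} (\<lambda>s. (1 + s) powr (1 - \<mu>)) = (1 - (1 + t) powr (2 - \<mu>)) / (\<mu> - 2)"
    using integral_one_plus_powr[of "1 - \<mu>" t] \<mu> t by (simp add: divide_simps) (simp add: algebra_simps)
  finally show ?thesis .
qed

lemma Psi_bounds:
  assumes \<mu>: "2 < \<mu>" and t: "0 \<le> t"
  shows "Psi \<mu> t \<le> t" and "t \<le> Psi \<mu> t + 1 / (\<mu> - 2)"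
proof -
  have "(1 + t) powr (2 - \<mu>) \<le> 1"
    using \<mu> t powr_mono[of "2 - \<mu>" 0 "1 + t"] by simp
  then show "Psi \<mu> t \<le> t"
    using \<mu> by (simp add: Psi_closed_form[OF \<mu> t] divide_nonneg_pos)
  have "(1 - (1 + t) powr (2 - \<mu>)) / (\<mu> - 2) \<le> 1 / (\<mu> - 2)"
    using \<mu> by (intro divide_right_mono) auto
  then show "t \<le> Psi \<mu> t + 1 / (\<mu> - 2)"
    by (simp add: Psi_closed_form[OF \<mu> t])
qed

lemma leb_decomp_zero: "leb_decomp (null_measure borel) {} (\<lambda>_. 0)"
proof -
  have "density (null_measure borel) (indicator (UNIV - {})) = density lborel (\<lambda>x::real^'n. ennreal 0)"
    by (rule measure_eqI) (auto simp: emeasure_density)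
  then show ?thesis by (simp add: leb_decomp_def)
qed

lemma emeasure_diff_leb_decomp:
  assumes decomp: "leb_decomp \<nu> Z h" and sets [measurable_cong]: "sets \<nu> = sets borel"
    and [measurable]: "A \<in> sets borel"
  shows "emeasure \<nu> (A - Z) = (\<integral>\<^sup>+x. ennreal (h x) * indicator A x \<partial>lborel)"
proof -
  have [measurable]: "Z \<in> sets borel" "h \<in> borel_measurable borel"
    and density: "density \<nu> (indicator (UNIV - Z)) = density lborel (\<lambda>x. ennreal (h x))"
    using decomp by (auto simp: leb_decomp_def)
  have "A - Z = (UNIV - Z) \<inter> A" by blast
  then have "emeasure \<nu> (A - Z) = emeasure (density \<nu> (indicator (UNIV - Z))) A"
    by (simp add: emeasure_restricted)
  also have "\<dots> = (\<integral>\<^sup>+x. ennreal (h x) * indicator A x \<partial>lborel)"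
    unfolding density by (rule emeasure_density) auto
  finally show ?thesis .
qed

context bounded_domain
begin

lemma AE_lebesgue_on_of_AE_lborel:
  assumes "AE x in lborel. P x" shows "AE x in M. P x"
proof (subst AE_restrict_space_iff)
  show "AE x in lebesgue. x \<in> \<Omega> \<longrightarrow> P x"
    using AE_completion[OF assms] by eventually_elim simp
qed auto

lemma nn_integral_lebesgue_on_eq:
  assumes [measurable]: "g \<in> borel_measurable borel"
  shows "(\<integral>\<^sup>+x. g x \<partial>M) = (\<integral>\<^sup>+x. g x * indicator \<Omega> x \<partial>lborel)"
proof -
  have "(\<integral>\<^sup>+x. g x \<partial>M) = (\<integral>\<^sup>+x. g x * indicator \<Omega> x \<partial>lebesgue)"
    by (subst nn_integral_restrict_space) auto
  also have "\<dots> = (\<integral>\<^sup>+x. g x * indicator \<Omega> x \<partial>lborel)"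
    by (rule nn_integral_completion)
  finally show ?thesis .
qed

lemma emeasure_eq_singular_plus_density:
  assumes repr: "grad_repr \<Omega> w \<nu> \<sigma>" and decomp: "leb_decomp \<nu> Z h"
  shows "emeasure \<nu> UNIV = emeasure \<nu> Z + (\<integral>\<^sup>+x. ennreal (h x) \<partial>M)"
proof -
  note [measurable_cong] = grad_reprD(1)[OF repr]
  have [measurable]: "Z \<in> sets borel" "h \<in> borel_measurable borel" "\<Omega> \<in> sets borel"
    using decomp open_domain by (auto simp: leb_decomp_def)
  note off_Z = emeasure_diff_leb_decomp[OF decomp grad_reprD(1)[OF repr]]
  have "(\<integral>\<^sup>+x. ennreal (h x) * indicator (UNIV - \<Omega>) x \<partial>lborel) = emeasure \<nu> (UNIV - \<Omega> - Z)"
    by (rule off_Z[symmetric]) measurable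
  also have "\<dots> \<le> emeasure \<nu> (UNIV - \<Omega>)"
    by (intro emeasure_mono) (auto simp del: Diff_UNIV)
  finally have outside: "(\<integral>\<^sup>+x. ennreal (h x) * indicator (UNIV - \<Omega>) x \<partial>lborel) = 0"
    by (simp add: grad_reprD(4)[OF repr])
  have "emeasure \<nu> UNIV = emeasure \<nu> Z + emeasure \<nu> (UNIV - Z)"
    by (subst plus_emeasure) auto
  also have "emeasure \<nu> (UNIV - Z)
      = (\<integral>\<^sup>+x. ennreal (h x) * indicator \<Omega> x + ennreal (h x) * indicator (UNIV - \<Omega>) x \<partial>lborel)"
    by (subst off_Z) (auto intro!: nn_integral_cong simp: indicator_def)
  also have "\<dots> = (\<integral>\<^sup>+x. ennreal (h x) \<partial>M)"
    by (subst nn_integral_add) (auto simp: outside nn_integral_lebesgue_on_eq)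
  finally show ?thesis .
qed

lemma AE_norm_absolutely_continuous_part:
  assumes repr: "grad_repr \<Omega> w \<nu> \<sigma>" and decomp: "leb_decomp \<nu> Z h"
  shows "AE x in M. norm (h x *\<^sub>R \<sigma> x) = h x"
proof -
  note [measurable_cong] = grad_reprD(1)[OF repr] and [measurable] = grad_reprD(5)[OF repr]
  have [measurable]: "Z \<in> sets borel" "h \<in> borel_measurable borel" and h: "\<And>x. 0 \<le> h x"
    and density: "density \<nu> (indicator (UNIV - Z)) = density lborel (\<lambda>x. ennreal (h x))"
    using decomp by (auto simp: leb_decomp_def)
  have "AE x in density \<nu> (indicator (UNIV - Z)). norm (\<sigma> x) = 1"
    using grad_reprD(6)[OF repr] by (subst AE_density) (auto intro: borel_measurable_indicator elim: eventually_mono)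
  then have "AE x in lborel. 0 < ennreal (h x) \<longrightarrow> norm (\<sigma> x) = 1"
    unfolding density by (subst (asm) AE_density) auto
  then have "AE x in lborel. norm (h x *\<^sub>R \<sigma> x) = h x"
  proof eventually_elim
    case (elim x)
    then show ?case using h[of x] by (cases "h x = 0") auto
  qed
  then show ?thesis by (rule AE_lebesgue_on_of_AE_lborel)
qed

lemma nn_integral_Psi_bounds:
  assumes \<mu>: "2 < \<mu>" and [measurable]: "h \<in> borel_measurable borel" and h: "\<And>x. 0 \<le> h x"
  shows "(\<integral>\<^sup>+x. ennreal (Psi \<mu> (h x)) \<partial>M) \<le> (\<integral>\<^sup>+x. ennreal (h x) \<partial>M)"
    and "(\<integral>\<^sup>+x. ennreal (h x) \<partial>M) \<le> (\<integral>\<^sup>+x. ennreal (Psi \<mu> (h x)) \<partial>M) + ennreal (measure M \<Omega> / (\<mu> - 2))"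
proof -
  show "(\<integral>\<^sup>+x. ennreal (Psi \<mu> (h x)) \<partial>M) \<le> (\<integral>\<^sup>+x. ennreal (h x) \<partial>M)"
    by (intro nn_integral_mono ennreal_leI Psi_bounds \<mu> h)
  have [measurable]: "(\<lambda>x. Psi \<mu> (h x)) \<in> borel_measurable M"
    unfolding Psi_closed_form[OF \<mu> h] by (intro borel_measurable_lebesgue_on) measurable
  have "(\<integral>\<^sup>+x. ennreal (h x) \<partial>M) \<le> (\<integral>\<^sup>+x. ennreal (Psi \<mu> (h x)) + ennreal (1 / (\<mu> - 2)) \<partial>M)"
  proof (rule nn_integral_mono)
    fix x
    have "ennreal (h x) \<le> ennreal (Psi \<mu> (h x) + 1 / (\<mu> - 2))" by (intro ennreal_leI Psi_bounds \<mu> h)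
    also have "\<dots> \<le> ennreal (Psi \<mu> (h x)) + ennreal (1 / (\<mu> - 2))"
      by (cases "0 \<le> Psi \<mu> (h x)")
        (use \<mu> in \<open>auto simp: ennreal_neg ennreal_plus[symmetric] simp del: ennreal_plus intro!: ennreal_leI\<close>)
    finally show "ennreal (h x) \<le> ennreal (Psi \<mu> (h x)) + ennreal (1 / (\<mu> - 2))" .
  qed
  also have "\<dots> = (\<integral>\<^sup>+x. ennreal (Psi \<mu> (h x)) \<partial>M) + ennreal (1 / (\<mu> - 2)) * emeasure M \<Omega>"
    by (subst nn_integral_add) auto
  also have "ennreal (1 / (\<mu> - 2)) * emeasure M \<Omega> = ennreal (measure M \<Omega> / (\<mu> - 2))"
    using \<mu> by (simp add: M.emeasure_eq_measure ennreal_mult[symmetric])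
  finally show "(\<integral>\<^sup>+x. ennreal (h x) \<partial>M) \<le> (\<integral>\<^sup>+x. ennreal (Psi \<mu> (h x)) \<partial>M) + ennreal (measure M \<Omega> / (\<mu> - 2))" .
qed

end

context denoising
begin

lemma exists_K_energy:
  assumes "is_BV \<Omega> w"
  obtains k where "K_energy \<mu> \<Omega> lam f w k"
proof -
  obtain \<nu> \<sigma> where repr: "grad_repr \<Omega> w \<nu> \<sigma>" using assms by (auto simp: is_BV_def)
  obtain Z h where "leb_decomp \<nu> Z h"
    using exists_leb_decomp[OF grad_reprD(3,1)[OF repr]] .
  with repr that show ?thesis unfolding K_energy_def by blast
qed

lemma K_energy_bounds:
  assumes \<mu>: "2 < \<mu>" and k: "K_energy \<mu> \<Omega> lam f w k"
  shows "k \<le> energy w" "energy w \<le> k + ennreal (measure M \<Omega> / (\<mu> - 2))"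
proof -
  let ?F = "ennreal (lam/2) * (\<integral>\<^sup>+x. ennreal ((norm (w x - f x))\<^sup>2) \<partial>M)"
  obtain \<nu> \<sigma> Z h where repr: "grad_repr \<Omega> w \<nu> \<sigma>" and decomp: "leb_decomp \<nu> Z h"
    and k_eq: "k = (\<integral>\<^sup>+x. ennreal (Psi \<mu> (norm (h x *\<^sub>R \<sigma> x))) \<partial>M) + emeasure \<nu> Z + ?F"
    using k unfolding K_energy_def by blast
  have h: "h \<in> borel_measurable borel" "\<And>x. 0 \<le> h x" using decomp by (auto simp: leb_decomp_def)
  have "(\<integral>\<^sup>+x. ennreal (Psi \<mu> (norm (h x *\<^sub>R \<sigma> x))) \<partial>M) = (\<integral>\<^sup>+x. ennreal (Psi \<mu> (h x)) \<partial>M)"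
    using AE_norm_absolutely_continuous_part[OF repr decomp]
    by (intro nn_integral_cong_AE) (auto elim!: eventually_mono)
  then have k_Psi: "k = (\<integral>\<^sup>+x. ennreal (Psi \<mu> (h x)) \<partial>M) + emeasure \<nu> Z + ?F" by (simp only: k_eq)
  have "ennreal (total_variation \<Omega> w) = emeasure \<nu> UNIV"
    using finite_measure.emeasure_eq_measure[OF grad_reprD(3)[OF repr]] total_variation_eq[OF open_domain repr] by simp
  then have energy: "energy w = emeasure \<nu> Z + (\<integral>\<^sup>+x. ennreal (h x) \<partial>M) + ?F"
    by (simp only: energy_def emeasure_eq_singular_plus_density[OF repr decomp])
  note Psi = nn_integral_Psi_bounds[OF \<mu> h]
  show "k \<le> energy w"
    unfolding k_Psi energy using Psi(1) by (simp add: add.commute add_mono)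
  have "energy w \<le> emeasure \<nu> Z + ((\<integral>\<^sup>+x. ennreal (Psi \<mu> (h x)) \<partial>M) + ennreal (measure M \<Omega> / (\<mu> - 2))) + ?F"
    unfolding energy by (intro add_mono order_refl Psi(2))
  also have "\<dots> = k + ennreal (measure M \<Omega> / (\<mu> - 2))"
    unfolding k_Psi by (simp only: ac_simps)
  finally show "energy w \<le> k + ennreal (measure M \<Omega> / (\<mu> - 2))" .
qed

lemma K_minimizer_almost_minimizer:
  assumes \<mu>: "2 < \<mu>" and w: "BV_minimizer \<Omega> (K_energy \<mu> \<Omega> lam f) w"
  shows "almost_minimizer (measure M \<Omega> / (\<mu> - 2)) w"
  unfolding almost_minimizer_def
proof (intro conjI allI impI)
  show BV: "is_BV \<Omega> w" using w by (simp add: BV_minimizer_def)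
  fix v :: "real^'n \<Rightarrow> real^'m" assume v: "is_BV \<Omega> v"
  obtain k where k: "K_energy \<mu> \<Omega> lam f w k" using exists_K_energy[OF BV] .
  obtain k' where k': "K_energy \<mu> \<Omega> lam f v k'" using exists_K_energy[OF v] .
  have "energy w \<le> k + ennreal (measure M \<Omega> / (\<mu> - 2))" by (rule K_energy_bounds(2)[OF \<mu> k])
  also have "k \<le> k'" using w v k k' unfolding BV_minimizer_def by blast
  also have "k' \<le> energy v" by (rule K_energy_bounds(1)[OF \<mu> k'])
  finally show "energy w \<le> energy v + ennreal (measure M \<Omega> / (\<mu> - 2))"
    by (simp add: add_right_mono)
qed

lemma K_minimizer_admissible:
  assumes w: "BV_minimizer \<Omega> (K_energy \<mu> \<Omega> lam f) w"
  shows "admissible w"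
proof (rule admissible_of_finite_fidelity)
  show BV: "is_BV \<Omega> w" using w by (simp add: BV_minimizer_def)
  obtain k where k: "K_energy \<mu> \<Omega> lam f w k" using exists_K_energy[OF BV] .
  let ?k\<^sub>0 = "ennreal (lam/2) * (\<integral>\<^sup>+x. ennreal ((norm (0 - f x))\<^sup>2) \<partial>M)"
  have "K_energy \<mu> \<Omega> lam f (\<lambda>_. 0) ?k\<^sub>0"
    unfolding K_energy_def
    by (intro exI[of _ "null_measure borel"] exI[of _ "\<lambda>_. 0"] exI[of _ "{}"] conjI
        grad_repr_zero leb_decomp_zero) (simp add: Psi_0)
  have "ennreal (lam/2) * (\<integral>\<^sup>+x. ennreal ((norm (w x - f x))\<^sup>2) \<partial>M) \<le> k"
    using k by (auto simp: K_energy_def)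
  also have "k \<le> ?k\<^sub>0"
    using w k \<open>K_energy \<mu> \<Omega> lam f (\<lambda>_. 0) ?k\<^sub>0\<close> is_BV_zero
    unfolding BV_minimizer_def by blast
  also have "\<dots> < \<infinity>"
    using nn_integral_norm_power2[OF f] by (simp add: ennreal_mult_less_top)
  finally show "ennreal (lam/2) * (\<integral>\<^sup>+x. ennreal ((norm (w x - f x))\<^sup>2) \<partial>M) < \<infinity>" .
qed

end

section \<open>The one-dimensional sup bound\<close>

lemma integral_eq_of_zero_outside:
  fixes k :: "real \<Rightarrow> 'b::euclidean_space"
  assumes "k integrable_on {a..b}" "\<And>t. t \<notin> {a..b} \<Longrightarrow> k t = 0" "{a..b} \<subseteq> S"
  shows "integral S k = integral {a..b} k"
  using assms by (intro integral_unique has_integral_on_superset[OF integrable_integral]) auto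

lemma integral_has_vector_derivative_at:
  fixes k :: "real \<Rightarrow> 'b::euclidean_space"
  assumes k: "continuous_on UNIV k" and t: "c < t"
  shows "((\<lambda>t. integral {c..t} k) has_vector_derivative k t) (at t)"
proof -
  have "((\<lambda>t. integral {c..t} k) has_vector_derivative k t) (at t within {c..t + 1})"
    using k t by (intro integral_has_vector_derivative) (auto intro: continuous_on_subset)
  moreover have "t \<in> interior {c..t + 1}" using t by auto
  ultimately show ?thesis by (metis at_within_interior)
qed

lemma primitive_of_mean_zero:
  fixes k :: "real \<Rightarrow> 'b::euclidean_space"
  assumes k: "continuous_on UNIV k" and zero: "\<And>t. t \<notin> {a..b} \<Longrightarrow> k t = 0"
    and mean: "integral {a..b} k = 0"
  obtains \<psi> where "\<And>t. (\<psi> has_vector_derivative k t) (at t)" "\<And>t. t \<notin> {a..b} \<Longrightarrow> \<psi> t = 0"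
    "\<And>t. norm (\<psi> t) \<le> integral {a..b} (\<lambda>t. norm (k t))"
proof -
  define \<psi> where "\<psi> t = integral {a - 1..t} k" for t
  have k_int: "k integrable_on {c..d}" "(\<lambda>t. norm (k t)) integrable_on {c..d}" for c d
    using k by (auto intro!: integrable_continuous_real continuous_on_norm intro: continuous_on_subset)
  have left: "\<psi> t = 0" if "t < a" for t
    unfolding \<psi>_def by (rule integral_unique, rule has_integral_is_0) (use zero that in auto)
  have right: "\<psi> t = 0" if "b < t" for t
    unfolding \<psi>_def mean[symmetric]
    by (rule integral_eq_of_zero_outside[OF k_int(1) zero]) (use that in auto)
  have "(\<psi> has_vector_derivative k t) (at t)" for t
  proof (cases "t < a")
    case True
    have "((\<lambda>_. 0) has_vector_derivative 0) (at t)" by simp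
    then have "(\<psi> has_vector_derivative 0) (at t)"
      by (rule has_vector_derivative_transform_within_open[where S = "{..<a}"]) (use True left in auto)
    then show ?thesis using zero True by simp
  next
    case False
    then show ?thesis unfolding \<psi>_def by (intro integral_has_vector_derivative_at[OF k]) simp
  qed
  moreover have "\<psi> t = 0" if "t \<notin> {a..b}" for t using left right that by (cases "t < a") auto
  moreover have "norm (\<psi> t) \<le> integral {a..b} (\<lambda>t. norm (k t))" for t
  proof -
    have "norm (\<psi> t) \<le> integral {a - 1..t} (\<lambda>t. norm (k t))"
      unfolding \<psi>_def by (rule integral_norm_bound_integral[OF k_int]) simp
    also have "\<dots> \<le> integral {a - 1..max b t} (\<lambda>t. norm (k t))"
      by (rule integral_subset_le[OF _ k_int(2) k_int(2)]) auto
    also have "\<dots> = integral {a..b} (\<lambda>t. norm (k t))"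
      by (rule integral_eq_of_zero_outside[OF k_int(2)]) (use zero in auto)
    finally show ?thesis .
  qed
  ultimately show ?thesis by (rule that)
qed

context bounded_domain
begin

lemma exists_borel_representative:
  fixes w :: "real^'n \<Rightarrow> 'b::euclidean_space"
  assumes w: "w \<in> borel_measurable M"
  obtains w' where "w' \<in> borel_measurable borel" "AE x in M. w x = w' x"
proof -
  define w0 where "w0 x = (if x \<in> \<Omega> then w x else 0)" for x
  have "w0 \<in> borel_measurable lebesgue"
    unfolding w0_def using w domain_lebesgue by (simp add: borel_measurable_if)
  then have "\<exists>c\<in>borel_measurable lborel. AE x in lborel. w0 x \<bullet> b = c x" for b
    by (intro completion_ex_borel_measurable_real borel_measurable_inner) auto
  then obtain c where c: "\<And>b. c b \<in> borel_measurable lborel" "\<And>b. AE x in lborel. w0 x \<bullet> b = c b x"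
    by metis
  have "AE x in lborel. \<forall>b\<in>Basis. w0 x \<bullet> b = c b x" using c(2) by (intro AE_finite_allI) auto
  from AE_lebesgue_on_of_AE_lborel[OF this] AE_space
  have "AE x in M. w x = (\<Sum>b\<in>Basis. c b x *\<^sub>R b)"
  proof eventually_elim
    case (elim x)
    then have "(\<Sum>b\<in>Basis. c b x *\<^sub>R b) = (\<Sum>b\<in>Basis. (w x \<bullet> b) *\<^sub>R b)"
      by (intro sum.cong) (auto simp: w0_def)
    then show ?case by (simp add: euclidean_representation)
  qed
  moreover have "(\<lambda>x. \<Sum>b\<in>Basis. c b x *\<^sub>R b) \<in> borel_measurable borel" using c(1) by simp
  ultimately show ?thesis using that by blast
qed

lemma integrable_C1_compact:
  fixes g :: "real^'n \<Rightarrow> 'b::euclidean_space"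
  assumes "C1_compact \<Omega>' g"
  shows "integrable M g"
proof -
  obtain B where "\<And>x. norm (g x) \<le> B" using C1_compact_bounded[OF assms] by blast
  then show ?thesis
    using C1_compactD(5)[OF assms] by (intro M.integrable_const_bound[of _ B] borel_measurable_lebesgue_on) auto
qed

lemma weighted_approx_C1_compact:
  fixes s :: "real^'n \<Rightarrow> 'b::euclidean_space"
  assumes \<rho>: "integrable M \<rho>" "\<And>x. 0 \<le> \<rho> x" and s: "s \<in> borel_measurable borel" "\<And>x. norm (s x) \<le> 1"
    and e: "0 < e"
  obtains g where "C1_compact \<Omega> g" "(\<integral>x. \<rho> x * norm (s x - g x) \<partial>M) < e"
proof -
  note [measurable] = s(1)
  have [measurable]: "\<rho> \<in> borel_measurable M" using \<rho>(1) by simp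
  have [measurable]: "(\<lambda>x. x) \<in> measurable M borel"
    by (rule borel_measurable_lebesgue_on) simp
  define \<beta> where "\<beta> = distr (density M (\<lambda>x. ennreal (\<rho> x))) borel (\<lambda>x. x)"
  have sets [measurable_cong]: "sets \<beta> = sets borel" by (simp add: \<beta>_def)
  have fin: "finite_measure \<beta>"
    unfolding \<beta>_def
    by (rule finite_measure.finite_measure_distr[OF finite_measure_density_of_integrable[OF \<rho>(1)]]) simp
  interpret \<beta>: finite_measure \<beta> by (rule fin)
  have "(\<lambda>x. x) -` (UNIV - \<Omega>) \<inter> space (density M (\<lambda>x. ennreal (\<rho> x))) = {}" by auto
  then have outside: "emeasure \<beta> (UNIV - \<Omega>) = 0"
    unfolding \<beta>_def using open_domain by (subst emeasure_distr) auto
  have "s \<in> borel_measurable \<beta>" using s(1) by (simp add: measurable_cong_sets[OF sets refl])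
  then have "integrable \<beta> s" using s(2) by (intro \<beta>.integrable_const_bound[of _ 1]) auto
  from integrable_approx_C1_compact[OF fin sets open_domain outside this e]
  obtain g where g: "C1_compact \<Omega> g" "(\<integral>x. norm (s x - g x) \<partial>\<beta>) < e" .
  note [measurable] = C1_compactD(5)[OF g(1)]
  have "(\<integral>x. norm (s x - g x) \<partial>\<beta>) = (\<integral>x. \<rho> x * norm (s x - g x) \<partial>M)"
    unfolding \<beta>_def using \<rho>(2) by (subst integral_distr) (auto simp: integral_density)
  with g show ?thesis using that by simp
qed

lemma pairing_diff_le:
  fixes s g w :: "'b::real_inner"
  assumes "0 \<le> C"
  shows "s \<bullet> w - C * norm s \<le> (g \<bullet> w - C * norm g) + (C + 1) * ((1 + norm w) * norm (s - g))"
proof -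
  have "s \<bullet> w - g \<bullet> w \<le> norm (s - g) * norm w"
    using norm_cauchy_schwarz[of "s - g" w] by (simp add: inner_diff_left)
  moreover have "C * norm g - C * norm s \<le> C * norm (s - g)"
    using mult_left_mono[OF norm_triangle_ineq2[of g s] assms] by (simp add: norm_minus_commute right_diff_distrib)
  moreover have "0 \<le> norm (s - g) + C * (norm (s - g) * norm w)" using assms by simp
  ultimately show ?thesis by (simp add: algebra_simps)
qed

lemma duality_bounded_borel:
  fixes w s :: "real^'n \<Rightarrow> 'b::euclidean_space"
  assumes w: "integrable M w" and C: "0 \<le> C"
    and dual: "\<And>g. C1_compact \<Omega> g \<Longrightarrow> (\<integral>x. g x \<bullet> w x \<partial>M) \<le> C * (\<integral>x. norm (g x) \<partial>M)"
    and s: "s \<in> borel_measurable borel" "\<And>x. norm (s x) \<le> 1"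
  shows "(\<integral>x. s x \<bullet> w x - C * norm (s x) \<partial>M) \<le> 0"
proof (rule field_le_epsilon)
  fix e :: real assume e: "0 < e"
  note [measurable] = borel_measurable_lebesgue_on[OF s(1)]
  have s_int: "integrable M s" using s(2) by (intro M.integrable_const_bound[of _ 1]) auto
  have sw_int: "integrable M (\<lambda>x. s x \<bullet> w x)" by (rule integrable_inner_bounded[OF w _ s(2)]) measurable
  let ?\<rho> = "\<lambda>x. 1 + norm (w x)"
  have \<rho>: "integrable M ?\<rho>" "\<And>x. 0 \<le> ?\<rho> x" using w by simp_all
  have "0 < e / (C + 1)" using e C by simp
  from weighted_approx_C1_compact[OF \<rho> s this]
  obtain g where g: "C1_compact \<Omega> g" "(\<integral>x. ?\<rho> x * norm (s x - g x) \<partial>M) < e / (C + 1)" .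
  note g_int = integrable_C1_compact[OF g(1)]
  obtain B where B: "\<And>x. norm (g x) \<le> B" using C1_compact_bounded[OF g(1)] by blast
  note [measurable] = borel_measurable_lebesgue_on[OF C1_compactD(5)[OF g(1)]]
  have "norm (s x - g x) \<le> 1 + B" for x
    using norm_triangle_ineq4[of "s x" "g x"] s(2)[of x] B[of x] by linarith
  then have weighted_int: "integrable M (\<lambda>x. ?\<rho> x * norm (s x - g x))"
    using integrable_inner_bounded[OF \<rho>(1), of "\<lambda>x. norm (s x - g x)" "1 + B"] by (simp add: mult.commute)
  have gw_int: "integrable M (\<lambda>x. g x \<bullet> w x)" by (rule integrable_inner_bounded[OF w _ B]) measurable
  have "(\<integral>x. s x \<bullet> w x - C * norm (s x) \<partial>M)
      \<le> (\<integral>x. (g x \<bullet> w x - C * norm (g x)) + (C + 1) * (?\<rho> x * norm (s x - g x)) \<partial>M)"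
    using s_int sw_int g_int gw_int weighted_int by (intro integral_mono pairing_diff_le C) auto
  also have "\<dots> = ((\<integral>x. g x \<bullet> w x \<partial>M) - C * (\<integral>x. norm (g x) \<partial>M)) + (C + 1) * (\<integral>x. ?\<rho> x * norm (s x - g x) \<partial>M)"
    using g_int gw_int weighted_int by simp
  also have "\<dots> \<le> (C + 1) * (\<integral>x. ?\<rho> x * norm (s x - g x) \<partial>M)" using dual[OF g(1)] by simp
  also have "\<dots> \<le> (C + 1) * (e / (C + 1))" using g(2) C by (intro mult_left_mono) auto
  also have "\<dots> = 0 + e" using C by simp
  finally show "(\<integral>x. s x \<bullet> w x - C * norm (s x) \<partial>M) \<le> 0 + e" .
qed

lemma AE_norm_le_of_duality:
  fixes w :: "real^'n \<Rightarrow> 'b::euclidean_space"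
  assumes w: "integrable M w" and C: "0 \<le> C"
    and dual: "\<And>g. C1_compact \<Omega> g \<Longrightarrow> (\<integral>x. g x \<bullet> w x \<partial>M) \<le> C * (\<integral>x. norm (g x) \<partial>M)"
  shows "AE x in M. norm (w x) \<le> C"
proof -
  obtain w' where w'_meas: "w' \<in> borel_measurable borel" and ww': "AE x in M. w x = w' x"
    by (rule exists_borel_representative[OF borel_measurable_integrable[OF w]])
  note [measurable] = w'_meas
  define s where "s x = (if C < norm (w' x) then sgn (w' x) else 0)" for x
  have s_meas: "s \<in> borel_measurable borel" unfolding s_def sgn_div_norm by measurable
  have s_le: "norm (s x) \<le> 1" for x by (simp add: s_def norm_sgn)
  note [measurable] = borel_measurable_lebesgue_on[OF s_meas]
  have s_int: "integrable M (\<lambda>x. s x \<bullet> w x - C * norm (s x))"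
    using s_le by (intro Bochner_Integration.integrable_diff integrable_mult_right integrable_norm
        integrable_inner_bounded[OF w, of s 1] M.integrable_const_bound[of s 1]) auto
  let ?excess = "\<lambda>x. max 0 (norm (w x) - C)"
  have "AE x in M. ?excess x = s x \<bullet> w x - C * norm (s x)"
    using ww'
  proof eventually_elim
    case (elim x)
    have "sgn (w' x) \<bullet> w' x = norm (w' x)"
      by (cases "w' x = 0") (auto simp: sgn_div_norm dot_square_norm power2_eq_square)
    with elim C show ?case by (auto simp: s_def norm_sgn)
  qed
  then have "(\<integral>x. ?excess x \<partial>M) = (\<integral>x. s x \<bullet> w x - C * norm (s x) \<partial>M)"
    using w s_int by (intro integral_cong_AE) auto
  then have "(\<integral>x. ?excess x \<partial>M) \<le> 0"
    using duality_bounded_borel[OF w C dual s_meas s_le] by simp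
  moreover have "0 \<le> (\<integral>x. ?excess x \<partial>M)" by (rule Bochner_Integration.integral_nonneg) simp
  ultimately have "(\<integral>x. ?excess x \<partial>M) = 0" by (rule antisym)
  then have "AE x in M. ?excess x = 0" using w by (subst (asm) integral_nonneg_eq_0_iff_AE) auto
  then show ?thesis by eventually_elim simp
qed

lemma exists_unit_bump:
  assumes "\<Omega> \<noteq> {}"
  obtains \<eta> :: "real^'n \<Rightarrow> real" where "C1_compact \<Omega> \<eta>" "\<And>x. 0 \<le> \<eta> x" "(\<integral>x. \<eta> x \<partial>M) = 1"
proof -
  obtain x0 r where r: "0 < r" "cball x0 r \<subseteq> \<Omega>"
    using assms open_domain open_contains_cball by blast
  obtain \<zeta> :: "real^'n \<Rightarrow> real" where \<zeta>: "C1_compact \<Omega> \<zeta>" "\<And>x. 0 \<le> \<zeta> x" "\<And>x. x \<in> cball x0 r \<Longrightarrow> \<zeta> x = 1"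
    using exists_C1_cutoff[OF compact_cball open_domain r(2)] by metis
  note \<zeta>_int = integrable_C1_compact[OF \<zeta>(1)]
  have "cball x0 r \<in> sets M" using r(2) by (auto simp: sets_restrict_space_iff)
  then have ball_int: "integrable M (indicat_real (cball x0 r))"
    by (rule integrable_real_indicator) (simp add: less_top[symmetric])
  have "0 < measure lebesgue (cball x0 r)" using r(1) by (simp add: content_cball_pos)
  also have "\<dots> = (\<integral>x. indicator (cball x0 r) x \<partial>M)"
    using r(2) by (simp add: Int_absorb2 measure_restrict_space)
  also have "\<dots> \<le> (\<integral>x. \<zeta> x \<partial>M)"
    using \<zeta>(2,3) by (intro integral_mono ball_int \<zeta>_int) (auto simp: indicator_def)
  finally have pos: "0 < (\<integral>x. \<zeta> x \<partial>M)" .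
  show ?thesis
  proof (rule that)
    show "C1_compact \<Omega> (\<lambda>x. \<zeta> x / (\<integral>x. \<zeta> x \<partial>M))"
      by (rule C1_compact_bounded_linear[OF bounded_linear_divide \<zeta>(1)])
    show "0 \<le> \<zeta> x / (\<integral>x. \<zeta> x \<partial>M)" for x using \<zeta>(2)[of x] pos by simp
    show "(\<integral>x. \<zeta> x / (\<integral>x. \<zeta> x \<partial>M) \<partial>M) = 1" using pos by simp
  qed
qed

end

locale interval_domain = bounded_domain \<Omega>
  for \<Omega> :: "(real^'n) set" +
  fixes j :: 'n
  assumes index: "(UNIV :: 'n set) = {j}" and connected_domain: "connected \<Omega>" and nonempty_domain: "\<Omega> \<noteq> {}"
begin

definition \<iota> :: "real \<Rightarrow> real^'n" where "\<iota> t = t *\<^sub>R axis j 1"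

lemma iota_component [simp]: "\<iota> t $ j = t"
  by (simp add: \<iota>_def axis_def)

lemma iota_of_component [simp]: "\<iota> (x $ j) = x"
proof -
  have "\<iota> (x $ j) $ i = x $ i" for i
  proof -
    have "i = j" using index by blast
    then show ?thesis by simp
  qed
  then show ?thesis by (simp add: vec_eq_iff)
qed

lemma continuous_on_iota: "continuous_on S \<iota>"
  unfolding \<iota>_def by (intro continuous_intros)

lemma borel_measurable_iota [measurable]: "\<iota> \<in> borel_measurable borel"
  by (intro borel_measurable_continuous_onI continuous_on_iota)

lemma Basis_eq: "(Basis :: (real^'n) set) = {axis j 1}"
  unfolding Basis_vec_def using index by auto

lemma distr_iota: "distr lborel borel \<iota> = lborel"
proof (rule lborel_eqI[symmetric])
  fix l u :: "real^'n" assume le: "\<And>b. b \<in> Basis \<Longrightarrow> l \<bullet> b \<le> u \<bullet> b"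
  have "\<iota> -` box l u = {l $ j <..< u $ j}"
    by (auto simp: box_def Basis_eq inner_axis)
  moreover have "l $ j \<le> u $ j" using le[of "axis j 1"] by (simp add: Basis_eq inner_axis)
  ultimately show "emeasure (distr lborel borel \<iota>) (box l u) = (\<Prod>b\<in>Basis. (u - l) \<bullet> b)"
    by (simp add: emeasure_distr Basis_eq inner_axis)
qed simp

lemma compact_subset_segment:
  assumes K: "compact K" "K \<subseteq> \<Omega>"
  obtains a b where "K \<subseteq> \<iota> ` {a..b}" "\<iota> ` {a..b} \<subseteq> \<Omega>"
proof -
  have "convex \<Omega>"
    using connected_domain connected_convex_1_gen[of \<Omega>] by (simp add: Basis_eq)
  then have hull: "convex hull K \<subseteq> \<Omega>" "K \<subseteq> convex hull K"
    using K(2) hull_subset[of K convex] by (auto simp: hull_minimal)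
  have coord: "continuous_on (convex hull K) (\<lambda>x. x $ j)" by (intro continuous_intros)
  have "compact ((\<lambda>x. x $ j) ` (convex hull K))"
    by (rule compact_continuous_image[OF coord compact_convex_hull[OF K(1)]])
  moreover have "connected ((\<lambda>x. x $ j) ` (convex hull K))"
    by (rule connected_continuous_image[OF coord convex_connected[OF convex_convex_hull]])
  ultimately obtain a b where ab: "(\<lambda>x. x $ j) ` (convex hull K) = {a..b}"
    using connected_compact_interval_1[of "(\<lambda>x. x $ j) ` (convex hull K)"] by auto
  have "\<iota> ` {a..b} = convex hull K" unfolding ab[symmetric] by (simp add: image_image)
  with hull show ?thesis by (intro that[of a b]) simp_all
qed

lemma integral_eq_integral_segment:
  fixes g :: "real^'n \<Rightarrow> 'b::euclidean_space"
  assumes g: "continuous_on UNIV g" and zero: "\<And>x. x \<notin> \<iota> ` {a..b} \<Longrightarrow> g x = 0"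
    and segment: "\<iota> ` {a..b} \<subseteq> \<Omega>"
  shows "(\<integral>x. g x \<partial>M) = integral {a..b} (\<lambda>t. g (\<iota> t))"
proof -
  have [measurable]: "g \<in> borel_measurable borel" using g by (rule borel_measurable_continuous_onI)
  have cont: "continuous_on {a..b} (\<lambda>t. g (\<iota> t))"
    by (rule continuous_on_compose2[OF g continuous_on_iota]) simp
  have zero': "g (\<iota> t) = 0" if "t \<notin> {a..b}" for t
    using zero[of "\<iota> t"] that by (metis imageE iota_component)
  have "(\<integral>x. g x \<partial>M) = (\<integral>x. indicator \<Omega> x *\<^sub>R g x \<partial>lebesgue)"
    by (rule integral_restrict_space) simp
  also have "\<dots> = (\<integral>x. g x \<partial>lebesgue)"
    using zero segment by (intro Bochner_Integration.integral_cong) (auto simp: indicator_def)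
  also have "\<dots> = (\<integral>x. g x \<partial>lborel)" by (rule integral_completion) simp
  also have "\<dots> = (\<integral>x. g x \<partial>distr lborel borel \<iota>)" unfolding distr_iota ..
  also have "\<dots> = (\<integral>t. g (\<iota> t) \<partial>lborel)" by (rule integral_distr) auto
  also have "\<dots> = (LINT t:{a..b}|lborel. g (\<iota> t))"
    unfolding set_lebesgue_integral_def using zero'
    by (intro Bochner_Integration.integral_cong) (auto simp: indicator_def)
  also have "\<dots> = integral {a..b} (\<lambda>t. g (\<iota> t))"
    by (rule set_borel_integral_eq_integral(2)[OF borel_integrable_atLeastAtMost'[OF cont]])
  finally show ?thesis .
qed

definition column :: "real^'m \<Rightarrow> real^'n^'m" where
  "column v = (\<chi> i. v $ i *\<^sub>R axis j 1)"

lemma bounded_linear_column: "bounded_linear column"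
  unfolding column_def by (intro linear_conv_bounded_linear[THEN iffD1] linearI)
    (auto simp: vec_eq_iff algebra_simps)

lemma norm_column: "norm (column v) = norm v"
  by (simp add: column_def norm_eq_sqrt_inner inner_vec_def[of _ "_ :: real^'n^'m"] inner_vec_def[of v v] inner_axis_axis)

lemma has_derivative_column:
  assumes "(\<psi> has_vector_derivative v) (at (x $ j))"
  shows "((\<lambda>x. column (\<psi> (x $ j))) has_derivative (\<lambda>h. column (h $ j *\<^sub>R v))) (at x)"
proof -
  have "((\<lambda>x. \<psi> (x $ j)) has_derivative (\<lambda>h. h $ j *\<^sub>R v)) (at x)"
    using has_derivative_compose[OF bounded_linear.has_derivative[OF bounded_linear_vec_nth has_derivative_ident]
        assms[unfolded has_vector_derivative_def]] by simp
  then show ?thesis by (rule bounded_linear.has_derivative[OF bounded_linear_column])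
qed

lemma mean_zero_eq_mdiv:
  fixes g :: "real^'n \<Rightarrow> real^'m"
  assumes g: "C1_compact \<Omega> g" and mean: "(\<integral>x. g x \<partial>M) = 0"
  obtains \<phi> where "C1_compact \<Omega> \<phi>" "\<And>x. mdiv \<phi> x = g x" "\<And>x. norm (\<phi> x) \<le> (\<integral>x. norm (g x) \<partial>M)"
proof -
  obtain a b where ab: "supp g \<subseteq> \<iota> ` {a..b}" "\<iota> ` {a..b} \<subseteq> \<Omega>"
    using compact_subset_segment[OF C1_compactD(2,3)[OF g]] .
  note g_cont = C1_compactD(4)[OF g]
  have g_zero: "g x = 0" if "x \<notin> \<iota> ` {a..b}" for x
    using that ab(1) zero_outside_supp[of x g] by blast
  have "continuous_on UNIV (\<lambda>t. g (\<iota> t))" by (rule continuous_on_compose2[OF g_cont continuous_on_iota]) simp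
  moreover have "g (\<iota> t) = 0" if "t \<notin> {a..b}" for t
    using g_zero[of "\<iota> t"] that by (metis imageE iota_component)
  moreover have "integral {a..b} (\<lambda>t. g (\<iota> t)) = 0"
    using integral_eq_integral_segment[OF g_cont g_zero ab(2)] mean by simp
  ultimately obtain \<psi> where \<psi>: "\<And>t. (\<psi> has_vector_derivative g (\<iota> t)) (at t)"
    "\<And>t. t \<notin> {a..b} \<Longrightarrow> \<psi> t = 0" "\<And>t. norm (\<psi> t) \<le> integral {a..b} (\<lambda>t. norm (g (\<iota> t)))"
    using primitive_of_mean_zero[of "\<lambda>t. g (\<iota> t)" a b] by metis
  define \<phi> :: "real^'n \<Rightarrow> real^'n^'m" where "\<phi> x = column (\<psi> (x $ j))" for x
  have deriv: "(\<phi> has_derivative (\<lambda>h. column (h $ j *\<^sub>R g x))) (at x)" for x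
    unfolding \<phi>_def using has_derivative_column[OF \<psi>(1)[of "x $ j"]] by simp
  have "C1_compact \<Omega> \<phi>"
  proof (rule C1_compactI)
    show "C1 \<phi>"
      by (rule C1I[OF deriv]) (intro bounded_linear.continuous_on[OF bounded_linear_column] continuous_intros g_cont)
    show "compact (\<iota> ` {a..b})" by (intro compact_continuous_image continuous_on_iota) simp
    show "\<phi> x = 0" if "x \<notin> \<iota> ` {a..b}" for x
    proof -
      have "x $ j \<notin> {a..b}" using that by (metis image_eqI iota_of_component)
      then show ?thesis using \<psi>(2) linear_simps(3)[OF bounded_linear_column] by (simp add: \<phi>_def)
    qed
  qed (rule ab(2))
  moreover have "mdiv \<phi> x = g x" for x
    unfolding mdiv_eq[OF deriv] index by (simp add: column_def vec_eq_iff axis_def)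
  moreover have "norm (\<phi> x) \<le> (\<integral>x. norm (g x) \<partial>M)" for x
    using \<psi>(3)[of "x $ j"] integral_eq_integral_segment[of "\<lambda>x. norm (g x)", OF continuous_on_norm[OF g_cont] _ ab(2)]
      g_zero by (simp add: \<phi>_def norm_column)
  ultimately show ?thesis by (rule that)
qed

lemma integral_inner_le_of_mean_zero:
  fixes w g :: "real^'n \<Rightarrow> real^'m"
  assumes w: "is_BV \<Omega> w" and g: "C1_compact \<Omega> g" and mean: "(\<integral>x. g x \<partial>M) = 0"
  shows "(\<integral>x. g x \<bullet> w x \<partial>M) \<le> (\<integral>x. norm (g x) \<partial>M) * total_variation \<Omega> w"
proof -
  from mean_zero_eq_mdiv[OF g mean] obtain \<phi> where \<phi>: "C1_compact \<Omega> \<phi>" "\<And>x. mdiv \<phi> x = g x"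
    "\<And>x. norm (\<phi> x) \<le> (\<integral>x. norm (g x) \<partial>M)" by blast
  show ?thesis using integral_inner_mdiv_le[OF open_domain w \<phi>(1,3)] by (simp add: \<phi>(2) inner_commute)
qed

lemma subtract_mean:
  fixes g :: "real^'n \<Rightarrow> real^'m"
  assumes \<eta>: "C1_compact \<Omega> \<eta>" "\<And>x. 0 \<le> \<eta> x" "(\<integral>x. \<eta> x \<partial>M) = 1" and g: "C1_compact \<Omega> g"
  defines "h \<equiv> \<lambda>x. g x - \<eta> x *\<^sub>R (\<integral>x. g x \<partial>M)"
  shows "C1_compact \<Omega> h" "(\<integral>x. h x \<partial>M) = 0" "(\<integral>x. norm (h x) \<partial>M) \<le> 2 * (\<integral>x. norm (g x) \<partial>M)"
proof -
  let ?c = "\<integral>x. g x \<partial>M"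
  note g_int = integrable_C1_compact[OF g] and \<eta>_int = integrable_C1_compact[OF \<eta>(1)]
  have "C1_compact \<Omega> (\<lambda>x. \<eta> x *\<^sub>R - ?c)"
    by (rule C1_compact_bounded_linear[OF bounded_linear_scaleR_left \<eta>(1)])
  from C1_compact_add[OF g this] show h: "C1_compact \<Omega> h" by (simp add: h_def)
  show "(\<integral>x. h x \<partial>M) = 0" using g_int \<eta>_int \<eta>(3) by (simp add: h_def)
  have "(\<integral>x. norm (h x) \<partial>M) \<le> (\<integral>x. norm (g x) + \<eta> x * norm ?c \<partial>M)"
  proof (rule integral_mono)
    show "norm (h x) \<le> norm (g x) + \<eta> x * norm ?c" for x
      using norm_triangle_ineq4[of "g x" "\<eta> x *\<^sub>R ?c"] \<eta>(2)[of x] by (simp add: h_def)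
  qed (use integrable_C1_compact[OF h] g_int \<eta>_int in simp_all)
  also have "\<dots> = (\<integral>x. norm (g x) \<partial>M) + norm ?c" using g_int \<eta>_int \<eta>(3) by simp
  also have "\<dots> \<le> 2 * (\<integral>x. norm (g x) \<partial>M)" using integral_norm_bound[of M g] by simp
  finally show "(\<integral>x. norm (h x) \<partial>M) \<le> 2 * (\<integral>x. norm (g x) \<partial>M)" .
qed

lemma integral_inner_le_of_unit_bump:
  fixes w g :: "real^'n \<Rightarrow> real^'m"
  assumes \<eta>: "C1_compact \<Omega> \<eta>" "\<And>x. 0 \<le> \<eta> x" "(\<integral>x. \<eta> x \<partial>M) = 1" and B: "\<And>x. \<eta> x \<le> B"
    and w: "is_BV \<Omega> w" and g: "C1_compact \<Omega> g"
  shows "(\<integral>x. g x \<bullet> w x \<partial>M)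
    \<le> (B * (\<integral>x. norm (w x) \<partial>M) + 2 * total_variation \<Omega> w) * (\<integral>x. norm (g x) \<partial>M)"
proof -
  define L where "L = (\<integral>x. norm (g x) \<partial>M)"
  define V where "V = total_variation \<Omega> w"
  define c where "c = (\<integral>x. g x \<partial>M)"
  let ?h = "\<lambda>x. g x - \<eta> x *\<^sub>R c"
  note h = subtract_mean[OF \<eta> g, folded c_def L_def]
  have w_int: "integrable M w" using w by (simp add: is_BV_def)
  have "(\<integral>x. ?h x \<bullet> w x \<partial>M) \<le> (\<integral>x. norm (?h x) \<partial>M) * V"
    unfolding V_def by (rule integral_inner_le_of_mean_zero[OF w h(1,2)])
  also have "\<dots> \<le> 2 * L * V"
    using h(3) total_variation_nonneg[OF open_domain w] by (simp add: V_def mult_right_mono)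
  finally have mean_zero_part: "(\<integral>x. ?h x \<bullet> w x \<partial>M) \<le> 2 * L * V" .
  have \<eta>c: "C1_compact \<Omega> (\<lambda>x. \<eta> x *\<^sub>R c)"
    by (rule C1_compact_bounded_linear[OF bounded_linear_scaleR_left \<eta>(1)])
  have "norm c \<le> L" using integral_norm_bound[of M g] by (simp add: L_def c_def)
  then have \<eta>c_le: "norm (\<eta> x *\<^sub>R c) \<le> B * L" for x
    using B[of x] \<eta>(2)[of x] by (auto intro!: mult_mono)
  then have mean_part: "\<bar>\<integral>x. (\<eta> x *\<^sub>R c) \<bullet> w x \<partial>M\<bar> \<le> B * L * (\<integral>x. norm (w x) \<partial>M)"
    by (intro integral_inner_bounded_le[OF w_int] borel_measurable_lebesgue_on C1_compactD(5)[OF \<eta>c])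
  obtain D where D: "\<And>x. norm (?h x) \<le> D" using C1_compact_bounded[OF h(1)] by blast
  have "integrable M (\<lambda>x. ?h x \<bullet> w x)" "integrable M (\<lambda>x. (\<eta> x *\<^sub>R c) \<bullet> w x)"
    by (rule integrable_inner_bounded[OF w_int borel_measurable_lebesgue_on[OF C1_compactD(5)[OF h(1)]] D],
        rule integrable_inner_bounded[OF w_int borel_measurable_lebesgue_on[OF C1_compactD(5)[OF \<eta>c]] \<eta>c_le])
  then have "(\<integral>x. g x \<bullet> w x \<partial>M) = (\<integral>x. ?h x \<bullet> w x \<partial>M) + (\<integral>x. (\<eta> x *\<^sub>R c) \<bullet> w x \<partial>M)"
    by (subst Bochner_Integration.integral_add[symmetric]) (auto simp: inner_diff_left)
  also have "\<dots> \<le> (B * (\<integral>x. norm (w x) \<partial>M) + 2 * V) * L"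
    using mean_zero_part mean_part by (simp add: algebra_simps)
  finally show ?thesis by (simp add: L_def V_def)
qed

lemma exists_sup_bound:
  obtains C where "0 \<le> C" "\<And>w :: real^'n \<Rightarrow> real^'m. is_BV \<Omega> w \<Longrightarrow>
    AE x in M. norm (w x) \<le> C * (\<integral>x. norm (w x) \<partial>M) + 2 * total_variation \<Omega> w"
proof -
  obtain \<eta> :: "real^'n \<Rightarrow> real" where \<eta>: "C1_compact \<Omega> \<eta>" "\<And>x. 0 \<le> \<eta> x" "(\<integral>x. \<eta> x \<partial>M) = 1"
    using exists_unit_bump[OF nonempty_domain] by blast
  obtain C where C: "0 \<le> C" "\<And>x. norm (\<eta> x) \<le> C" using C1_compact_bounded[OF \<eta>(1)] by blast
  have "AE x in M. norm (w x) \<le> C * (\<integral>x. norm (w x) \<partial>M) + 2 * total_variation \<Omega> w"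
    if w: "is_BV \<Omega> w" for w :: "real^'n \<Rightarrow> real^'m"
  proof (rule AE_norm_le_of_duality)
    show "integrable M w" using w by (simp add: is_BV_def)
    show "0 \<le> C * (\<integral>x. norm (w x) \<partial>M) + 2 * total_variation \<Omega> w"
      using C(1) total_variation_nonneg[OF open_domain w] by simp
    have "\<eta> x \<le> C" for x using C(2)[of x] by simp
    then show "(\<integral>x. g x \<bullet> w x \<partial>M) \<le> (C * (\<integral>x. norm (w x) \<partial>M) + 2 * total_variation \<Omega> w) * (\<integral>x. norm (g x) \<partial>M)"
      if "C1_compact \<Omega> g" for g
      using that by (intro integral_inner_le_of_unit_bump[OF \<eta> _ w])
  qed
  with C(1) that show ?thesis by blast
qed

end

section \<open>Convergence of the minimizers\<close>

context denoising
begin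

lemma L2_norm_le_of_real_energy:
  assumes "admissible w"
  shows "L2_norm M w \<le> sqrt (2 * real_energy w / lam) + L2_norm M f"
proof -
  have sq: "square_integrable M w" and bv: "is_BV \<Omega> w" using assms by (simp_all add: admissible_def)
  have "(L2_norm M (\<lambda>x. w x - f x))\<^sup>2 \<le> 2 * real_energy w / lam"
    using total_variation_nonneg[OF open_domain bv] lam by (simp add: real_energy_def field_simps)
  then have "L2_norm M (\<lambda>x. w x - f x) \<le> sqrt (2 * real_energy w / lam)" by (rule real_le_rsqrt)
  moreover have "L2_norm M w - L2_norm M f \<le> L2_norm M (\<lambda>x. w x - f x)"
    using abs_L2_norm_diff_le[OF sq f] by simp
  ultimately show ?thesis by simp
qed

lemma almost_minimizers_AE_bounded:
  assumes card: "CARD('n) = 1" and connected: "connected \<Omega>" and nonempty: "\<Omega> \<noteq> {}"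
  obtains B where "\<And>\<epsilon> w. 0 \<le> \<epsilon> \<Longrightarrow> \<epsilon> \<le> E \<Longrightarrow> almost_minimizer \<epsilon> w \<Longrightarrow> AE x in M. norm (w x) \<le> B"
proof -
  obtain j :: 'n where "UNIV = {j}" using card by (rule card_1_singletonE)
  then interpret interval_domain \<Omega> j using connected nonempty by unfold_locales
  obtain C where C: "0 \<le> C" "\<And>w :: real^'n \<Rightarrow> real^'m. is_BV \<Omega> w \<Longrightarrow>
      AE x in M. norm (w x) \<le> C * (\<integral>x. norm (w x) \<partial>M) + 2 * total_variation \<Omega> w"
    using exists_sup_bound by blast
  define R where "R = real_energy (\<lambda>_. 0) + E"
  let ?L = "sqrt (measure M (space M)) * (sqrt (2 * R / lam) + L2_norm M f)"
  show ?thesis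
  proof (rule that)
    fix \<epsilon> w assume \<epsilon>: "0 \<le> \<epsilon>" "\<epsilon> \<le> E" and "almost_minimizer \<epsilon> w"
    then have w: "admissible w" and "real_energy w \<le> real_energy (\<lambda>_. 0) + \<epsilon>"
      using almost_minimizer_iff[OF \<epsilon>(1)] admissible_zero by blast+
    with \<epsilon> have R: "real_energy w \<le> R" by (simp add: R_def)
    have sq: "square_integrable M w" and bv: "is_BV \<Omega> w" using w by (simp_all add: admissible_def)
    have "sqrt (2 * real_energy w / lam) \<le> sqrt (2 * R / lam)" using R lam by (simp add: divide_right_mono)
    then have "L2_norm M w \<le> sqrt (2 * R / lam) + L2_norm M f"
      using L2_norm_le_of_real_energy[OF w] by linarith
    then have "sqrt (measure M (space M)) * L2_norm M w \<le> ?L" by (intro mult_left_mono) auto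
    then have "(\<integral>x. norm (w x) \<partial>M) \<le> ?L" using M.integral_norm_le_L2_norm[OF sq] by linarith
    then have "C * (\<integral>x. norm (w x) \<partial>M) \<le> C * ?L" using C(1) by (rule mult_left_mono)
    moreover have "0 \<le> lam/2 * (L2_norm M (\<lambda>x. w x - f x))\<^sup>2" using lam by simp
    with R have "total_variation \<Omega> w \<le> R" unfolding real_energy_def by linarith
    ultimately show "AE x in M. norm (w x) \<le> C * ?L + 2 * R"
      using C(2)[OF bv] by (auto elim!: eventually_mono)
  qed
qed

lemma almost_minimizer_Lp_tendsto:
  assumes connected: "connected \<Omega>" and nonempty: "\<Omega> \<noteq> {}"
    and u: "almost_minimizer 0 u" and w: "\<forall>\<^sub>F i in F. 0 \<le> \<epsilon> i \<and> almost_minimizer (\<epsilon> i) (w i)"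
    and \<epsilon>: "(\<epsilon> \<longlongrightarrow> 0) F"
    and p: "0 < p" "CARD('n) = 1 \<or> p < real CARD('n) / (real CARD('n) - 1)"
  shows "((\<lambda>i. \<integral>\<^sup>+x. ennreal (norm (w i x - u x) powr p) \<partial>M) \<longlongrightarrow> 0) F"
proof -
  have sq: "\<forall>\<^sub>F i in F. square_integrable M (\<lambda>x. w i x - u x)"
    using w u by (auto elim!: eventually_mono simp: almost_minimizer_iff admissible_def intro!: square_integrable_diff)
  note L2_lim = almost_minimizer_tendsto[OF u w \<epsilon>]
  consider (subquadratic) "p \<le> 2" | (one_dim) "2 \<le> p" "CARD('n) = 1"
  proof (cases "CARD('n) = 1")
    case False
    then have "2 \<le> CARD('n)" using zero_less_card_finite[where 'a = 'n] by linarith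
    then have "real CARD('n) / (real CARD('n) - 1) \<le> 2" by (simp add: field_simps)
    with p(2) False that(1) show ?thesis by simp
  qed linarith
  then show ?thesis
  proof cases
    case subquadratic
    then show ?thesis by (rule M.Lp_tendsto_0_of_L2[OF sq L2_lim p(1)])
  next
    case one_dim
    obtain B where B: "\<And>\<epsilon> w. 0 \<le> \<epsilon> \<Longrightarrow> \<epsilon> \<le> 1 \<Longrightarrow> almost_minimizer \<epsilon> w \<Longrightarrow> AE x in M. norm (w x) \<le> B"
      using almost_minimizers_AE_bounded[OF one_dim(2) connected nonempty] by blast
    have "\<forall>\<^sub>F i in F. \<epsilon> i < 1" using \<epsilon> by (rule order_tendstoD) simp
    with w have bounded: "\<forall>\<^sub>F i in F. AE x in M. norm (w i x - u x) \<le> B + B"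
    proof eventually_elim
      case (elim i)
      then have "AE x in M. norm (w i x) \<le> B" by (intro B[of "\<epsilon> i"]) auto
      moreover have "AE x in M. norm (u x) \<le> B" using B[OF _ _ u] by simp
      ultimately show ?case by eventually_elim (rule norm_triangle_le_diff, simp)
    qed
    show ?thesis by (rule Lp_tendsto_0_of_L2_of_bounded[OF sq L2_lim bounded one_dim(1)])
  qed
qed

end

theorem theorem2p3:
  fixes \<Omega> :: "(real^'n) set" and f :: "real^'n \<Rightarrow> real^'m"
    and lam :: real and u :: "real \<Rightarrow> real^'n \<Rightarrow> real^'m"
  assumes dom: "bounded \<Omega>" "lipschitz_domain \<Omega>"
    and lam: "lam > 0"
    and f_L2: "f \<in> borel_measurable (lebesgue_on \<Omega>)"
      "integrable (lebesgue_on \<Omega>) (\<lambda>x. (norm (f x))\<^sup>2)"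
    and umin: "\<And>\<mu>. \<mu> > 1 \<Longrightarrow> BV_minimizer \<Omega> (K_energy \<mu> \<Omega> lam f) (u \<mu>)"
  shows "\<exists>u0. BV_minimizer \<Omega> (TV_energy \<Omega> lam f) u0
     \<and> (\<forall>v. BV_minimizer \<Omega> (TV_energy \<Omega> lam f) v \<longrightarrow> (AE x in lebesgue_on \<Omega>. v x = u0 x))
     \<and> (\<forall>p::real. 1 \<le> p \<and> (CARD('n) = 1 \<or> p < real CARD('n) / (real CARD('n) - 1)) \<longrightarrow>
          ((\<lambda>\<mu>. \<integral>\<^sup>+x. ennreal ((norm (u \<mu> x - u0 x)) powr p) \<partial>lebesgue_on \<Omega>) \<longlongrightarrow> 0) at_top)
     \<and> integrable (lebesgue_on \<Omega>) (\<lambda>x. (norm (u0 x))\<^sup>2)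
     \<and> (\<forall>\<mu>>1. integrable (lebesgue_on \<Omega>) (\<lambda>x. (norm (u \<mu> x))\<^sup>2))
     \<and> (\<forall>g. g \<in> borel_measurable (lebesgue_on \<Omega>) \<longrightarrow>
            integrable (lebesgue_on \<Omega>) (\<lambda>x. (norm (g x))\<^sup>2) \<longrightarrow>
            ((\<lambda>\<mu>. \<integral>x. u \<mu> x \<bullet> g x \<partial>lebesgue_on \<Omega>) \<longlongrightarrow> (\<integral>x. u0 x \<bullet> g x \<partial>lebesgue_on \<Omega>)) at_top)"
proof -
  have domain: "open \<Omega>" "connected \<Omega>" "\<Omega> \<noteq> {}" using dom(2) by (simp_all add: lipschitz_domain_def)
  interpret denoising \<Omega> lam f
    using domain(1) dom(1) lam f_L2 by unfold_locales (simp_all add: square_integrable_def)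
  define \<epsilon> where "\<epsilon> \<mu> = measure M \<Omega> / (\<mu> - 2)" for \<mu>
  have \<epsilon>: "(\<epsilon> \<longlongrightarrow> 0) at_top" unfolding \<epsilon>_def by real_asymp
  have almost_min: "\<forall>\<^sub>F \<mu> in at_top. 0 \<le> \<epsilon> \<mu> \<and> almost_minimizer (\<epsilon> \<mu>) (u \<mu>)"
    using eventually_gt_at_top[of 2]
    by eventually_elim (simp add: \<epsilon>_def K_minimizer_almost_minimizer umin)
  obtain u0 where u0: "almost_minimizer 0 u0" using exists_minimizer by blast
  have u0_sq: "square_integrable M u0" using u0 by (simp add: almost_minimizer_iff admissible_def)
  have u_sq: "square_integrable M (u \<mu>)" if "1 < \<mu>" for \<mu>
    using K_minimizer_admissible[OF umin[OF that]] by (simp add: admissible_def)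
  have "\<forall>\<^sub>F \<mu> in at_top. square_integrable M (u \<mu>)"
    using eventually_gt_at_top[of 1] by eventually_elim (rule u_sq)
  note weak = integral_inner_tendsto_of_L2[OF this u0_sq almost_minimizer_tendsto[OF u0 almost_min \<epsilon>]]
  show ?thesis
    using u0 u_sq u0_sq minimizer_unique weak almost_minimizer_Lp_tendsto[OF domain(2,3) u0 almost_min \<epsilon>]
    by (intro exI[of _ u0]) (simp add: TV_minimizer_iff_almost_minimizer_0 square_integrable_def)
qed

end
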